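(* Let $m\le n$. Consider the mechanical system $$\dot q=\nabla_pH(q,p),\qquad \dot p=-\nabla_qH(q,p)+G(u+d),\qquad H(q,p)=\tfrac12p^\top M^{-1}(q)p+V(q),$$ with constant input matrix $G$, constant unknown disturbance $d\in\mathbb{R}^m$, and a feasible trajectory $x^\star(t)=[q^\star(t)^\top,p^\star(t)^\top]^\top$, $p^\star=M(q^\star)\dot q^\star$. Assume there exist a constant matrix $J_{d_{12}}\in\mathbb{R}^{n\times n}$, a positive definite $M_d:\mathbb{R}^n\to\mathbb{R}^{n\times n}$, a function $V_{d_2}:\mathbb{R}^n\times\mathbb{R}_+\to\mathbb{R}_+$, constant positive definite matrices $R_d\in\mathbb{R}^{n\times n}$, $K_\zeta\in\mathbb{R}^{m\times m}$, and constant matrices $W_1\in\mathbb{R}^{n\times m}$, $W_2,W_3\in\mathbb{R}^{m\times n}$ of rank $m$, such that, with $$\Theta(q,p,t)=\tfrac12\nabla_q\big(p^\top M_d^{-1}(q)p\big)+\nabla_qV_{d_2}(q,t),$$ $$\gamma_1(t)=(G^\top W_1K_\zeta)^{-1}\Big(G^\top\big(-J_{d_{12}}^\top\Theta(q^\star,p^\star,t)-R_dM_d^{-1}(q^\star)p^\star\big)-G^\top\dot p^\star\Big),$$ the following hold. (i) The matching equations $$M^{-1}(q)p=J_{d_{12}}M_d^{-1}(q)p,$$ $$G^\perp\big(\nabla_q(p^\top M^{-1}(q)p)-J_{d_{12}}^\top\nabla_q(p^\top M_d^{-1}(q)p)-2R_dM_d^{-1}(q)p\big)=0,$$ $$G^\perp\big(\nabla_qV-J_{d_{12}}^\top\nabla_qV_{d_2}+W_1K_\zeta(\zeta-\gamma_1)\big)=0$$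 hold identically (in $q,p,\zeta,t$, with $\zeta\in\mathbb{R}^m$). (ii) With $\eta=[q^\top,p^\top,\zeta^\top]^\top$, $\mu_1=(W_1K_\zeta)^\dagger Gd$ and $$\bar H_{d_2}(\eta,t)=\tfrac12p^\top M_d^{-1}(q)p+V_{d_2}(q,t)+\tfrac12(\zeta-\gamma_1(t)+\mu_1)^\top K_\zeta(\zeta-\gamma_1(t)+\mu_1),$$ the matrix $P_2=\begin{bmatrix}0&J_{d_{12}}&0\\ -J_{d_{12}}^\top&-R_d&W_1\\ W_2&W_3&0\end{bmatrix}$ is Hurwitz; there are constants $0<\alpha_2<\beta_2$ and an open set $D_2\subseteq\mathbb{R}^{2n+m}$ with $\alpha_2I\prec\nabla_\eta^2\bar H_{d_2}(\eta,t)\prec\beta_2I$ for all $\eta\in D_2$ and all $t$; and for some $\varepsilon_2>0$ the matrix $$N_2=\begin{bmatrix}P_2&\big(1-\frac{\alpha_2}{\beta_2}\big)P_2P_2^\top\\ -\big(1-\frac{\alpha_2}{\beta_2}+\varepsilon_2\big)I&-P_2^\top\end{bmatrix}$$ has no eigenvalues on the imaginary axis. (iii) $W_2\Theta(q^\star,p^\star,t)+W_3M_d^{-1}(q^\star)p^\star=0$ for all $t$. Then the controller $$u=G^\dagger\Big(-J_{d_{12}}^\top\Theta(q,p,t)-R_dM_d^{-1}(q)p+W_1K_\zeta(\zeta-\gamma_1(t))+\nabla_qH(q,p)\Big),$$ with $$\dot\zeta=W_2\Theta(q,p,t)+W_3M_d^{-1}(q)p,$$ makes the system a local exponential tracker for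 $x^\star(t)$ while eliminating the effect of the constant disturbance $d$; that is, locally, the $(q,p)$-trajectories of the closed loop with the disturbance $d$ present converge exponentially to $x^\star(t)$.
   Context: $q,p\in\mathbb{R}^n$ are positions and momenta, $u\in\mathbb{R}^m$ the input, $M(q)\succ0$ the inertia matrix, $V:\mathbb{R}^n\to\mathbb{R}_+$ the potential energy, $G\in\mathbb{R}^{n\times m}$ with $\mathrm{rank}(G)=m\le n$. All functions are sufficiently smooth. $A\succ0$ means $A$ is (symmetric) positive definite. $\nabla$ denotes the column gradient, $\nabla^2$ the Hessian. For full-column-rank $g$, $g^\dagger=(g^\top g)^{-1}g^\top$. $G^\perp$ is a full-rank left annihilator of $G$ ($G^\perp G=0$, $G^\perp\in\mathbb{R}^{(n-m)\times n}$). A matrix is Hurwitz if all its eigenvalues have strictly negative real parts. A feasible trajectory is a function $x^\star=[{q^\star}^\top,{p^\star}^\top]^\top$ of time for which there is an input $u^\star(t)$ such that $\dot q^\star=\nabla_pH(q^\star,p^\star)$ and $\dot p^\star=-\nabla_qH(q^\star,p^\star)+Gu^\star$ for all $t$ in its time domain, here $\mathbb{R}_+$. A system $\dot x=f(x,t)$ is contractive on an open set $D$ if there are a symmetric matrix function $Q(x,t)$, uniformly positive definite and bounded, and $\lambda>0$ with $\frac{\partial f}{\partial x}^\top Q+Q\frac{\partial f}{\partial x}+\dot Q\preceq-2\lambda Q$ on $D$ for all $t$. Local exponential tracking is understood in the sense of the convergence property of contractive systems (Lohmiller and Slotine): trajectories starting in a ball (with respect to the contraction metric) centered at the desired trajectory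 of the (extended) closed-loop system, this moving ball being contained at all times in the contraction region ($D_2$ here), remain in that ball and converge exponentially to the desired trajectory as $t\to\infty$. *)

theory Defs
  imports "HOL-Analysis.Analysis"
begin

(* On UNIV, UNIV \<times> {0..} and {0..}, the only sets on which this is used, derivatives within S
   are unique, and this is C^k up to the boundary: all iterated directional derivatives of
   order at most k exist and are continuous. *)
primrec Ck_on :: "nat \<Rightarrow> 'a::real_normed_vector set \<Rightarrow> ('a \<Rightarrow> 'b::real_normed_vector) \<Rightarrow> bool" where
  "Ck_on 0 S f \<longleftrightarrow> continuous_on S f"
| "Ck_on (Suc k) S f \<longleftrightarrow>
     (\<exists>f'. (\<forall>x\<in>S. (f has_derivative f' x) (at x within S)) \<and> (\<forall>v. Ck_on k S (\<lambda>x. f' x v)))"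

definition grad :: "(real^'k \<Rightarrow> real) \<Rightarrow> real^'k \<Rightarrow> real^'k" where
  "grad f x = (\<chi> i. frechet_derivative f (at x) (axis i 1))"

definition hessian :: "(real^'k \<Rightarrow> real) \<Rightarrow> real^'k \<Rightarrow> real^'k^'k" where
  "hessian f x = jacobian (grad f) (at x)"

definition pos_def :: "real^'k^'k \<Rightarrow> bool" where
  "pos_def A \<longleftrightarrow> transpose A = A \<and> (\<forall>x. x \<noteq> 0 \<longrightarrow> 0 < x \<bullet> (A *v x))"

definition pos_semidef :: "real^'k^'k \<Rightarrow> bool" where
  "pos_semidef A \<longleftrightarrow> transpose A = A \<and> (\<forall>x. 0 \<le> x \<bullet> (A *v x))"

definition matrix_eigenvalue :: "real^'k^'k \<Rightarrow> complex \<Rightarrow> bool" where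
  "matrix_eigenvalue A l \<longleftrightarrow> (\<exists>v::complex^'k. v \<noteq> 0 \<and> map_matrix complex_of_real A *v v = l *s v)"

definition hurwitz :: "real^'k^'k \<Rightarrow> bool" where
  "hurwitz A \<longleftrightarrow> (\<forall>l. matrix_eigenvalue A l \<longrightarrow> Re l < 0)"

definition pseudo_inv :: "real^'b^'a \<Rightarrow> real^'a^'b" where
  "pseudo_inv g = matrix_inv (transpose g ** g) ** transpose g"

(* The (n - m) \<times> n matrix is given by the list of its rows, since n - m may be 0 and no index
   type is empty; its product with a column x vanishes iff g \<bullet> x = 0 for each row g. *)
definition full_rank_left_annihilator :: "(real^'n) list \<Rightarrow> real^'m^'n \<Rightarrow> bool" where
  "full_rank_left_annihilator Gp G \<longleftrightarrow>
     length Gp = CARD('n) - CARD('m) \<and> distinct Gp \<and> independent (set Gp) \<and>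
     (\<forall>g\<in>set Gp. g v* G = 0)"

definition vec3 :: "'x^'a \<Rightarrow> 'x^'b \<Rightarrow> 'x^'c \<Rightarrow> 'x^('a + 'b + 'c)" where
  "vec3 u v w = (\<chi> i. case i of Inl a \<Rightarrow> u $ a | Inr (Inl b) \<Rightarrow> v $ b | Inr (Inr c) \<Rightarrow> w $ c)"

definition blk1 :: "'x^('a::finite + 'b::finite + 'c::finite) \<Rightarrow> 'x^'a" where "blk1 x = (\<chi> a. x $ Inl a)"
definition blk2 :: "'x^('a::finite + 'b::finite + 'c::finite) \<Rightarrow> 'x^'b" where "blk2 x = (\<chi> b. x $ Inr (Inl b))"
definition blk3 :: "'x^('a::finite + 'b::finite + 'c::finite) \<Rightarrow> 'x^'c" where "blk3 x = (\<chi> c. x $ Inr (Inr c))"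

definition block3x3 ::
  "'x^'a^'d \<Rightarrow> 'x^'b^'d \<Rightarrow> 'x^'c^'d \<Rightarrow>
   'x^'a^'e \<Rightarrow> 'x^'b^'e \<Rightarrow> 'x^'c^'e \<Rightarrow>
   'x^'a^'f \<Rightarrow> 'x^'b^'f \<Rightarrow> 'x^'c^'f \<Rightarrow> 'x^('a + 'b + 'c)^('d + 'e + 'f)" where
  "block3x3 A11 A12 A13 A21 A22 A23 A31 A32 A33 =
     (\<chi> i. case i of Inl a \<Rightarrow> vec3 (A11 $ a) (A12 $ a) (A13 $ a)
                  | Inr (Inl b) \<Rightarrow> vec3 (A21 $ b) (A22 $ b) (A23 $ b)
                  | Inr (Inr c) \<Rightarrow> vec3 (A31 $ c) (A32 $ c) (A33 $ c))"

definition block2x2 ::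
  "'x^'a^'c \<Rightarrow> 'x^'b^'c \<Rightarrow> 'x^'a^'d \<Rightarrow> 'x^'b^'d \<Rightarrow> 'x^('a + 'b)^('c + 'd)" where
  "block2x2 A B C D =
     (\<chi> i j. case i of
        Inl c \<Rightarrow> (case j of Inl a \<Rightarrow> A $ c $ a | Inr b \<Rightarrow> B $ c $ b)
      | Inr d \<Rightarrow> (case j of Inl a \<Rightarrow> C $ d $ a | Inr b \<Rightarrow> D $ d $ b))"

(* A vector field is written f x t, and time ranges over {0..}. *)

definition solves_on :: "(real^'k \<Rightarrow> real \<Rightarrow> real^'k) \<Rightarrow> real set \<Rightarrow> (real \<Rightarrow> real^'k) \<Rightarrow> bool" where
  "solves_on f I x \<longleftrightarrow> (\<forall>t\<in>I. (x has_vector_derivative f (x t) t) (at t within I))"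

definition deriv_along ::
  "(real^'k \<Rightarrow> real \<Rightarrow> real^'k) \<Rightarrow> (real^'k \<Rightarrow> real \<Rightarrow> real^'k^'k) \<Rightarrow> real^'k \<Rightarrow> real \<Rightarrow> real^'k^'k" where
  "deriv_along f Q x t =
     frechet_derivative (\<lambda>(y, s). Q y s) (at (x, t) within UNIV \<times> {0..}) (f x t, 1)"

definition contractive_with ::
  "(real^'k \<Rightarrow> real \<Rightarrow> real^'k) \<Rightarrow> (real^'k) set \<Rightarrow> (real^'k \<Rightarrow> real \<Rightarrow> real^'k^'k) \<Rightarrow> real \<Rightarrow> bool" where
  "contractive_with f D Q r \<longleftrightarrow>
     open D \<and> 0 < r \<and>
     Ck_on 1 (UNIV \<times> {0..}) (\<lambda>(x, t). Q x t) \<and>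
     (\<exists>a b. 0 < a \<and> (\<forall>x. \<forall>t\<ge>0. pos_semidef (Q x t - mat a) \<and> pos_semidef (mat b - Q x t))) \<and>
     (\<forall>x\<in>D. \<forall>t\<ge>0. (\<lambda>y. f y t) differentiable (at x) \<and>
        (let A = jacobian (\<lambda>y. f y t) (at x) in
           pos_semidef (- (2 * r) *\<^sub>R Q x t
                        - (transpose A ** Q x t + Q x t ** A + deriv_along f Q x t))))"

definition metric_length :: "(real^'k \<Rightarrow> real^'k^'k) \<Rightarrow> (real \<Rightarrow> real^'k) \<Rightarrow> real" where
  "metric_length S c = integral {0..1}
     (\<lambda>s. sqrt (vector_derivative c (at s) \<bullet> (S (c s) *v vector_derivative c (at s))))"

(* C^1 rather than piecewise C^1 curves: the library's notion of piecewise C^1 allows curves with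
   unbounded derivative, whose length integral may be the default value 0. *)
definition metric_dist :: "(real^'k \<Rightarrow> real^'k^'k) \<Rightarrow> real^'k \<Rightarrow> real^'k \<Rightarrow> real" where
  "metric_dist S x y = Inf (metric_length S ` {c. c C1_differentiable_on {0..1} \<and> c 0 = x \<and> c 1 = y})"

definition metric_ball :: "(real^'k \<Rightarrow> real^'k^'k) \<Rightarrow> real^'k \<Rightarrow> real \<Rightarrow> (real^'k) set" where
  "metric_ball S x r = {y. metric_dist S x y < r}"

(* Whenever the moving metric ball around xs stays in D, trajectories starting in it exist for all
   future times, cannot leave it, and converge exponentially to xs, with constants that depend
   neither on the radius nor on the trajectory. Arbitrary compact time intervals are considered
   so that no trajectory can leave the ball and then cease to exist. *)
definition exp_attracts_balls ::
  "(real^'k \<Rightarrow> real \<Rightarrow> real^'k) \<Rightarrow> (real^'k) set \<Rightarrow> (real^'k \<Rightarrow> real \<Rightarrow> real^'k^'k) \<Rightarrow> (real \<Rightarrow> real^'k) \<Rightarrow> bool" where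
  "exp_attracts_balls f D Q xs \<longleftrightarrow>
     (\<exists>C>0. \<exists>k>0. \<forall>r>0.
        (\<forall>t\<ge>0. metric_ball (\<lambda>y. Q y t) (xs t) r \<subseteq> D) \<longrightarrow>
        (\<forall>t0\<ge>0. \<forall>x0 \<in> metric_ball (\<lambda>y. Q y t0) (xs t0) r.
           (\<exists>x. solves_on f {t0..} x \<and> x t0 = x0) \<and>
           (\<forall>T x. solves_on f {t0..T} x \<and> x t0 = x0 \<longrightarrow>
              (\<forall>t\<in>{t0..T}. x t \<in> metric_ball (\<lambda>y. Q y t) (xs t) r \<and>
                 norm (x t - xs t) \<le> C * exp (- k * (t - t0)) * norm (x0 - xs t0)))))"

(* f is the closed loop in the extended state (q, p, z); its desired trajectory extends the given
   (qs, ps) by a trajectory zs of the controller state. *)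
definition local_exponential_tracker ::
  "(real^('n + 'n + 'm::finite) \<Rightarrow> real \<Rightarrow> real^('n + 'n + 'm)) \<Rightarrow> (real^('n + 'n + 'm)) set \<Rightarrow>
   (real \<Rightarrow> real^'n) \<Rightarrow> (real \<Rightarrow> real^'n) \<Rightarrow> bool" where
  "local_exponential_tracker f D qs ps \<longleftrightarrow>
     (\<exists>zs Q r. solves_on f {0..} (\<lambda>t. vec3 (qs t) (ps t) (zs t)) \<and>
        contractive_with f D Q r \<and>
        exp_attracts_balls f D Q (\<lambda>t. vec3 (qs t) (ps t) (zs t)))"

definition hamiltonian ::
  "(real^'n \<Rightarrow> real^'n^'n) \<Rightarrow> (real^'n \<Rightarrow> real) \<Rightarrow> real^'n \<Rightarrow> real^'n \<Rightarrow> real" where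
  "hamiltonian M V q p = 1/2 * (p \<bullet> (matrix_inv (M q) *v p)) + V q"

(* Feasibility refers to the undisturbed system. *)
definition feasible_trajectory ::
  "(real^'n \<Rightarrow> real^'n \<Rightarrow> real) \<Rightarrow> real^'m^'n \<Rightarrow> (real \<Rightarrow> real^'n) \<Rightarrow> (real \<Rightarrow> real^'n) \<Rightarrow> bool" where
  "feasible_trajectory H G qs ps \<longleftrightarrow>
     (\<exists>us :: real \<Rightarrow> real^'m. \<forall>t\<ge>0.
        (qs has_vector_derivative grad (\<lambda>p. H (qs t) p) (ps t)) (at t within {0..}) \<and>
        (ps has_vector_derivative (- grad (\<lambda>q. H q (ps t)) (qs t) + G *v us t)) (at t within {0..}))"

end

theory Submission
  imports Defs "HOL-Computational_Algebra.Fundamental_Theorem_Algebra"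
begin

text \<open>
  By the matching equations the disturbed closed loop is \<open>\<eta>' = P\<^sub>2 \<nabla>H\<close> with \<open>H\<close> the function
  \<open>Hd2\<close>; here \<open>G d = W\<^sub>1 K\<^sub>\<zeta> \<mu>\<^sub>1\<close> because \<open>W\<^sub>1 K\<^sub>\<zeta>\<close> and \<open>G\<close> have the same range, so the disturbance only
  shifts \<open>\<zeta>\<close>, and the desired trajectory is extended by the constant \<open>\<zeta> = - \<mu>\<^sub>1\<close>.

  It remains to find a constant contraction metric \<open>Q\<close> for all Jacobians \<open>P S\<close> with \<open>P = P\<^sub>2\<close>
  and \<open>\<alpha> I < S < \<beta> I\<close>. Put \<open>\<delta> = 1 - \<alpha> / \<beta>\<close>, \<open>\<theta> = \<delta> (\<delta> + \<epsilon>)\<close> and \<open>Z = P\<^sup>-\<^sup>1\<close>. As \<open>N\<^sub>2\<close> has no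
  imaginary eigenvalue, \<open>|(i \<omega> Z - I) x|\<^sup>2 > \<theta> |x|\<^sup>2\<close> for all real \<open>\<omega>\<close> and complex \<open>x \<noteq> 0\<close>. By convex
  duality, as in Rantzer's proof of the Kalman-Yakubovich-Popov lemma, there is a symmetric \<open>Q\<close>
  with \<open>2 x\<^sup>T Q v \<le> |Z v - x|\<^sup>2 - \<theta> |x|\<^sup>2\<close>. Choosing \<open>v = P S x / \<beta>\<close>, where \<open>|S x / \<beta> - x| \<le> \<delta> |x|\<close>,
  gives \<open>2 x\<^sup>T Q P S x \<le> - \<beta> \<delta> \<epsilon> |x|\<^sup>2\<close>, and \<open>v = P x\<close> gives the Lyapunov inequality which, \<open>P\<close> being
  Hurwitz, makes \<open>Q\<close> positive definite.
\<close>

text \<open>One constant \<open>Q\<close> has to serve every Hessian \<open>S\<close> between the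
  bounds, an infinite family that varies with state and time. Of \<open>v = P S x / \<beta>\<close>
  only the constraint \<open>|Z v - x| \<le> \<delta> |x|\<close> is kept, and
  \<open>\<theta> = \<delta> (\<delta> + \<epsilon>)\<close> has to exceed \<open>\<delta>^2\<close>
  for the quadratic bound to leave a negative remainder; the \<open>\<epsilon>\<close> in the lower
  left corner of the Hamiltonian matrix supplies this excess. The absence of imaginary eigenvalues
  says only that a Hermitian form depending on \<open>\<omega>\<close> is never singular. The form
  is positive for large \<open>\<omega>\<close> because \<open>Z\<close> is invertible, and on the
  way down it could lose positivity only by first becoming semidefinite and singular. A constant
  metric has no derivative along the flow, and its balls are ellipsoids, whose convexity allows
  derivative bounds to be integrated along segments. The tracking property also demands solutions
  for all future times, although the derivative of the field is controlled only on
  \<open>D2\<close>; this is why the field is truncated and a global existence theorem is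
  proved.\<close>

section \<open>The frequency condition\<close>

text \<open>A null vector minimises a semidefinite form, so the term of
  \<open>B (w + t v) (w + t v)\<close> that is linear in \<open>t\<close> must vanish. This turns an
  extremal point into an eigenvector equation, both for the frequency condition and for the Rayleigh
  quotient.\<close>

lemma psd_form_zero:
  fixes B :: "'a::real_vector \<Rightarrow> 'a \<Rightarrow> real"
  assumes S: "subspace S" and B: "bilinear B" and sym: "\<And>x y. B x y = B y x"
    and nn: "\<And>x. x \<in> S \<Longrightarrow> 0 \<le> B x x"
    and w: "w \<in> S" "B w w = 0" and v: "v \<in> S"
  shows "B w v = 0"
proof (rule ccontr)
  assume ne: "B w v \<noteq> 0"
  define a b where "a = B w v" and "b = B v v"
  have exp: "B (t *\<^sub>R v + w) (t *\<^sub>R v + w) = t\<^sup>2 * b + 2 * t * a" for t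
    using w(2) sym[of v w]
    by (simp add: bilinear_ladd[OF B] bilinear_radd[OF B] bilinear_lmul[OF B] bilinear_rmul[OF B]
        a_def b_def power2_eq_square algebra_simps)
  have ge: "0 \<le> t\<^sup>2 * b + 2 * t * a" for t
    unfolding exp[symmetric] using S v w by (intro nn) (simp add: subspace_add subspace_scale)
  have b: "0 \<le> b" using nn v by (simp add: b_def)
  \<comment> \<open>The minimiser would be \<open>- a / b\<close>; adding 1 keeps the denominator
    positive when \<open>b = 0\<close> and still makes the value negative.\<close>
  define t where "t = - a / (b + 1)"
  have t: "t * (b + 1) = - a" using b by (simp add: t_def)
  have "(b + 1)\<^sup>2 * (t\<^sup>2 * b + 2 * t * a) = (t * (b + 1))\<^sup>2 * b + 2 * (t * (b + 1)) * a * (b + 1)"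
    by (simp add: power2_eq_square algebra_simps)
  also have "\<dots> = - (a\<^sup>2 * (b + 2))" unfolding t by (simp add: power2_eq_square algebra_simps)
  also have "\<dots> < 0" using b ne by (simp add: a_def)
  finally show False using ge[of t] b by (simp add: mult_less_0_iff)
qed

section \<open>Complex vectors as pairs of real vectors, and vectors in two blocks\<close>

definition cvec :: "real^'k \<Rightarrow> real^'k \<Rightarrow> complex^'k" where
  "cvec x y = (\<chi> i. Complex (x $ i) (y $ i))"

lemma cvec_eq_0_iff: "cvec x y = 0 \<longleftrightarrow> x = 0 \<and> y = 0"
  by (auto simp: cvec_def vec_eq_iff complex_eq_iff)

lemma cvec_eq_iff: "cvec x y = cvec x' y' \<longleftrightarrow> x = x' \<and> y = y'"
  by (auto simp: cvec_def vec_eq_iff complex_eq_iff)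

lemma cvec_Re_Im: "cvec (\<chi> i. Re (v $ i)) (\<chi> i. Im (v $ i)) = v"
  by (simp add: cvec_def vec_eq_iff complex_eq_iff)

lemma matrix_mult_cvec: "map_matrix complex_of_real A *v cvec x y = cvec (A *v x) (A *v y)"
  by (simp add: cvec_def vec_eq_iff matrix_vector_mult_def complex_eq_iff)

lemma scale_cvec: "Complex a b *s cvec x y = cvec (a *\<^sub>R x - b *\<^sub>R y) (b *\<^sub>R x + a *\<^sub>R y)"
  by (simp add: cvec_def vec_eq_iff complex_eq_iff)

lemma sum_plus_type: "(\<Sum>i\<in>(UNIV::('a::finite + 'b::finite) set). f i) = (\<Sum>i\<in>UNIV. f (Inl i)) + (\<Sum>i\<in>UNIV. f (Inr i))"
  for f :: "_ \<Rightarrow> 'c::comm_monoid_add"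
  unfolding UNIV_Plus_UNIV[symmetric] by (subst sum.Plus) (auto simp: o_def)

definition vec2 :: "'x^'a \<Rightarrow> 'x^'b \<Rightarrow> 'x^('a + 'b)" where
  "vec2 u v = (\<chi> i. case i of Inl a \<Rightarrow> u $ a | Inr b \<Rightarrow> v $ b)"

lemma vec2_eq_iff: "vec2 u v = vec2 u' v' \<longleftrightarrow> u = u' \<and> v = v'"
proof
  assume *: "vec2 u v = vec2 u' v'"
  have "u $ i = u' $ i" for i using arg_cong[OF *, of "\<lambda>x. x $ Inl i"] by (simp add: vec2_def)
  moreover have "v $ i = v' $ i" for i using arg_cong[OF *, of "\<lambda>x. x $ Inr i"] by (simp add: vec2_def)
  ultimately show "u = u' \<and> v = v'" by (simp add: vec_eq_iff)
qed simp

lemma block2x2_mult_vec2: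
  fixes A :: "real^'a^'c"
  shows "block2x2 A B C D *v vec2 x y = vec2 (A *v x + B *v y) (C *v x + D *v y)"
  by (auto simp: vec_eq_iff vec2_def block2x2_def matrix_vector_mult_def sum_plus_type split: sum.splits)

lemma cvec_vec2_eq_0_iff: "cvec (vec2 x y) (vec2 x' y') = 0 \<longleftrightarrow> x = 0 \<and> y = 0 \<and> x' = 0 \<and> y' = 0"
proof -
  have "(0::real^('a+'b)) = vec2 0 0" by (simp add: vec2_def vec_eq_iff split: sum.splits)
  then show ?thesis by (metis cvec_eq_0_iff vec2_eq_iff)
qed

lemma vec2_scaleR: "r *\<^sub>R vec2 x y = vec2 (r *\<^sub>R x) (r *\<^sub>R y)"
  by (auto simp: vec2_def vec_eq_iff split: sum.splits)

lemma uminus_matrix_vector_mult: "(- A) *v x = - (A *v (x::real^'n))"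
  by (simp add: matrix_vector_mult_def vec_eq_iff sum_negf)

lemma matrix_vector_mult_uminus: "A *v (- x) = - (A *v (x::real^'n))"
  by (simp add: matrix_vector_mult_def vec_eq_iff sum_negf)

lemma mat_mult_vector: "mat c *v x = c *\<^sub>R (x::real^'n)"
  by (simp add: matrix_vector_mult_def mat_def vec_eq_iff if_distrib if_distribR cong: if_cong)

text \<open>The real pair \<open>(x, y)\<close> stands for the complex vector \<open>x + i y\<close>; the left-hand side is the
  squared norm of \<open>(i w Z - I) (x + i y)\<close>.\<close>

lemma hamiltonian_matrix_frequency_condition:
  fixes P Z :: "real^'k^'k"
  assumes PZ: "P ** Z = mat 1" and d: "0 < \<delta>" and c: "0 < c"
    and N: "\<And>l. matrix_eigenvalue (block2x2 P (\<delta> *\<^sub>R (P ** transpose P)) (- mat c) (- transpose P)) l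
              \<Longrightarrow> Re l \<noteq> 0"
    and ne: "(x, y) \<noteq> 0"
  shows "\<delta> * c * ((norm x)\<^sup>2 + (norm y)\<^sup>2)
           < (norm (\<omega> *\<^sub>R (Z *v y) + x))\<^sup>2 + (norm (\<omega> *\<^sub>R (Z *v x) - y))\<^sup>2"
proof -
  define \<theta> where "\<theta> = \<delta> * c"
  have \<theta>: "0 < \<theta>" using d c by (simp add: \<theta>_def)
  \<comment> \<open>The first component is the negative of the real part of
    \<open>(i \<omega> Z - I) (x + i y)\<close>, the second is the imaginary part. Thus
    \<open>B \<omega>\<close> is the real bilinear form behind the inequality, and the claim is that
    it is positive.\<close>
  define h where "h = (\<lambda>\<omega> (w :: (real^'k) \<times> (real^'k)). (\<omega> *\<^sub>R (Z *v snd w) + fst w, \<omega> *\<^sub>R (Z *v fst w) - snd w))"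
  define B where "B = (\<lambda>\<omega> w w'. h \<omega> w \<bullet> h \<omega> w' - \<theta> * (w \<bullet> w'))"
  have blin: "bilinear (B \<omega>)" for \<omega>
    unfolding bilinear_def B_def h_def
    by (auto intro!: linearI simp: matrix_vector_right_distrib matrix_vector_mult_scaleR inner_Pair
        inner_add_left inner_add_right inner_diff_left inner_diff_right algebra_simps)
  have sym: "B \<omega> w w' = B \<omega> w' w" for \<omega> w w' by (simp add: B_def inner_commute)
  have PZx: "P *v (Z *v x) = x" for x by (simp add: matrix_vector_mul_assoc PZ)
  \<comment> \<open>With \<open>A = i \<omega> Z - I\<close>, a null vector \<open>w\<close> of the
    semidefinite form satisfies \<open>A^H A w = \<theta> w\<close>. Put
    \<open>Z^T A w / \<delta>\<close> below \<open>w\<close>: since \<open>P^T Z^T = I\<close>, this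
    second-order equation becomes the eigenvector equation of the Hamiltonian matrix for the
    eigenvalue \<open>i \<omega>\<close>.\<close>
  have singular: "\<not> (B \<omega> w w = 0 \<and> w \<noteq> 0 \<and> (\<forall>v. 0 \<le> B \<omega> v v))" for \<omega> w
  proof
    assume *: "B \<omega> w w = 0 \<and> w \<noteq> 0 \<and> (\<forall>v. 0 \<le> B \<omega> v v)"
    have zero: "B \<omega> w v = 0" for v
      by (rule psd_form_zero[OF subspace_UNIV blin sym]) (use * in auto)
    obtain a b where w: "w = (a, b)" by (cases w)
    define h1 h2 where "h1 = - (\<omega> *\<^sub>R (Z *v b) + a)" and "h2 = \<omega> *\<^sub>R (Z *v a) - b"
    have tr: "v \<bullet> (x v* Z) = x \<bullet> (Z *v v)" for v x
      by (metis dot_lmul_matrix inner_commute)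
    have "v \<bullet> (- h1 + \<omega> *\<^sub>R (transpose Z *v h2) - \<theta> *\<^sub>R a) = 0" for v
      using zero[of "(v, 0)"]
      by (simp add: B_def h_def w h1_def h2_def inner_add_right inner_add_left inner_diff_left inner_diff_right
          tr inner_commute[of _ v] inner_commute[of "Z *v v"] transpose_matrix_vector algebra_simps)
    from this[of "- h1 + \<omega> *\<^sub>R (transpose Z *v h2) - \<theta> *\<^sub>R a"]
    have e1: "- h1 + \<omega> *\<^sub>R (transpose Z *v h2) - \<theta> *\<^sub>R a = 0" by simp
    have "v \<bullet> (- (\<omega> *\<^sub>R (transpose Z *v h1)) - h2 - \<theta> *\<^sub>R b) = 0" for v
      using zero[of "(0, v)"]
      by (simp add: B_def h_def w h1_def h2_def inner_add_right inner_add_left inner_diff_left inner_diff_right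
          tr inner_commute[of _ v] inner_commute[of "Z *v v"] transpose_matrix_vector algebra_simps)
    from this[of "- (\<omega> *\<^sub>R (transpose Z *v h1)) - h2 - \<theta> *\<^sub>R b"]
    have e2: "- (\<omega> *\<^sub>R (transpose Z *v h1)) - h2 - \<theta> *\<^sub>R b = 0" by simp
    let ?b1 = "(1 / \<delta>) *\<^sub>R (transpose Z *v h1)" and ?b2 = "(1 / \<delta>) *\<^sub>R (transpose Z *v h2)"
    let ?N = "block2x2 P (\<delta> *\<^sub>R (P ** transpose P)) (- mat c) (- transpose P)"
    have TPZ: "transpose P *v (transpose Z *v v) = v" for v
    proof -
      have "transpose P ** transpose Z = transpose (Z ** P)" by (simp add: matrix_transpose_mul)
      also have "Z ** P = mat 1" using PZ matrix_left_right_inverse by blast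
      finally show ?thesis by (metis matrix_vector_mul_assoc matrix_vector_mul_lid transpose_mat)
    qed
    have "map_matrix complex_of_real ?N *v cvec (vec2 a ?b1) (vec2 b ?b2)
            = Complex 0 \<omega> *s cvec (vec2 a ?b1) (vec2 b ?b2)"
    proof -
      have r1: "P *v a + (\<delta> *\<^sub>R (P ** transpose P)) *v ?b1 = - (\<omega> *\<^sub>R b)"
      proof -
        have "P *v a + (\<delta> *\<^sub>R (P ** transpose P)) *v ?b1 = P *v (a + h1)"
          using d by (simp add: matrix_vector_mult_scaleR scaleR_matrix_vector_assoc[symmetric]
              matrix_vector_mul_assoc[symmetric] TPZ matrix_vector_right_distrib del: transpose_matrix_vector)
        also have "a + h1 = - (\<omega> *\<^sub>R (Z *v b))" by (simp add: h1_def)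
        finally show ?thesis by (simp add: matrix_vector_mult_uminus PZx matrix_vector_mult_scaleR)
      qed
      have r2: "P *v b + (\<delta> *\<^sub>R (P ** transpose P)) *v ?b2 = \<omega> *\<^sub>R a"
      proof -
        have "P *v b + (\<delta> *\<^sub>R (P ** transpose P)) *v ?b2 = P *v (b + h2)"
          using d by (simp add: matrix_vector_mult_scaleR scaleR_matrix_vector_assoc[symmetric]
              matrix_vector_mul_assoc[symmetric] TPZ matrix_vector_right_distrib del: transpose_matrix_vector)
        also have "b + h2 = \<omega> *\<^sub>R (Z *v a)" by (simp add: h2_def)
        finally show ?thesis by (simp add: PZx matrix_vector_mult_scaleR)
      qed
      have r3: "(- mat c) *v a + (- transpose P) *v ?b1 = - (\<omega> *\<^sub>R ?b2)"
      proof -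
        have "\<delta> *\<^sub>R ((- mat c) *v a + (- transpose P) *v ?b1 + \<omega> *\<^sub>R ?b2)
              = - (\<theta> *\<^sub>R a) - h1 + \<omega> *\<^sub>R (transpose Z *v h2)"
          using d by (simp add: uminus_matrix_vector_mult mat_mult_vector TPZ matrix_vector_mult_scaleR \<theta>_def algebra_simps
              del: transpose_matrix_vector)
        also have "\<dots> = 0" using e1 by (simp add: algebra_simps)
        finally show ?thesis using d by (simp add: add_eq_0_iff)
      qed
      have r4: "(- mat c) *v b + (- transpose P) *v ?b2 = \<omega> *\<^sub>R ?b1"
      proof -
        have "\<delta> *\<^sub>R ((- mat c) *v b + (- transpose P) *v ?b2 - \<omega> *\<^sub>R ?b1)
              = - (\<theta> *\<^sub>R b) - h2 - \<omega> *\<^sub>R (transpose Z *v h1)"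
          using d by (simp add: uminus_matrix_vector_mult mat_mult_vector TPZ matrix_vector_mult_scaleR \<theta>_def algebra_simps
              del: transpose_matrix_vector)
        also have "\<dots> = 0" by (subst e2[symmetric]) (simp add: algebra_simps)
        finally show ?thesis using d by simp
      qed
      show ?thesis
        unfolding matrix_mult_cvec block2x2_mult_vec2 scale_cvec r1 r2 r3 r4 vec2_scaleR cvec_eq_iff
        by (auto simp: vec2_def vec_eq_iff split: sum.splits)
    qed
    moreover have "cvec (vec2 a ?b1) (vec2 b ?b2) \<noteq> 0"
      using * by (auto simp: w cvec_vec2_eq_0_iff zero_prod_def)
    ultimately have "matrix_eigenvalue ?N (Complex 0 \<omega>)"
      unfolding matrix_eigenvalue_def by blast
    from N[OF this] show False by simp
  qed
  obtain K where K: "K > 0" "\<And>x. norm (P *v x) \<le> norm x * K"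
    using bounded_linear.pos_bounded[OF matrix_vector_mul_bounded_linear[of P]] by blast
  \<comment> \<open>The bound \<open>K\<close> for \<open>P\<close> bounds its inverse
    \<open>Z\<close> from below, so beyond this threshold \<open>\<omega> Z\<close> outweighs the
    identity by more than \<open>sqrt \<theta>\<close>.\<close>
  have large: "0 < B \<omega> w w" if "K * (1 + sqrt \<theta>) < \<omega>" "w \<noteq> 0" for \<omega> w
  proof -
    obtain a b where w: "w = (a, b)" by (cases w)
    have Kp: "0 \<le> \<omega>" using that K \<theta> by (smt (verit) mult_pos_pos real_sqrt_gt_zero)
    have Z: "norm x \<le> K * norm (Z *v x)" for x using K(2)[of "Z *v x"] by (simp add: PZx mult.commute)
    have zz: "norm w \<le> K * norm (Z *v b, Z *v a)"
    proof -
      have "(norm w)\<^sup>2 = (norm a)\<^sup>2 + (norm b)\<^sup>2" by (simp add: w norm_Pair)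
      also have "\<dots> \<le> (K * norm (Z *v a))\<^sup>2 + (K * norm (Z *v b))\<^sup>2"
        using Z by (intro add_mono power_mono) auto
      also have "\<dots> = (K * norm (Z *v b, Z *v a))\<^sup>2" by (simp add: norm_Pair power_mult_distrib distrib_left)
      finally show ?thesis using K(1) by (meson mult_nonneg_nonneg norm_ge_zero order_less_imp_le power2_le_imp_le)
    qed
    have "K * (1 + sqrt \<theta>) * norm w < \<omega> * norm w" using that by simp
    also have "\<dots> \<le> \<omega> * (K * norm (Z *v b, Z *v a))" using zz Kp by (rule mult_left_mono)
    finally have "K * ((1 + sqrt \<theta>) * norm w) < K * (\<omega> * norm (Z *v b, Z *v a))" by (simp add: mult_ac)
    then have "(1 + sqrt \<theta>) * norm w < \<omega> * norm (Z *v b, Z *v a)" using K by simp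
    also have "\<dots> = norm (\<omega> *\<^sub>R (Z *v b, Z *v a))" using Kp by (metis abs_of_nonneg norm_scaleR)
    also have "\<omega> *\<^sub>R (Z *v b, Z *v a) = h \<omega> w - (a, - b)" by (simp add: h_def w)
    also have "norm \<dots> \<le> norm (h \<omega> w) + norm w" by (rule order_trans[OF norm_triangle_ineq4]) (simp add: w norm_Pair)
    finally have "sqrt \<theta> * norm w < norm (h \<omega> w)" by (simp add: algebra_simps)
    then have "(sqrt \<theta> * norm w)\<^sup>2 < (norm (h \<omega> w))\<^sup>2" using \<theta> by (intro power_strict_mono) auto
    then show ?thesis using \<theta> by (simp add: B_def power2_norm_eq_inner power_mult_distrib)
  qed
  have "0 < B \<omega> (x, y) (x, y)"
  proof (rule ccontr)
    assume neg: "\<not> ?thesis"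
    \<comment> \<open>If positivity fails at \<open>\<omega>\<close>, the set \<open>T\<close> of
      failures on unit vectors up to \<open>\<Omega>\<close> is compact and non-empty. At the
      largest failing frequency \<open>s\<close> the form is semidefinite, as a limit of positive
      forms from the right, and it has a null vector, contrary to \<open>singular\<close>.\<close>
    define \<Omega> where "\<Omega> = max \<omega> (K * (1 + sqrt \<theta>))"
    define T where "T = {(s, w). s \<in> {\<omega>..\<Omega>} \<and> w \<in> sphere 0 1 \<and> B s w w \<le> 0}"
    have contB: "continuous_on UNIV (\<lambda>(s, w). B s w w)"
      unfolding B_def h_def case_prod_beta
      by (intro continuous_intros bounded_linear.continuous_on[OF matrix_vector_mul_bounded_linear])
    have "T = ({\<omega>..\<Omega>} \<times> sphere 0 1) \<inter> {z. (\<lambda>(s, w). B s w w) z \<le> 0}" by (auto simp: T_def)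
    moreover have "closed {z. (\<lambda>(s, w). B s w w) z \<le> 0}"
      by (rule closed_Collect_le[OF contB]) auto
    ultimately have cT: "compact T" by (simp add: compact_Times compact_Int_closed)
    have hom: "B s (r *\<^sub>R w) (r *\<^sub>R w) = r\<^sup>2 * B s w w" for s r w
      by (simp add: bilinear_lmul[OF blin] bilinear_rmul[OF blin] power2_eq_square)
    have "(\<omega>, (1 / norm (x, y)) *\<^sub>R (x, y)) \<in> T"
      using ne neg by (auto simp: T_def hom \<Omega>_def mult_le_0_iff simp del: scaleR_Pair)
    then have "fst ` T \<noteq> {}" by blast
    moreover have "compact (fst ` T)" by (intro compact_continuous_image cT continuous_intros)
    ultimately obtain s where s: "s \<in> fst ` T" "\<And>s'. s' \<in> fst ` T \<Longrightarrow> s' \<le> s"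
      using compact_attains_sup by metis
    then obtain w where w: "s \<in> {\<omega>..\<Omega>}" "w \<in> sphere 0 1" "B s w w \<le> 0" by (auto simp: T_def)
    have above: "0 < B s' v v" if "s < s'" "v \<noteq> 0" for s' v
    proof (cases "s' \<le> \<Omega>")
      case True
      show ?thesis
      proof (rule ccontr)
        assume "\<not> ?thesis"
        then have "(s', (1 / norm v) *\<^sub>R v) \<in> T"
          using that True w by (auto simp: T_def hom mult_le_0_iff)
        then show False using s(2)[of s'] that by force
      qed
    next
      case False
      then show ?thesis using that by (intro large) (auto simp: \<Omega>_def)
    qed
    have nonneg: "0 \<le> B s v v" for v
    proof (cases "v = 0")
      case False
      have "((\<lambda>s'. B s' v v) \<longlongrightarrow> B s v v) (at_right s)"
        unfolding B_def h_def by (intro tendsto_intros)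
      moreover have "\<forall>\<^sub>F s' in at_right s. 0 \<le> B s' v v"
        using False by (auto simp: eventually_at_filter intro!: always_eventually less_imp_le above)
      ultimately show ?thesis by (rule tendsto_lowerbound) simp
    qed (simp add: bilinear_lzero[OF blin])
    have "w \<noteq> 0" using w by auto
    then show False using singular[of s w] nonneg w nonneg[of w] by force
  qed
  then show ?thesis
    by (simp add: B_def h_def \<theta>_def power2_norm_eq_inner inner_Pair)
qed

section \<open>Duality\<close>

text \<open>The sum over \<open>k\<close> is invariant under orthogonal recombination of the family.
  Completing the coefficient rows \<open>a\<close> and \<open>b\<close> to an orthogonal matrix
  makes \<open>wa\<close> and \<open>wb\<close> two members of the recombined family, and the
  subtraction deletes exactly these two. The same new family works for every symmetric
  \<open>B\<close>.\<close>

lemma sum_bilinear_peel: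
  fixes B :: "'a::real_vector \<Rightarrow> 'a \<Rightarrow> 'b::real_vector"
  assumes B: "bilinear B" and sym: "\<And>x y. B x y = B y x"
    and ab: "(\<Sum>k\<in>S. (a k)\<^sup>2) = 1" "(\<Sum>k\<in>S. (b k)\<^sup>2) = 1" "(\<Sum>k\<in>S. a k * b k) = 0"
    and wa: "wa = (\<Sum>k\<in>S. a k *\<^sub>R w k)" and wb: "wb = (\<Sum>k\<in>S. b k *\<^sub>R w k)"
  shows "(\<Sum>k\<in>S. B (w k - a k *\<^sub>R wa - b k *\<^sub>R wb) (w k - a k *\<^sub>R wa - b k *\<^sub>R wb))
           = (\<Sum>k\<in>S. B (w k) (w k)) - B wa wa - B wb wb"
proof -
  have lin: "linear (\<lambda>x. B x y)" for y using B by (simp add: bilinear_def)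
  have e: "B (w k - a k *\<^sub>R wa - b k *\<^sub>R wb) (w k - a k *\<^sub>R wa - b k *\<^sub>R wb)
      = B (w k) (w k) - (a k *\<^sub>R B (w k) wa + a k *\<^sub>R B (w k) wa) - (b k *\<^sub>R B (w k) wb + b k *\<^sub>R B (w k) wb)
        + (a k)\<^sup>2 *\<^sub>R B wa wa + (b k)\<^sup>2 *\<^sub>R B wb wb + ((a k * b k) *\<^sub>R B wa wb + (a k * b k) *\<^sub>R B wa wb)" for k
    by (simp add: bilinear_ladd[OF B] bilinear_radd[OF B] bilinear_lsub[OF B] bilinear_rsub[OF B] bilinear_lmul[OF B] bilinear_rmul[OF B]
        sym[of wa "w k"] sym[of wb "w k"] sym[of wb wa] power2_eq_square algebra_simps)
  have "(\<Sum>k\<in>S. a k *\<^sub>R B (w k) wa) = B wa wa" "(\<Sum>k\<in>S. b k *\<^sub>R B (w k) wb) = B wb wb"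
    by (simp_all add: wa wb linear_sum[OF lin] linear_scale[OF lin])
  then show ?thesis
    by (simp add: e sum.distrib sum_subtractf scaleR_sum_left[symmetric] ab)
qed

text \<open>A skew pair of families has an imaginary eigenvalue: the operators
  \<open>A = \<Sum> x\<^sub>k x\<^sub>k\<^sup>T\<close> and \<open>\<Omega> = \<Sum> v\<^sub>k x\<^sub>k\<^sup>T\<close> satisfy \<open>\<Omega> (y + i z) = i \<omega> A (y + i z)\<close>. The eigenvalue is found
  as the maximum of the generalised Rayleigh quotient \<open>2 y\<^sup>T \<Omega> z / (y\<^sup>T A y + z\<^sup>T A z)\<close> on the span of
  the \<open>x\<^sub>k\<close>, where \<open>A\<close> is positive definite.\<close>

lemma skew_family_imaginary_eigenpair:
  fixes x v :: "'i \<Rightarrow> 'a::euclidean_space" and S :: "'i set"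
  defines "A \<equiv> (\<lambda>y. \<Sum>k\<in>S. (x k \<bullet> y) *\<^sub>R x k)" and "Om \<equiv> (\<lambda>y. \<Sum>k\<in>S. (x k \<bullet> y) *\<^sub>R v k)"
  assumes S: "finite S"
    and skew: "\<And>y z. (\<Sum>k\<in>S. (x k \<bullet> y) * (v k \<bullet> z) + (v k \<bullet> y) * (x k \<bullet> z)) = 0"
    and ne: "Om y0 \<noteq> 0"
  obtains y z \<omega> where "Om y = - \<omega> *\<^sub>R A z" "Om z = \<omega> *\<^sub>R A y"
    "y \<bullet> A y = 1" "z \<bullet> A z = 1" "y \<bullet> A z = 0"
proof -
  have linA: "linear A" and linO: "linear Om"
    unfolding A_def Om_def
    by (auto intro!: linearI simp: inner_add_right scaleR_add_left sum.distrib scaleR_sum_right)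
  have iA: "y \<bullet> A z = (\<Sum>k\<in>S. (x k \<bullet> y) * (x k \<bullet> z))" for y z
    by (simp add: A_def inner_sum_right inner_commute mult.commute)
  have iO: "y \<bullet> Om z = (\<Sum>k\<in>S. (v k \<bullet> y) * (x k \<bullet> z))" for y z
    by (simp add: Om_def inner_sum_right inner_commute mult.commute)
  have symA: "y \<bullet> A z = z \<bullet> A y" for y z by (simp add: iA mult.commute)
  have skO: "y \<bullet> Om z = - (z \<bullet> Om y)" for y z
    using skew[of y z] by (simp add: iO sum.distrib mult.commute)
  have Oyy: "y \<bullet> Om y = 0" for y using skO[of y y] by simp
  define D where "D = span (x ` S)"
  have subD: "subspace D" by (simp add: D_def)
  have perp: "A p = 0" "Om p = 0" if "\<And>w. w \<in> D \<Longrightarrow> orthogonal p w" for p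
  proof -
    have "x k \<bullet> p = 0" if "k \<in> S" for k
      using \<open>\<And>w. w \<in> D \<Longrightarrow> orthogonal p w\<close>[of "x k"] that
      by (auto simp: D_def orthogonal_def inner_commute intro: span_base)
    then show "A p = 0" "Om p = 0" by (simp_all add: A_def Om_def)
  qed
  have decomp: "\<exists>d\<in>D. \<forall>u. u \<bullet> A y = u \<bullet> A d \<and> u \<bullet> Om y = u \<bullet> Om d" for y
  proof -
    obtain d p where dp: "d \<in> span (x ` S)" "\<And>w. w \<in> span (x ` S) \<Longrightarrow> orthogonal p w" "y = d + p"
      using orthogonal_subspace_decomp_exists by metis
    then have "A p = 0" "Om p = 0" using perp by (auto simp: D_def)
    then show ?thesis using dp by (auto simp: D_def linear_add[OF linA] linear_add[OF linO])
  qed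
  \<comment> \<open>Testing against \<open>D\<close> is enough: \<open>A\<close> is symmetric and
    \<open>Om\<close> is skew, and both vanish on the orthogonal complement of \<open>D\<close>, so
    that complement contributes nothing.\<close>
  have eqI: "r *\<^sub>R A y = s *\<^sub>R Om z" if "\<And>u. u \<in> D \<Longrightarrow> r * (u \<bullet> A y) = s * (u \<bullet> Om z)" for r s y z
  proof -
    have "u \<bullet> (r *\<^sub>R A y - s *\<^sub>R Om z) = 0" for u
    proof -
      obtain d where "d \<in> D" "\<And>w. w \<bullet> A u = w \<bullet> A d" "\<And>w. w \<bullet> Om u = w \<bullet> Om d" using decomp by blast
      then show ?thesis using that[of d] symA[of u y] symA[of d y] skO[of u z] skO[of d z]
        by (simp add: inner_diff_right)
    qed
    from this[of "r *\<^sub>R A y - s *\<^sub>R Om z"] show ?thesis by simp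
  qed
  have posA: "0 < y \<bullet> A y" if "y \<in> D" "y \<noteq> 0" for y
  proof -
    have "0 \<le> y \<bullet> A y" by (simp add: iA sum_nonneg)
    moreover have "y \<bullet> A y \<noteq> 0"
    proof
      assume "y \<bullet> A y = 0"
      then have "\<forall>k\<in>S. (x k \<bullet> y) * (x k \<bullet> y) = 0"
        unfolding iA by (subst (asm) sum_nonneg_eq_0_iff) (use S in auto)
      then have "\<And>w. w \<in> x ` S \<Longrightarrow> orthogonal y w" by (auto simp: orthogonal_def inner_commute)
      then have "orthogonal y y" using that orthogonal_to_span[of y "x ` S" y] by (auto simp: D_def)
      then show False using that by (simp add: orthogonal_def)
    qed
    ultimately show ?thesis by simp
  qed
  have nnA: "0 \<le> y \<bullet> A y" for y by (simp add: iA sum_nonneg)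
  define K where "K = sphere 0 1 \<inter> (D \<times> D)"
  have subDD: "subspace (D \<times> D)" by (simp add: subD subspace_Times)
  have cK: "compact K" unfolding K_def by (intro compact_Int_closed closed_subspace subDD) simp
  define R where "R = (\<lambda>(y, z). 2 * (y \<bullet> Om z) / (y \<bullet> A y + z \<bullet> A z))"
  have den: "0 < y \<bullet> A y + z \<bullet> A z" if "(y, z) \<in> D \<times> D" "(y, z) \<noteq> 0" for y z
    using that posA[of y] posA[of z] nnA[of y] nnA[of z] by (cases "y = 0") (auto simp: zero_prod_def)
  \<comment> \<open>Since \<open>Om y0 \<noteq> 0\<close>, the projections onto \<open>D\<close> of
    \<open>Om y0\<close> and \<open>y0\<close> give \<open>|Om y0|^2 > 0\<close>. Hence the maximal
    quotient \<open>\<omega>\<close> is positive and can be divided by.\<close>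
  obtain yn zn where yn: "yn \<in> D" "zn \<in> D" "0 < yn \<bullet> Om zn"
  proof -
    obtain d where d: "d \<in> D" "\<And>u. u \<bullet> Om y0 = u \<bullet> Om d" using decomp by blast
    obtain e where e: "e \<in> D" "\<And>u. u \<bullet> Om (Om y0) = u \<bullet> Om e" using decomp by blast
    have "0 < Om y0 \<bullet> Om y0" using ne by simp
    also have "Om y0 \<bullet> Om y0 = Om y0 \<bullet> Om d" by (rule d)
    also have "\<dots> = - (d \<bullet> Om e)" by (simp add: skO[of "Om y0" d] e)
    also have "\<dots> = e \<bullet> Om d" using skO[of e d] by simp
    finally show thesis using d(1) e(1) that by blast
  qed
  have contR: "continuous_on K R"
  proof -
    have "bounded_linear A" "bounded_linear Om"
      using linA linO by (simp_all add: linear_conv_bounded_linear)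
    note cont = this[THEN bounded_linear.continuous_on]
    have "y \<bullet> A y + z \<bullet> A z \<noteq> 0" if "(y, z) \<in> K" for y z
      using den[of y z] that by (force simp: K_def zero_prod_def)
    then show ?thesis unfolding R_def case_prod_beta
      by (intro continuous_intros cont) auto
  qed
  have nrm: "(1 / norm (y, z)) *\<^sub>R (y, z) \<in> K" "R ((1 / norm (y, z)) *\<^sub>R (y, z)) = R (y, z)"
    if "(y, z) \<in> D \<times> D" "(y, z) \<noteq> 0" for y z
  proof -
    show "(1 / norm (y, z)) *\<^sub>R (y, z) \<in> K"
      using that subspace_scale[OF subDD that(1)] by (auto simp: K_def simp del: scaleR_Pair)
    have "R (r *\<^sub>R (y, z)) = R (y, z)" if "r \<noteq> 0" for r
    proof -
      have "R (r *\<^sub>R (y, z)) = (r * r * (2 * (y \<bullet> Om z))) / (r * r * (y \<bullet> A y + z \<bullet> A z))"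
        by (simp add: R_def linear_scale[OF linA] linear_scale[OF linO] algebra_simps)
      then show ?thesis using that by (simp add: R_def)
    qed
    then show "R ((1 / norm (y, z)) *\<^sub>R (y, z)) = R (y, z)" using that by simp
  qed
  have yn0: "(yn, zn) \<noteq> 0" using yn by (auto simp: zero_prod_def linear_0[OF linO])
  have "K \<noteq> {}" using nrm(1)[of yn zn] yn yn0 by auto
  then obtain m where m: "m \<in> K" "\<And>u. u \<in> K \<Longrightarrow> R u \<le> R m"
    using continuous_attains_sup[OF cK _ contR] by blast
  obtain y z where yz: "m = (y, z)" by (cases m)
  define \<omega> where "\<omega> = R m"
  have yzD: "(y, z) \<in> D \<times> D" "(y, z) \<noteq> 0" using m(1) by (auto simp: K_def yz zero_prod_def)
  have "0 < R (yn, zn)" using yn den[of yn zn] yn0 by (auto simp: R_def)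
  also have "\<dots> \<le> \<omega>" using m(2)[OF nrm(1)[of yn zn]] nrm(2)[of yn zn] yn yn0 by (simp add: \<omega>_def)
  finally have \<omega>: "0 < \<omega>" .
  \<comment> \<open>On the diagonal this is \<open>\<omega> - R\<close> multiplied by the
    denominator of \<open>R\<close>: nonnegative on \<open>D \<times> D\<close> because
    \<open>\<omega>\<close> is the maximum, and zero at the maximiser. Its kernel equations are the
    eigenvalue equations.\<close>
  define B where "B = (\<lambda>(p :: 'a \<times> 'a) q. \<omega> * (fst p \<bullet> A (fst q) + snd p \<bullet> A (snd q)) - (fst p \<bullet> Om (snd q) + fst q \<bullet> Om (snd p)))"
  have bilB: "bilinear B" unfolding bilinear_def B_def
    by (auto intro!: linearI simp: linear_add[OF linA] linear_add[OF linO] linear_scale[OF linA]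
        linear_scale[OF linO] inner_add_left inner_add_right algebra_simps)
  have symB: "B p q = B q p" for p q
    using symA[of "fst p" "fst q"] symA[of "snd p" "snd q"] by (simp add: B_def)
  have nnB: "0 \<le> B p p" if "p \<in> D \<times> D" for p
  proof (cases "p = 0")
    case False
    obtain a b where p: "p = (a, b)" by (cases p)
    have "R (a, b) \<le> \<omega>" using m(2)[OF nrm(1)[of a b]] nrm(2)[of a b] False that by (simp add: \<omega>_def p)
    then show ?thesis using den[of a b] that False by (simp add: R_def p B_def divide_le_eq)
  qed (simp add: bilinear_lzero[OF bilB])
  have B0: "B (y, z) (y, z) = 0"
    using den[OF yzD] by (simp add: B_def \<omega>_def R_def yz field_simps)
  note zero = psd_form_zero[OF subDD bilB symB nnB yzD(1) B0]
  have "\<omega> *\<^sub>R A y = 1 *\<^sub>R Om z"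
  proof (rule eqI)
    fix u assume "u \<in> D"
    then have "B (y, z) (u, 0) = 0" using subspace_0[OF subD] by (intro zero) auto
    then show "\<omega> * (u \<bullet> A y) = 1 * (u \<bullet> Om z)"
      using symA[of u y] by (simp add: B_def linear_0[OF linA] linear_0[OF linO])
  qed
  then have e1: "Om z = \<omega> *\<^sub>R A y" by simp
  have "\<omega> *\<^sub>R A z = (- 1) *\<^sub>R Om y"
  proof (rule eqI)
    fix u assume "u \<in> D"
    then have "B (y, z) (0, u) = 0" using subspace_0[OF subD] by (intro zero) auto
    then show "\<omega> * (u \<bullet> A z) = - 1 * (u \<bullet> Om y)"
      using symA[of u z] skO[of u y] by (simp add: B_def linear_0[OF linA] linear_0[OF linO])
  qed
  then have e2: "Om y = - \<omega> *\<^sub>R A z" by simp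
  \<comment> \<open>Skewness of \<open>Om\<close> alone makes the pair orthogonal and of equal
    length with respect to \<open>A\<close>; one common scaling then normalises both
    vectors.\<close>
  have yAz: "y \<bullet> A z = 0" using Oyy[of y] \<omega> by (simp add: e2)
  have "\<omega> * (z \<bullet> A z) = - (z \<bullet> Om y)" by (simp add: e2)
  also have "\<dots> = \<omega> * (y \<bullet> A y)" using skO[of z y] by (simp add: e1)
  finally have eq: "z \<bullet> A z = y \<bullet> A y" using \<omega> by simp
  define r where "r = 1 / sqrt (y \<bullet> A y)"
  have "0 < y \<bullet> A y" using den[OF yzD] eq by simp
  then have r: "r * r * (y \<bullet> A y) = 1" by (simp add: r_def)
  show thesis
  proof
    show "Om (r *\<^sub>R y) = - \<omega> *\<^sub>R A (r *\<^sub>R z)" "Om (r *\<^sub>R z) = \<omega> *\<^sub>R A (r *\<^sub>R y)"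
      by (simp_all add: linear_scale[OF linA] linear_scale[OF linO] e1 e2)
    show "(r *\<^sub>R y) \<bullet> A (r *\<^sub>R y) = 1" "(r *\<^sub>R z) \<bullet> A (r *\<^sub>R z) = 1" "(r *\<^sub>R y) \<bullet> A (r *\<^sub>R z) = 0"
      using r by (simp_all add: linear_scale[OF linA] eq yAz mult.assoc)
  qed
qed

definition outer_product :: "real^'k \<Rightarrow> real^'k \<Rightarrow> real^'k^'k" where
  "outer_product x v = (\<chi> i j. x $ i * v $ j)"

lemma outer_product_mult: "outer_product x v *v z = (v \<bullet> z) *\<^sub>R x"
  by (simp add: outer_product_def matrix_vector_mult_def vec_eq_iff inner_vec_def sum_distrib_left mult_ac)

lemma inner_outer_product: "Y \<bullet> outer_product x v = x \<bullet> (Y *v v)"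
  by (simp add: outer_product_def inner_vec_def matrix_vector_mult_def sum_distrib_left mult_ac)

lemma bilinear_outer_product: "bilinear outer_product"
  unfolding bilinear_def outer_product_def
  by (auto intro!: linearI simp: vec_eq_iff algebra_simps)

text \<open>The convex cone generated by the values \<open>(x v\<^sup>T + v x\<^sup>T, |Z v - x|\<^sup>2 - \<theta> |x|\<^sup>2)\<close> is separated from
  \<open>{0} \<times> {..0}\<close>; the normal of the separating hyperplane is the sought matrix. If the two sets met,
  a point of the intersection with the least second coordinate would split off a rank-two piece
  \<open>(x, \<omega> y), (y, - \<omega> x)\<close>, which the frequency condition excludes.\<close>

theorem frequency_condition_imp_quadratic_bound:
  fixes Z :: "real^'k^'k"
  assumes freq: "\<And>\<omega> x y. (x, y) \<noteq> 0 \<Longrightarrow> \<theta> * ((norm x)\<^sup>2 + (norm y)\<^sup>2)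
           < (norm (\<omega> *\<^sub>R (Z *v y) + x))\<^sup>2 + (norm (\<omega> *\<^sub>R (Z *v x) - y))\<^sup>2"
    and inj: "\<And>v. Z *v v = 0 \<Longrightarrow> v = 0"
  obtains Y where "transpose Y = Y"
    "\<And>x v. 2 * (x \<bullet> (Y *v v)) \<le> (norm (Z *v v - x))\<^sup>2 - \<theta> * (norm x)\<^sup>2"
proof -
  \<comment> \<open>\<open>T\<close> and \<open>q\<close> are the polarised forms of the two
    coordinates, so that \<open>T w w = x v^T + v x^T\<close> for \<open>w = (x, v)\<close>.\<close>
  define T where "T = (\<lambda>(w :: (real^'k) \<times> (real^'k)) w'. (1/2) *\<^sub>R
      (outer_product (fst w) (snd w') + outer_product (snd w) (fst w')
       + (outer_product (fst w') (snd w) + outer_product (snd w') (fst w))))"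
  define q where "q = (\<lambda>(w :: (real^'k) \<times> (real^'k)) w'.
      (Z *v snd w - fst w) \<bullet> (Z *v snd w' - fst w') - \<theta> * (fst w \<bullet> fst w'))"
  note op = bilinear_ladd[OF bilinear_outer_product] bilinear_radd[OF bilinear_outer_product]
      bilinear_lmul[OF bilinear_outer_product] bilinear_rmul[OF bilinear_outer_product]
  have bT: "bilinear T" unfolding bilinear_def T_def
    by (auto intro!: linearI simp: op algebra_simps)
  have sT: "T w w' = T w' w" for w w' by (simp add: T_def)
  have bq: "bilinear q" unfolding bilinear_def q_def
    by (auto intro!: linearI simp: matrix_vector_right_distrib matrix_vector_mult_scaleR
        inner_add_left inner_add_right inner_diff_left inner_diff_right algebra_simps)
  have sq: "q w w' = q w' w" for w w' by (simp add: q_def inner_commute)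
  have bi: "bilinear (\<lambda>(w :: (real^'k) \<times> (real^'k)) w'. w \<bullet> w')"
    using bilinear_conv_bounded_bilinear bounded_bilinear_inner by blast
  have Tv: "y \<bullet> (T w w *v z) = (fst w \<bullet> y) * (snd w \<bullet> z) + (snd w \<bullet> y) * (fst w \<bullet> z)" for w y z
    by (simp add: T_def scaleR_matrix_vector_assoc[symmetric] matrix_vector_mult_add_rdistrib outer_product_mult
        inner_add_right inner_commute algebra_simps)
  have qq: "q (x, v) (x, v) = (norm (Z *v v - x))\<^sup>2 - \<theta> * (norm x)\<^sup>2" for x v
    by (simp add: q_def power2_norm_eq_inner)
  define \<Phi> where "\<Phi> = (\<lambda>w. (T w w, q w w))"
  \<comment> \<open>The cone is represented by a base: the hull of the values on the unit sphere is
    compact, which makes strict separation possible.\<close>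
  define C where "C = convex hull (\<Phi> ` sphere 0 1)"
  have "bounded_bilinear T" "bounded_bilinear q"
    using bT bq bilinear_conv_bounded_bilinear by blast+
  from this[THEN bounded_bilinear.continuous_on, OF continuous_on_id continuous_on_id]
  have "continuous_on (sphere 0 1) \<Phi>"
    unfolding \<Phi>_def by (intro continuous_on_Pair)
  then have cC: "compact C" unfolding C_def by (intro compact_convex_hull compact_continuous_image) auto
  have vC: "convex C" by (simp add: C_def)
  have hom: "T (r *\<^sub>R w) (r *\<^sub>R w) = r\<^sup>2 *\<^sub>R T w w" "q (r *\<^sub>R w) (r *\<^sub>R w) = r\<^sup>2 * q w w" for r w
    by (simp_all add: bilinear_lmul[OF bT] bilinear_rmul[OF bT] bilinear_lmul[OF bq] bilinear_rmul[OF bq] power2_eq_square)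
  have unit: "(1 / norm w) *\<^sub>R w \<in> sphere 0 1" if "w \<noteq> 0" for w :: "(real^'k) \<times> (real^'k)"
    using that by simp
  obtain e0 :: "real^'k" where e0: "norm e0 = 1" using vector_choose_size[of 1] by auto
  have cone: "((1 / N) *\<^sub>R (\<Sum>k\<in>S. T (w k) (w k)), (\<Sum>k\<in>S. q (w k) (w k)) / N) \<in> C"
    if S: "finite S" and N: "N = (\<Sum>k\<in>S. w k \<bullet> w k)" "0 < N" for S :: "'j set" and w N
  proof -
    \<comment> \<open>The squared lengths divided by \<open>N\<close> are convex weights for the
      values at the normalised vectors. A zero vector has weight zero, and \<open>(e0, 0)\<close>
      only supplies some point of the sphere for it.\<close>
    define y where "y = (\<lambda>k. \<Phi> (if w k = 0 then (e0, 0) else (1 / norm (w k)) *\<^sub>R w k))"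
    have yC: "y k \<in> C" for k
      unfolding C_def y_def using unit[of "w k"] e0 by (intro hull_inc imageI) (auto simp: norm_Pair)
    have "(\<Sum>k\<in>S. (w k \<bullet> w k / N) *\<^sub>R y k) \<in> C"
      by (rule convex_sum[OF S vC]) (use N yC in \<open>auto simp: sum_divide_distrib[symmetric]\<close>)
    also have "(\<Sum>k\<in>S. (w k \<bullet> w k / N) *\<^sub>R y k)
        = (\<Sum>k\<in>S. ((1 / N) *\<^sub>R T (w k) (w k), q (w k) (w k) / N))"
    proof (rule sum.cong[OF refl])
      fix k
      show "(w k \<bullet> w k / N) *\<^sub>R y k = ((1 / N) *\<^sub>R T (w k) (w k), q (w k) (w k) / N)"
      proof (cases "w k = 0")
        case True
        then have "T (w k) (w k) = 0" "q (w k) (w k) = 0"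
          by (simp_all only: bilinear_lzero[OF bT] bilinear_lzero[OF bq])
        with True show ?thesis by (simp only: inner_zero_left) (simp add: zero_prod_def)
      next
        case False
        have "y k = ((1 / (w k \<bullet> w k)) *\<^sub>R T (w k) (w k), (1 / (w k \<bullet> w k)) * q (w k) (w k))"
          using False hom[of "1 / norm (w k)" "w k"]
          by (simp add: y_def \<Phi>_def power_divide power2_norm_eq_inner)
        then show ?thesis using False by simp
      qed
    qed
    also have "\<dots> = ((1 / N) *\<^sub>R (\<Sum>k\<in>S. T (w k) (w k)), (\<Sum>k\<in>S. q (w k) (w k)) / N)"
      by (simp add: prod_eq_iff fst_sum snd_sum scaleR_sum_right sum_divide_distrib)
    finally show ?thesis .
  qed
  have sep: "(0, s) \<notin> C" if "s \<le> 0" for s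
  proof
    assume sC: "(0, s) \<in> C"
    define C0 where "C0 = C \<inter> ({0} \<times> UNIV)"
    have "compact C0" unfolding C0_def by (intro compact_Int_closed cC closed_Times) auto
    then have "compact (snd ` C0)" by (intro compact_continuous_image continuous_intros)
    moreover have "snd ` C0 \<noteq> {}" using sC by (auto simp: C0_def)
    ultimately obtain \<mu> where \<mu>: "\<mu> \<in> snd ` C0" "\<And>t. t \<in> snd ` C0 \<Longrightarrow> \<mu> \<le> t"
      using compact_attains_inf by metis
    have \<mu>C: "(0, \<mu>) \<in> C" using \<mu>(1) by (auto simp: C0_def)
    have \<mu>min: "\<mu> \<le> t" if "(0, t) \<in> C" for t using \<mu>(2)[of t] that by (force simp: C0_def)
    have \<mu>0: "\<mu> \<le> 0" using \<mu>min[OF sC] that by simp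
    obtain S u where Su: "finite S" "S \<subseteq> \<Phi> ` sphere 0 1" "\<And>x. x \<in> S \<Longrightarrow> 0 \<le> u x" "sum u S = 1"
        "(\<Sum>x\<in>S. u x *\<^sub>R x) = (0, \<mu>)"
      using \<mu>C unfolding C_def convex_hull_explicit by blast
    \<comment> \<open>The convex weights are absorbed into the vectors as square roots, so the
      minimal point is a plain sum of values of \<open>\<Phi>\<close> and the squared lengths add up
      to 1.\<close>
    define w where "w = (\<lambda>p. sqrt (u p) *\<^sub>R (SOME z. z \<in> sphere 0 1 \<and> p = \<Phi> z))"
    have w: "\<Phi> (w p) = u p *\<^sub>R p" "w p \<bullet> w p = u p" if "p \<in> S" for p
    proof -
      have "\<exists>z. z \<in> sphere 0 1 \<and> p = \<Phi> z" using that Su(2) by blast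
      note some = someI_ex[OF this]
      define z where "z = (SOME z. z \<in> sphere 0 1 \<and> p = \<Phi> z)"
      have "w p = sqrt (u p) *\<^sub>R z" by (simp only: w_def z_def)
      moreover have "z \<in> sphere 0 1" "p = \<Phi> z" using some by (simp_all only: z_def)
      ultimately have z: "w p = sqrt (u p) *\<^sub>R z" "norm z = 1" "p = \<Phi> z" by auto
      show "\<Phi> (w p) = u p *\<^sub>R p" "w p \<bullet> w p = u p"
        using z hom[of "sqrt (u p)" z] Su(3)[OF that]
        by (auto simp: \<Phi>_def norm_eq_1 mult.assoc[symmetric])
    qed
    have sumw: "(\<Sum>p\<in>S. T (w p) (w p)) = 0" "(\<Sum>p\<in>S. q (w p) (w p)) = \<mu>" "(\<Sum>p\<in>S. w p \<bullet> w p) = 1"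
    proof -
      have "(\<Sum>p\<in>S. \<Phi> (w p)) = (0, \<mu>)" using Su(5) w(1) by (simp cong: sum.cong)
      then show "(\<Sum>p\<in>S. T (w p) (w p)) = 0" "(\<Sum>p\<in>S. q (w p) (w p)) = \<mu>"
        by (auto simp: \<Phi>_def prod_eq_iff fst_sum snd_sum)
      show "(\<Sum>p\<in>S. w p \<bullet> w p) = 1" using Su(4) w(2) by (simp cong: sum.cong)
    qed
    define x v where "x = (\<lambda>p. fst (w p))" and "v = (\<lambda>p. snd (w p))"
    \<comment> \<open>The first coordinate of the point is zero, which says that the matrix
      \<open>\<Sum> v_k x_k^T\<close> is skew.\<close>
    have skew: "(\<Sum>k\<in>S. (x k \<bullet> y) * (v k \<bullet> z) + (v k \<bullet> y) * (x k \<bullet> z)) = 0" for y z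
    proof -
      have "(\<Sum>k\<in>S. (x k \<bullet> y) * (v k \<bullet> z) + (v k \<bullet> y) * (x k \<bullet> z)) = (\<Sum>k\<in>S. y \<bullet> (T (w k) (w k) *v z))"
        by (simp add: Tv x_def v_def)
      also have "\<dots> = y \<bullet> ((\<Sum>k\<in>S. T (w k) (w k)) *v z)"
        by (induction S rule: infinite_finite_induct)
           (simp_all add: matrix_vector_mult_add_rdistrib inner_add_right)
      finally show ?thesis by (simp add: sumw)
    qed
    show False
    proof (cases "\<forall>y. (\<Sum>k\<in>S. (x k \<bullet> y) *\<^sub>R v k) = 0")
      case True
      \<comment> \<open>The sum is the trace of \<open>Z \<Sum> v_k x_k^T\<close>, and here that
        matrix is zero. Without cross terms \<open>\<mu>\<close> is a sum of nonnegative terms,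
        which forces the whole family to vanish.\<close>
      have cross: "(\<Sum>k\<in>S. x k \<bullet> (Z *v v k)) = 0"
      proof -
        have "x k \<bullet> (Z *v v k) = (\<Sum>i\<in>UNIV. (x k \<bullet> axis i 1) * ((Z *v v k) $ i))" for k
          by (simp add: inner_vec_def inner_axis axis_def if_distrib cong: if_cong)
        then have "(\<Sum>k\<in>S. x k \<bullet> (Z *v v k))
            = (\<Sum>k\<in>S. \<Sum>i\<in>UNIV. (Z *v ((x k \<bullet> axis i 1) *\<^sub>R v k)) $ i)"
          by (simp add: matrix_vector_mult_scaleR)
        also have "\<dots> = (\<Sum>i\<in>UNIV. (Z *v (\<Sum>k\<in>S. (x k \<bullet> axis i 1) *\<^sub>R v k)) $ i)"
          by (subst sum.swap) (simp add: linear_sum[OF matrix_vector_mul_linear[of Z]])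
        finally show ?thesis using True by simp
      qed
      \<comment> \<open>The frequency condition at \<open>\<omega> = 0\<close>.\<close>
      have \<theta>1: "\<theta> < 1" using freq[of e0 0 0] e0 by (cases "e0 = 0") (auto simp: zero_prod_def)
      have "q (w k) (w k) = (norm (Z *v v k))\<^sup>2 + (1 - \<theta>) * (norm (x k))\<^sup>2 - 2 * (x k \<bullet> (Z *v v k))" for k
        by (simp add: q_def x_def v_def power2_norm_eq_inner inner_diff_left inner_diff_right inner_commute algebra_simps)
      then have "\<mu> = (\<Sum>k\<in>S. (norm (Z *v v k))\<^sup>2 + (1 - \<theta>) * (norm (x k))\<^sup>2)"
        using cross by (simp add: sumw(2)[symmetric] sum_subtractf sum_distrib_left[symmetric])
      moreover have "0 \<le> (norm (Z *v v k))\<^sup>2 + (1 - \<theta>) * (norm (x k))\<^sup>2" for k using \<theta>1 by simp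
      ultimately have "\<forall>k\<in>S. (norm (Z *v v k))\<^sup>2 + (1 - \<theta>) * (norm (x k))\<^sup>2 = 0"
        using \<mu>0 Su(1) by (metis (no_types, lifting) antisym sum_nonneg sum_nonneg_eq_0_iff)
      moreover have "x k = 0 \<and> v k = 0" if "(norm (Z *v v k))\<^sup>2 + (1 - \<theta>) * (norm (x k))\<^sup>2 = 0" for k
      proof -
        have "(norm (Z *v v k))\<^sup>2 = 0 \<and> (1 - \<theta>) * (norm (x k))\<^sup>2 = 0"
          using that \<theta>1 by (subst (asm) add_nonneg_eq_0_iff) auto
        then show ?thesis using \<theta>1 inj by auto
      qed
      ultimately have "\<forall>k\<in>S. w k = 0" by (auto simp: x_def v_def prod_eq_iff)
      then show False using sumw(3) by simp
    next
      case False
      then obtain y0 where y0: "(\<Sum>k\<in>S. (x k \<bullet> y0) *\<^sub>R v k) \<noteq> 0" by blast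
      obtain y z \<omega> where yz:
        "(\<Sum>k\<in>S. (x k \<bullet> y) *\<^sub>R v k) = - \<omega> *\<^sub>R (\<Sum>k\<in>S. (x k \<bullet> z) *\<^sub>R x k)"
        "(\<Sum>k\<in>S. (x k \<bullet> z) *\<^sub>R v k) = \<omega> *\<^sub>R (\<Sum>k\<in>S. (x k \<bullet> y) *\<^sub>R x k)"
        "y \<bullet> (\<Sum>k\<in>S. (x k \<bullet> y) *\<^sub>R x k) = 1" "z \<bullet> (\<Sum>k\<in>S. (x k \<bullet> z) *\<^sub>R x k) = 1"
        "y \<bullet> (\<Sum>k\<in>S. (x k \<bullet> z) *\<^sub>R x k) = 0"
        by (rule skew_family_imaginary_eigenpair[OF Su(1) skew y0])
      define \<xi> \<eta> where "\<xi> = (\<Sum>k\<in>S. (x k \<bullet> y) *\<^sub>R x k)" and "\<eta> = (\<Sum>k\<in>S. (x k \<bullet> z) *\<^sub>R x k)"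
      define wa wb where "wa = (\<Sum>k\<in>S. (x k \<bullet> y) *\<^sub>R w k)" and "wb = (\<Sum>k\<in>S. (x k \<bullet> z) *\<^sub>R w k)"
      \<comment> \<open>These are the real and imaginary parts of \<open>(z, i \<omega> z)\<close>
        with \<open>z = \<xi> + i \<eta>\<close>. Their \<open>T\<close>-values cancel, so removing
        them leaves the first coordinate at zero, while their \<open>q\<close>-values add up to the
        form in the frequency condition.\<close>
      have wa: "wa = (\<xi>, - (\<omega> *\<^sub>R \<eta>))" and wb: "wb = (\<eta>, \<omega> *\<^sub>R \<xi>)"
        using yz(1,2) by (simp_all add: wa_def wb_def prod_eq_iff fst_sum snd_sum \<xi>_def \<eta>_def x_def v_def)
      define w' where "w' = (\<lambda>k. w k - (x k \<bullet> y) *\<^sub>R wa - (x k \<bullet> z) *\<^sub>R wb)"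
      have on: "(\<Sum>k\<in>S. (x k \<bullet> y)\<^sup>2) = 1" "(\<Sum>k\<in>S. (x k \<bullet> z)\<^sup>2) = 1" "(\<Sum>k\<in>S. (x k \<bullet> y) * (x k \<bullet> z)) = 0"
        using yz(3-5) by (simp_all add: inner_sum_right power2_eq_square inner_commute mult.commute)
      note peel = sum_bilinear_peel[where w=w and S=S, OF _ _ on wa_def wb_def]
      have "T wa wa + T wb wb = 0"
        by (simp add: T_def wa wb outer_product_def vec_eq_iff algebra_simps)
      then have T': "(\<Sum>k\<in>S. T (w' k) (w' k)) = 0"
        using peel[OF bT sT] sumw(1) by (simp add: w'_def add_eq_0_iff)
      have q': "(\<Sum>k\<in>S. q (w' k) (w' k)) = \<mu> - q wa wa - q wb wb"
        using peel[OF bq sq] sumw(2) by (simp add: w'_def)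
      have n': "(\<Sum>k\<in>S. w' k \<bullet> w' k) = 1 - wa \<bullet> wa - wb \<bullet> wb"
        using peel[OF bi inner_commute] sumw(3) by (simp add: w'_def)
      \<comment> \<open>The remaining family, rescaled to total squared length 1, is again a point
        of \<open>C\<close> over the zero matrix, so minimality of \<open>\<mu>\<close> applies. It
        forces the removed piece to have \<open>q\<close>-value at most \<open>\<mu>\<close> times
        its squared length, hence at most 0, against the frequency condition.\<close>
      have min': "\<mu> * (\<Sum>k\<in>S. w' k \<bullet> w' k) \<le> (\<Sum>k\<in>S. q (w' k) (w' k))"
      proof (cases "(\<Sum>k\<in>S. w' k \<bullet> w' k) = 0")
        case True
        then have "\<forall>k\<in>S. w' k = 0" using Su(1) by (subst (asm) sum_nonneg_eq_0_iff) auto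
        then show ?thesis by (simp add: bilinear_lzero[OF bq])
      next
        case False
        then have pos: "0 < (\<Sum>k\<in>S. w' k \<bullet> w' k)" by (simp add: sum_nonneg order_less_le)
        from \<mu>min[of "(\<Sum>k\<in>S. q (w' k) (w' k)) / (\<Sum>k\<in>S. w' k \<bullet> w' k)"] cone[OF Su(1) refl pos] T'
        show ?thesis using pos by (simp add: le_divide_eq)
      qed
      have "(\<xi>, \<eta>) \<noteq> 0" using yz(3) by (auto simp: \<xi>_def[symmetric] zero_prod_def)
      from freq[OF this, of \<omega>]
      have "0 < q wa wa + q wb wb"
        by (simp add: wa wb qq norm_minus_commute[of "\<omega> *\<^sub>R (Z *v \<xi>)"] norm_minus_cancel[symmetric, of "- (\<omega> *\<^sub>R (Z *v \<eta>)) - \<xi>"]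
            matrix_vector_mult_uminus matrix_vector_mult_scaleR algebra_simps)
      moreover have "q wa wa + q wb wb \<le> \<mu> * (wa \<bullet> wa + wb \<bullet> wb)"
        using min' unfolding n' q' by (simp add: algebra_simps)
      moreover have "\<mu> * (wa \<bullet> wa + wb \<bullet> wb) \<le> 0" using \<mu>0 by (intro mult_nonpos_nonneg) auto
      ultimately show False by simp
    qed
  qed
  have "\<exists>a b. (\<forall>x\<in>{0} \<times> {..0}. a \<bullet> x < b) \<and> (\<forall>x\<in>C. a \<bullet> x > b)"
  proof (rule separating_hyperplane_closed_compact)
    show "C \<noteq> {}" using e0 by (auto simp: C_def norm_Pair intro!: exI[of _ "(e0, 0)"])
    show "{0} \<times> {..0} \<inter> C = {}" using sep by auto
  qed (auto intro!: convex_Times closed_Times cC vC)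
  then obtain Y0 \<tau> b where sepY: "\<And>s. s \<le> 0 \<Longrightarrow> \<tau> * s < b" "\<And>X s. (X, s) \<in> C \<Longrightarrow> b < Y0 \<bullet> X + \<tau> * s"
    by fastforce
  have b: "0 < b" using sepY(1)[of 0] by simp
  have on_sphere: "b < Y0 \<bullet> T w w + \<tau> * q w w" if "w \<in> sphere 0 1" for w
    using that by (intro sepY(2)) (auto simp: C_def \<Phi>_def intro!: hull_inc)
  \<comment> \<open>A negative \<open>\<tau>\<close> is impossible because the half-line is
    unbounded below, and \<open>\<tau> = 0\<close> because \<open>T\<close> vanishes at the unit
    vector \<open>(0, e0)\<close> while \<open>b\<close> is positive.\<close>
  have \<tau>: "0 < \<tau>"
  proof -
    have "\<not> \<tau> < 0" using sepY(1)[of "b / \<tau>"] b by (auto simp: divide_le_0_iff)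
    moreover have "\<tau> \<noteq> 0"
    proof
      assume "\<tau> = 0"
      with on_sphere[of "(0, e0)"] e0 b show False
        by (simp add: T_def bilinear_lzero[OF bilinear_outer_product] bilinear_rzero[OF bilinear_outer_product] norm_Pair)
    qed
    ultimately show ?thesis by simp
  qed
  define Y where "Y = - (1 / (2 * \<tau>)) *\<^sub>R (Y0 + transpose Y0)"
  have YT: "2 * (x \<bullet> (Y *v v)) = - (1 / \<tau>) * (Y0 \<bullet> T (x, v) (x, v))" for x v
  proof -
    have "v \<bullet> (Y0 *v x) = x \<bullet> (transpose Y0 *v v)"
      by (metis dot_lmul_matrix inner_commute transpose_matrix_vector)
    moreover have "T (x, v) (x, v) = outer_product x v + outer_product v x"
      by (simp add: T_def vec_eq_iff)
    then have "Y0 \<bullet> T (x, v) (x, v) = x \<bullet> (Y0 *v v) + v \<bullet> (Y0 *v x)"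
      by (simp add: inner_add_right inner_outer_product)
    moreover have "x \<bullet> (Y *v v) = - (1 / (2 * \<tau>)) * (x \<bullet> (Y0 *v v) + x \<bullet> (transpose Y0 *v v))"
      by (simp only: Y_def scaleR_matrix_vector_assoc[symmetric] matrix_vector_mult_add_rdistrib
          inner_scaleR_right inner_add_right)
    ultimately show ?thesis using \<tau>
      by (simp add: field_simps del: transpose_matrix_vector)
  qed
  show thesis
  proof
    show "transpose Y = Y" by (simp add: Y_def transpose_def vec_eq_iff)
    show "2 * (x \<bullet> (Y *v v)) \<le> (norm (Z *v v - x))\<^sup>2 - \<theta> * (norm x)\<^sup>2" for x v
    proof -
      have "0 \<le> Y0 \<bullet> T (x, v) (x, v) + \<tau> * q (x, v) (x, v)"
      proof (cases "(x, v) = 0")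
        case True
        then show ?thesis by (simp only: bilinear_lzero[OF bT] bilinear_lzero[OF bq]) simp
      next
        case False
        let ?w = "(x, v)"
        have "0 < (1 / norm ?w)\<^sup>2 * (Y0 \<bullet> T ?w ?w + \<tau> * q ?w ?w)"
          using on_sphere[OF unit[OF False]] b unfolding hom by (simp add: algebra_simps)
        then show ?thesis by (auto simp: zero_less_mult_iff)
      qed
      then have "- (1 / \<tau>) * (Y0 \<bullet> T (x, v) (x, v)) \<le> q (x, v) (x, v)"
        using \<tau> by (simp add: field_simps)
      then show ?thesis unfolding YT[symmetric] qq .
    qed
  qed
qed

section \<open>Lyapunov matrices of Hurwitz matrices\<close>

context
  fixes f :: "complex^'k \<Rightarrow> complex^'k"
  assumes f: "Vector_Spaces.linear (*s) (*s) f"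
begin

interpretation f: Vector_Spaces.linear "(*s)" "(*s)" f by (rule f)

text \<open>The vector sought represents an eigenvector of the map induced on the quotient by
  \<open>E\<close>. Among the polynomials \<open>p\<close> with \<open>p(f) v\<close> in
  \<open>E\<close>, one of least degree has a complex root \<open>\<mu>\<close>; the cofactor of the
  linear factor, applied to \<open>v\<close>, is not in \<open>E\<close> by minimality.\<close>

lemma quotient_eigenvector:
  assumes E: "vec.subspace E" and v: "v \<notin> E"
  obtains w \<mu> where "w \<notin> E" "f w - \<mu> *s w \<in> E"
proof -
  \<comment> \<open>\<open>ap p\<close> is \<open>p(f) v\<close>, evaluated by Horner's
    rule.\<close>
  define ap where "ap = (\<lambda>p. fold_coeffs (\<lambda>a w. a *s v + f w) p 0)"
  have ap_pCons: "ap (pCons a p) = a *s v + f (ap p)" for a p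
    by (cases "p = 0 \<and> a = 0") (auto simp: ap_def)
  have ap0: "ap 0 = 0" by (simp add: ap_def)
  have ap_add: "ap (p + q) = ap p + ap q" for p q
    by (induction p q rule: poly_induct2) (simp_all add: ap0 ap_pCons f.add algebra_simps)
  have ap_smult: "ap (smult c p) = c *s ap p" for c p
    by (induction p) (simp_all add: ap0 ap_pCons f.scale vec.scale_right_distrib vec.scale_scale)
  have ap_sum: "ap (\<Sum>i\<in>I. g i) = (\<Sum>i\<in>I. ap (g i))" for g :: "nat \<Rightarrow> complex poly" and I
    by (induction I rule: infinite_finite_induct) (simp_all add: ap0 ap_add)
  have "\<exists>p. p \<noteq> 0 \<and> ap p = 0"
  \<comment> \<open>There are \<open>CARD('k) + 1\<close> iterates of \<open>v\<close>, one more
    than the dimension. Either two of them coincide, or they form a set that is large enough to be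
    linearly dependent.\<close>
  proof (cases "inj_on (\<lambda>i. ap (monom 1 i)) {..CARD('k)}")
    case False
    then obtain i j where ij: "i \<noteq> j" "ap (monom 1 i) = ap (monom 1 j)" by (auto simp: inj_on_def)
    have "ap (monom 1 i + smult (- 1) (monom 1 j)) = 0" unfolding ap_add ap_smult by (simp add: ij)
    moreover have "coeff (monom 1 i + smult (- 1) (monom (1::complex) j)) i \<noteq> coeff 0 i" using ij by simp
    ultimately show ?thesis by metis
  next
    case True
    define X where "X = (\<lambda>i. ap (monom 1 i)) ` {..CARD('k)}"
    have "card X = CARD('k) + 1" using card_image[OF True] by (simp add: X_def)
    moreover have "card X \<le> CARD('k)" if "\<not> vec.dependent X"
      using that vec.dim_eq_card_independent dim_subset_UNIV_cart_gen by metis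
    ultimately have "vec.dependent X" by force
    moreover have "finite X" by (simp add: X_def)
    ultimately obtain u where u: "\<exists>x\<in>X. u x \<noteq> 0" "(\<Sum>x\<in>X. u x *s x) = 0"
      using vec.dependent_finite by blast
    define p where "p = (\<Sum>i\<le>CARD('k). smult (u (ap (monom 1 i))) (monom 1 i))"
    have "ap p = (\<Sum>x\<in>X. u x *s x)"
      unfolding p_def ap_sum ap_smult X_def by (subst sum.reindex[OF True]) simp
    moreover have "p \<noteq> 0"
    proof -
      obtain i where i: "i \<le> CARD('k)" "u (ap (monom 1 i)) \<noteq> 0" using u(1) by (auto simp: X_def)
      have "coeff p i = u (ap (monom 1 i))"
        using i(1) by (simp add: p_def coeff_sum if_distrib cong: if_cong)
      then show ?thesis using i(2) by auto
    qed
    ultimately show ?thesis using u(2) by auto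
  qed
  then have ex: "\<exists>p. p \<noteq> 0 \<and> ap p \<in> E" using vec.subspace_0[OF E] by metis
  define p where "p = (ARG_MIN degree p. p \<noteq> 0 \<and> ap p \<in> E)"
  have p: "p \<noteq> 0" "ap p \<in> E" and pmin: "\<And>r. r \<noteq> 0 \<Longrightarrow> ap r \<in> E \<Longrightarrow> degree p \<le> degree r"
    using arg_min_natI[of "\<lambda>p. p \<noteq> 0 \<and> ap p \<in> E" _ degree] arg_min_nat_le[of "\<lambda>p. p \<noteq> 0 \<and> ap p \<in> E" _ degree] ex
    unfolding p_def by blast+
  \<comment> \<open>The fundamental theorem of algebra excludes nonzero constants in this form. A
    constant \<open>p\<close> would put \<open>v\<close> itself into \<open>E\<close>.\<close>
  have "\<not> (\<exists>a l. a \<noteq> 0 \<and> l = 0 \<and> p = pCons a l)"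
  proof
    assume "\<exists>a l. a \<noteq> 0 \<and> l = 0 \<and> p = pCons a l"
    then obtain c where c: "p = [:c:]" by blast
    then have "c *s v \<in> E" "c \<noteq> 0" using p by (simp_all add: ap_pCons ap0)
    then have "(1 / c) *s (c *s v) \<in> E" using vec.subspace_scale[OF E] by blast
    then show False using v \<open>c \<noteq> 0\<close> by (simp add: vec.scale_scale)
  qed
  then obtain \<mu> where "poly p \<mu> = 0" using fundamental_theorem_of_algebra_alt by blast
  then obtain r where r: "p = [:- \<mu>, 1:] * r" by (meson poly_eq_0_iff_dvd dvdE)
  have "r \<noteq> 0" using p r by auto
  then have "degree r < degree p" using degree_mult_eq[of "[:- \<mu>, 1:]" r] by (simp add: r del: mult_pCons_left)
  with pmin[OF \<open>r \<noteq> 0\<close>] have "ap r \<notin> E" by force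
  moreover have "ap p = f (ap r) - \<mu> *s ap r"
  proof -
    have "p = pCons 0 r + smult (- \<mu>) r" by (simp add: r)
    then have "ap p = (0 *s v + f (ap r)) + (- \<mu>) *s ap r" by (simp only: ap_add ap_smult ap_pCons)
    then show ?thesis by (simp add: vec.scale_minus_left)
  qed
  ultimately show thesis using that p(2) by metis
qed

text \<open>\<open>f - \<mu>\<close> maps the span of \<open>E\<close> and \<open>w\<close> into
  \<open>E\<close>, whose dimension is smaller by one, so it has a kernel there. An eigenvalue found
  on the quotient is thus a genuine one, to which the Hurwitz property applies.\<close>

lemma quotient_eigenvalue_imp_eigenvector:
  assumes E: "vec.subspace E" and inv: "\<And>e. e \<in> E \<Longrightarrow> f e \<in> E"
    and w: "w \<notin> E" "f w - \<mu> *s w \<in> E"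
  obtains z where "z \<noteq> 0" "f z = \<mu> *s z"
proof -
  define g where "g = (\<lambda>z. f z - \<mu> *s z)"
  have g: "Vector_Spaces.linear (*s) (*s) g"
    unfolding g_def
    by (unfold_locales) (simp_all add: f.add f.scale vec.scale_right_distrib vec.scale_right_diff_distrib vec.scale_scale mult.commute algebra_simps)
  interpret g: Vector_Spaces.linear "(*s)" "(*s)" g by (rule g)
  have "g ` insert w E \<subseteq> E"
    using w(2) inv vec.subspace_diff[OF E] vec.subspace_scale[OF E] by (auto simp: g_def)
  then have le: "vec.dim (g ` insert w E) \<le> vec.dim E" by (rule vec.dim_subset)
  have "vec.span E = E" by (rule vec.span_eq_iff[THEN iffD2, OF E])
  from vec.dim_insert[of w E, unfolded this] have "vec.dim (insert w E) = vec.dim E + 1" using w(1) by simp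
  then have "\<not> inj_on g (vec.span (insert w E))"
    using le vec.dim_image_eq[OF g, of "insert w E"] by force
  then obtain x y where "x \<noteq> y" "g x = g y" by (auto simp: inj_on_def)
  then have "x - y \<noteq> 0" "g (x - y) = 0" by (simp_all add: g.diff)
  then show thesis using that[of "x - y"] by (simp add: g_def)
qed

end

text \<open>Lyapunov's theorem in the direction in which the Lyapunov matrix is given: a maximal
  \<open>Y\<close>-orthogonal family that spans an invariant subspace and on which \<open>Y\<close> is positive spans the
  whole space, since an eigenvector of the quotient extends it.\<close>

theorem hurwitz_lyapunov_pos_def:
  fixes P Y :: "real^'k^'k"
  assumes P: "hurwitz P" and Y: "transpose Y = Y"
    and neg: "\<And>x. x \<noteq> 0 \<Longrightarrow> x \<bullet> (Y *v (P *v x)) < 0"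
  shows "pos_def Y"
proof -
  define f where "f = (\<lambda>v. map_matrix complex_of_real P *v v)"
  have f: "Vector_Spaces.linear (*s) (*s) f" unfolding f_def by (rule matrix_vector_mul_linear_gen)
  interpret f: Vector_Spaces.linear "(*s)" "(*s)" f by (rule f)
  define h :: "complex^'k \<Rightarrow> complex^'k \<Rightarrow> complex"
    where "h = (\<lambda>x y. \<Sum>i\<in>UNIV. \<Sum>j\<in>UNIV. cnj (x $ i) * of_real (Y $ i $ j) * y $ j)"
  have h_add: "h x (y + z) = h x y + h x z" for x y z
    by (simp add: h_def sum.distrib algebra_simps)
  have h_scale: "h x (c *s y) = c * h x y" for x y c
    by (simp add: h_def sum_distrib_left algebra_simps)
  have Yij: "Y $ i $ j = Y $ j $ i" for i j
    using Y by (metis (no_types, lifting) transpose_def vec_lambda_beta)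
  have h_cnj: "h y x = cnj (h x y)" for x y
    unfolding h_def by (subst sum.swap) (simp add: Yij mult_ac)
  have h_diff: "h x (y - z) = h x y - h x z" for x y z
    using h_add[of x y "(- 1) *s z"] h_scale[of x "- 1" z] by simp
  have h_0: "h x 0 = 0" for x by (simp add: h_def)
  have h_sum: "h x (\<Sum>i\<in>I. g i) = (\<Sum>i\<in>I. h x (g i))" for x g and I :: "(complex^'k) set"
    by (induction I rule: infinite_finite_induct) (simp_all add: h_add h_0)
  have h_real: "h x x = of_real (Re (h x x))" for x
    using h_cnj[of x x] by (simp add: complex_eq_iff)
  have h_cvec: "Re (h (cvec a b) (cvec c d)) = a \<bullet> (Y *v c) + b \<bullet> (Y *v d)" for a b c d
    by (simp add: h_def cvec_def inner_vec_def matrix_vector_mult_def sum_distrib_left sum.distrib mult.assoc)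
  have h_neg: "Re (h z (f z)) < 0" if "z \<noteq> 0" for z
  proof -
    obtain a b where z: "z = cvec a b" using cvec_Re_Im[of z] by metis
    have le: "x \<bullet> (Y *v (P *v x)) \<le> 0" for x using neg[of x] by (cases "x = 0") auto
    have "a \<noteq> 0 \<or> b \<noteq> 0" using that by (auto simp: z cvec_eq_0_iff)
    then show ?thesis using neg[of a] neg[of b] le[of a] le[of b]
      by (auto simp: z f_def matrix_mult_cvec h_cvec)
  qed
  define ok where "ok = (\<lambda>B. finite B \<and> (\<forall>b\<in>B. 0 < Re (h b b)) \<and> (\<forall>b\<in>B. \<forall>c\<in>B. b \<noteq> c \<longrightarrow> h b c = 0)
      \<and> (\<forall>b\<in>B. f b \<in> vec.span B))"
  have hb: "h b (\<Sum>c\<in>B. u c *s c) = u b * h b b" if "ok B" "b \<in> B" for B b u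
  proof -
    have "h b (\<Sum>c\<in>B. u c *s c) = (\<Sum>c\<in>B. u c * h b c)" by (simp add: h_sum h_scale)
    also have "\<dots> = (\<Sum>c\<in>B. if c = b then u b * h b b else 0)"
      using that by (intro sum.cong) (auto simp: ok_def)
    finally show ?thesis using that by (simp add: ok_def)
  qed
  \<comment> \<open>Orthogonal families with positive \<open>h b b\<close> are linearly independent.
    This bounds their size by the dimension, so a largest one exists.\<close>
  have bound: "card B < CARD('k) + 1" if B: "ok B" for B
  proof -
    have "\<not> vec.dependent B"
    proof
      assume "vec.dependent B"
      then obtain u b where u: "b \<in> B" "u b \<noteq> 0" "(\<Sum>c\<in>B. u c *s c) = 0"
        using B vec.dependent_finite[of B] by (auto simp: ok_def)
      have "u b * h b b = 0" using hb[OF B u(1), of u] u(3) by (simp add: h_0)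
      moreover have "0 < Re (h b b)" using B u(1) by (simp add: ok_def)
      ultimately show False using u(2) by auto
    qed
    then show ?thesis
      using vec.dim_eq_card_independent[of B] dim_subset_UNIV_cart_gen[of B] by simp
  qed
  have "ok {}" by (simp add: ok_def)
  then obtain B where B: "ok B" "\<And>B'. ok B' \<Longrightarrow> card B' \<le> card B"
    using ex_has_greatest_nat[of ok "{}" card "CARD('k) + 1"] bound by (auto simp: less_imp_le)
  have finB: "finite B" using B by (simp add: ok_def)
  have finv: "f e \<in> vec.span B" if "e \<in> vec.span B" for e
    using that
  proof (induction rule: vec.span_induct_alt)
    case base
    show ?case by (simp add: vec.span_zero)
  next
    case (step c x y)
    then show ?case using B(1) by (auto simp: ok_def f.add f.scale intro!: vec.span_add vec.span_scale)
  qed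
  have "vec.span B = UNIV"
  proof (rule ccontr)
    assume "\<not> ?thesis"
    then obtain v where v: "v \<notin> vec.span B" by auto
    obtain w0 \<mu> where w0: "w0 \<notin> vec.span B" "f w0 - \<mu> *s w0 \<in> vec.span B"
      using quotient_eigenvector[OF f vec.subspace_span v] by blast
    \<comment> \<open>The \<open>h\<close>-orthogonal projection of \<open>w0\<close> onto the span;
      the denominators are nonzero by positivity. Subtracting it preserves the eigenvector property
      modulo the span, because the span is invariant.\<close>
    define e where "e = (\<Sum>b\<in>B. (h b w0 / h b b) *s b)"
    define w where "w = w0 - e"
    have eB: "e \<in> vec.span B" unfolding e_def by (intro vec.span_sum vec.span_scale vec.span_base)
    have wB: "w \<notin> vec.span B" using w0(1) eB vec.span_add[of w B e] by (auto simp: w_def)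
    have fw: "f w - \<mu> *s w \<in> vec.span B"
    proof -
      have "f w - \<mu> *s w = (f w0 - \<mu> *s w0) - (f e - \<mu> *s e)"
        by (simp add: w_def f.diff vec.scale_right_diff_distrib)
      then show ?thesis using w0(2) eB finv[OF eB] by (metis vec.span_diff vec.span_scale)
    qed
    obtain z where z: "z \<noteq> 0" "f z = \<mu> *s z"
      using quotient_eigenvalue_imp_eigenvector[OF f vec.subspace_span finv wB fw] by blast
    then have mu: "Re \<mu> < 0" using P by (auto simp: hurwitz_def matrix_eigenvalue_def f_def)
    have orth: "h b w = 0" if "b \<in> B" for b
      using hb[OF B(1) that, of "\<lambda>b. h b w0 / h b b"] that B(1) by (force simp: w_def h_diff e_def ok_def)
    have orth': "h w b = 0" if "b \<in> B" for b using orth[OF that] h_cnj[of b w] by simp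
    have orthS: "h w y = 0" if "y \<in> vec.span B" for y
      using that by (induction rule: vec.span_induct_alt) (simp_all add: h_0 h_add h_scale orth')
    \<comment> \<open>\<open>w\<close> is orthogonal to \<open>f w - \<mu> w\<close>. The Lyapunov
      inequality makes the real part of the left side negative, and \<open>Re \<mu> < 0\<close>, so
      \<open>h w w\<close> must be positive and \<open>w\<close> extends the maximal family.\<close>
    have "h w (f w) = \<mu> * h w w"
      using orthS[OF fw] by (simp add: h_diff h_scale)
    then have "Re (h w (f w)) = Re \<mu> * Re (h w w)" by (subst (asm) h_real) simp
    moreover have "w \<noteq> 0" using wB vec.span_zero by auto
    ultimately have "Re \<mu> * Re (h w w) < 0" using h_neg by metis
    then have hw: "0 < Re (h w w)" using mu by (simp add: mult_less_0_iff)
    have "ok (insert w B)"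
    proof -
      have "f w \<in> vec.span (insert w B)"
        using fw vec.span_mono[OF subset_insertI[of B w]] vec.span_add[of "f w - \<mu> *s w" "insert w B" "\<mu> *s w"]
          vec.span_scale[OF vec.span_base[of w "insert w B"], of \<mu>] by auto
      moreover have "f b \<in> vec.span (insert w B)" if "b \<in> B" for b
        using B(1) that vec.span_mono[OF subset_insertI[of B w]] by (auto simp: ok_def)
      ultimately show ?thesis using B(1) hw orth orth' by (auto simp: ok_def)
    qed
    moreover have "card (insert w B) = card B + 1" using wB finB by (metis card_insert_disjoint vec.span_base Suc_eq_plus1)
    ultimately show False using B(2) by force
  qed
  have pos: "0 < Re (h x x)" if "x \<noteq> 0" for x
  proof -
    have "x \<in> vec.span B" using \<open>vec.span B = UNIV\<close> by simp
    then obtain u where u: "x = (\<Sum>b\<in>B. u b *s b)" using vec.span_finite[OF finB] by auto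
    have "h x x = (\<Sum>b\<in>B. u b * h x b)" by (subst u) (simp add: h_sum h_scale)
    also have "\<dots> = (\<Sum>b\<in>B. u b * cnj (u b) * h b b)"
    proof (rule sum.cong[OF refl])
      fix b assume b: "b \<in> B"
      have "h x b = cnj (u b * h b b)" using hb[OF B(1) b, of u] h_cnj[of b x] by (simp add: u)
      then show "u b * h x b = u b * cnj (u b) * h b b" using h_cnj[of b b] by simp
    qed
    finally have "Re (h x x) = (\<Sum>b\<in>B. (cmod (u b))\<^sup>2 * Re (h b b))"
      by (simp add: complex_norm_square[symmetric] flip: of_real_power)
    moreover have "\<exists>b\<in>B. u b \<noteq> 0"
    proof (rule ccontr)
      assume "\<not> ?thesis"
      then show False using that u by simp
    qed
    then obtain b where "b \<in> B" "u b \<noteq> 0" by blast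
    then have "0 < (\<Sum>b\<in>B. (cmod (u b))\<^sup>2 * Re (h b b))"
      using B(1) by (intro sum_pos2[of _ b]) (auto simp: ok_def less_imp_le)
    ultimately show ?thesis by simp
  qed
  have "0 < x \<bullet> (Y *v x)" if "x \<noteq> 0" for x
    using pos[of "cvec x 0"] that h_cvec[of x 0 x 0] by (simp add: cvec_eq_0_iff)
  then show ?thesis using Y by (simp add: pos_def_def)
qed

section \<open>The contraction metric\<close>

text \<open>A kernel vector would be an eigenvector for 0, whose real part is not negative.\<close>

lemma hurwitz_inverse:
  fixes P :: "real^'k^'k"
  assumes "hurwitz P"
  obtains Z where "P ** Z = mat 1" "Z ** P = mat 1"
proof -
  have "x = 0" if "P *v x = 0" for x
  proof (rule ccontr)
    assume "x \<noteq> 0"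
    then have "cvec x 0 \<noteq> 0" by (simp add: cvec_eq_0_iff)
    moreover have "map_matrix complex_of_real P *v cvec x 0 = 0 *s cvec x 0"
      by (simp add: matrix_mult_cvec that cvec_eq_0_iff)
    ultimately have "matrix_eigenvalue P 0" unfolding matrix_eigenvalue_def by blast
    then show False using assms by (force simp: hurwitz_def)
  qed
  then obtain Z where "Z ** P = mat 1"
    using matrix_left_invertible_ker by metis
  then show thesis using that matrix_left_right_inverse by blast
qed

text \<open>The symmetric operator \<open>D = I - S / \<beta>\<close> lies between 0 and
  \<open>\<delta> I\<close>. Evaluating its form at \<open>x - D x / \<delta>\<close> gives
  \<open>|D x|^2 \<le> \<delta> (x \<bullet> D x) \<le> \<delta>^2 |x|^2\<close>, with no recourse
  to eigenvalues.\<close>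

lemma symmetric_sandwich_norm_le:
  fixes S :: "real^'k^'k"
  assumes sym: "transpose S = S" and b: "0 < \<alpha>" "\<alpha> < \<beta>"
    and lo: "\<And>x. \<alpha> * (x \<bullet> x) \<le> x \<bullet> (S *v x)" and hi: "\<And>x. x \<bullet> (S *v x) \<le> \<beta> * (x \<bullet> x)"
  shows "(norm ((1 / \<beta>) *\<^sub>R (S *v x) - x))\<^sup>2 \<le> (1 - \<alpha> / \<beta>)\<^sup>2 * (norm x)\<^sup>2"
proof -
  define \<delta> where "\<delta> = 1 - \<alpha> / \<beta>"
  have \<delta>: "0 < \<delta>" using b by (simp add: \<delta>_def)
  define D where "D = (\<lambda>x. x - (1 / \<beta>) *\<^sub>R (S *v x))"
  have D_diff: "D (x - r *\<^sub>R y) = D x - r *\<^sub>R D y" for x y r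
    by (simp add: D_def matrix_vector_mult_diff_distrib matrix_vector_mult_scaleR algebra_simps)
  have D_sym: "x \<bullet> D y = y \<bullet> D x" for x y
    by (simp add: D_def inner_diff_right inner_commute)
       (metis dot_lmul_matrix inner_commute sym transpose_matrix_vector)
  have D_lo: "0 \<le> x \<bullet> D x" for x using hi[of x] b by (simp add: D_def inner_diff_right field_simps)
  have D_hi: "x \<bullet> D x \<le> \<delta> * (x \<bullet> x)" for x using lo[of x] b by (simp add: D_def \<delta>_def inner_diff_right field_simps)
  have "0 \<le> (x - (1 / \<delta>) *\<^sub>R D x) \<bullet> D (x - (1 / \<delta>) *\<^sub>R D x)" by (rule D_lo)
  also have "\<dots> = x \<bullet> D x - (2 / \<delta>) * (D x \<bullet> D x) + (1 / \<delta>)\<^sup>2 * (D x \<bullet> D (D x))"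
    using D_sym[of x "D x"]
    by (simp add: D_diff inner_diff_left inner_diff_right power2_eq_square algebra_simps)
  also have "\<dots> \<le> x \<bullet> D x - (2 / \<delta>) * (D x \<bullet> D x) + (1 / \<delta>)\<^sup>2 * (\<delta> * (D x \<bullet> D x))"
    using D_hi by (intro add_left_mono mult_left_mono) auto
  also have "\<dots> = x \<bullet> D x - (1 / \<delta>) * (D x \<bullet> D x)"
    using \<delta> by (simp add: power2_eq_square field_simps)
  finally have "D x \<bullet> D x \<le> \<delta> * (x \<bullet> D x)" using \<delta> by (simp add: field_simps)
  also have "\<dots> \<le> \<delta> * (\<delta> * (x \<bullet> x))" using \<delta> D_hi by (intro mult_left_mono) auto
  finally have "(norm (D x))\<^sup>2 \<le> \<delta>\<^sup>2 * (norm x)\<^sup>2"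
    by (simp add: power2_norm_eq_inner power2_eq_square[of \<delta>] mult.assoc)
  then show ?thesis by (simp add: D_def \<delta>_def norm_minus_commute)
qed

text \<open>\<open>Q\<close> and \<open>c\<close> are chosen before \<open>S\<close>, so that one
  metric and one rate are valid for the Hessians at all points and times.\<close>

theorem hamiltonian_matrix_contraction_metric:
  fixes P :: "real^'k^'k"
  assumes P: "hurwitz P" and b: "0 < \<alpha>" "\<alpha> < \<beta>" and e: "0 < \<epsilon>"
    and N: "\<And>l. matrix_eigenvalue (block2x2 P ((1 - \<alpha> / \<beta>) *\<^sub>R (P ** transpose P))
              (- mat (1 - \<alpha> / \<beta> + \<epsilon>)) (- transpose P)) l \<Longrightarrow> Re l \<noteq> 0"
  shows "\<exists>Q c. pos_def Q \<and> 0 < c \<and>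
    (\<forall>S. transpose S = S \<longrightarrow> (\<forall>x. \<alpha> * (x \<bullet> x) \<le> x \<bullet> (S *v x) \<and> x \<bullet> (S *v x) \<le> \<beta> * (x \<bullet> x)) \<longrightarrow>
      (\<forall>x. x \<bullet> (Q *v (P *v (S *v x))) \<le> - c * (x \<bullet> x)))"
proof -
  define \<delta> where "\<delta> = 1 - \<alpha> / \<beta>"
  have \<delta>: "0 < \<delta>" using b by (simp add: \<delta>_def)
  obtain Z where Z: "P ** Z = mat 1" "Z ** P = mat 1" by (rule hurwitz_inverse[OF P])
  have PZ: "P *v (Z *v x) = x" "Z *v (P *v x) = x" for x using Z by (simp_all add: matrix_vector_mul_assoc)
  have c: "0 < \<delta> + \<epsilon>" using \<delta> e by simp
  note freq = hamiltonian_matrix_frequency_condition[OF Z(1) \<delta> c, unfolded \<delta>_def, OF N, folded \<delta>_def]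
  have inj: "v = 0" if "Z *v v = 0" for v using PZ(1)[of v] that by simp
  obtain Y where Y: "transpose Y = Y"
    "\<And>x v. 2 * (x \<bullet> (Y *v v)) \<le> (norm (Z *v v - x))\<^sup>2 - \<delta> * (\<delta> + \<epsilon>) * (norm x)\<^sup>2"
    by (rule frequency_condition_imp_quadratic_bound[OF freq inj]) auto
  have YP: "2 * (x \<bullet> (Y *v (P *v z))) \<le> (norm (z - x))\<^sup>2 - \<delta> * (\<delta> + \<epsilon>) * (norm x)\<^sup>2" for x z
    using Y(2)[of x "P *v z"] by (simp add: PZ)
  show ?thesis
  \<comment> \<open>The quadratic bound leaves \<open>\<delta>^2 - \<delta> (\<delta> + \<epsilon>)
    = - \<delta> \<epsilon>\<close>; undoing the factor \<open>2 / \<beta>\<close> gives the rate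
    \<open>\<beta> \<delta> \<epsilon> / 2\<close>.\<close>
  proof (intro exI[of _ Y] exI[of _ "\<beta> * \<delta> * \<epsilon> / 2"] conjI allI impI)
    show "pos_def Y"
    proof (rule hurwitz_lyapunov_pos_def[OF P Y(1)])
      fix x :: "real^'k" assume "x \<noteq> 0"
      then have "0 < \<delta> * (\<delta> + \<epsilon>) * (norm x)\<^sup>2" using \<delta> c by simp
      then show "x \<bullet> (Y *v (P *v x)) < 0" using YP[of x x] by simp
    qed
    show "0 < \<beta> * \<delta> * \<epsilon> / 2" using b \<delta> e by simp
    fix S :: "real^'k^'k" and x
    assume S: "transpose S = S" "\<forall>x. \<alpha> * (x \<bullet> x) \<le> x \<bullet> (S *v x) \<and> x \<bullet> (S *v x) \<le> \<beta> * (x \<bullet> x)"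
    have "(2 / \<beta>) * (x \<bullet> (Y *v (P *v (S *v x)))) = 2 * (x \<bullet> (Y *v (P *v ((1 / \<beta>) *\<^sub>R (S *v x)))))"
      by (simp add: matrix_vector_mult_scaleR)
    also have "\<dots> \<le> (norm ((1 / \<beta>) *\<^sub>R (S *v x) - x))\<^sup>2 - \<delta> * (\<delta> + \<epsilon>) * (norm x)\<^sup>2" by (rule YP)
    also have "\<dots> \<le> \<delta>\<^sup>2 * (norm x)\<^sup>2 - \<delta> * (\<delta> + \<epsilon>) * (norm x)\<^sup>2"
      using symmetric_sandwich_norm_le[OF S(1) b, of x] S(2) by (simp add: \<delta>_def)
    also have "\<dots> = - (\<delta> * \<epsilon> * (x \<bullet> x))"
      unfolding power2_norm_eq_inner by (simp add: power2_eq_square algebra_simps)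
    finally show "x \<bullet> (Y *v (P *v (S *v x))) \<le> - (\<beta> * \<delta> * \<epsilon> / 2) * (x \<bullet> x)"
      using b by (simp add: field_simps)
  qed
qed

section \<open>Ordinary differential equations\<close>

lemma integral_has_vector_derivative_atLeast:
  fixes h :: "real \<Rightarrow> 'a::banach"
  assumes h: "continuous_on {t0..} h" and t: "t0 \<le> t"
  shows "((\<lambda>\<tau>. integral {t0..\<tau>} h) has_vector_derivative h t) (at t within {t0..})"
proof -
  have "((\<lambda>\<tau>. integral {t0..\<tau>} h) has_vector_derivative h t) (at t within {t0..t + 1})"
    using t by (intro integral_has_vector_derivative continuous_on_subset[OF h]) auto
  moreover have "at t within {t0..t + 1} = at t within {t0..}"
    by (rule at_within_nhd[of _ "{..<t + 1}"]) auto
  ultimately show ?thesis by simp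
qed

lemma integral_exp_shift_le:
  fixes m t0 t :: real
  assumes "0 < m" "t0 \<le> t"
  shows "integral {t0..t} (\<lambda>s. exp (m * (s - t0))) \<le> exp (m * (t - t0)) / m"
proof -
  have "((\<lambda>s. exp (m * (s - t0))) has_integral (exp (m * (t - t0)) / m - exp (m * (t0 - t0)) / m)) {t0..t}"
    using assms
    by (intro fundamental_theorem_of_calculus[where f="\<lambda>s. exp (m * (s - t0)) / m"])
       (auto intro!: derivative_eq_intros simp flip: has_real_derivative_iff_has_vector_derivative)
  then show ?thesis using assms by (simp add: integral_unique)
qed

text \<open>Banach's fixed point theorem is applied to the bounded function \<open>t \<mapsto> exp (- m (t - t0)) e(t)\<close>
  with \<open>m > 2 L\<close>, for which the Picard operator contracts on the whole half-line.\<close>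

theorem global_lipschitz_ode_solution:
  fixes g :: "'a::banach \<Rightarrow> real \<Rightarrow> 'a"
  assumes lip: "\<And>x y t. t0 \<le> t \<Longrightarrow> norm (g x t - g y t) \<le> L * norm (x - y)"
    and zero: "\<And>t. t0 \<le> t \<Longrightarrow> g 0 t = 0"
    and cont: "continuous_on (UNIV \<times> {t0..}) (\<lambda>(x, t). g x t)"
    and L: "0 \<le> L"
  obtains e where "e t0 = e0" "\<And>t. t0 \<le> t \<Longrightarrow> (e has_vector_derivative g (e t) t) (at t within {t0..})"
proof -
  \<comment> \<open>\<open>L / m \<le> 1 / 2\<close> is the contraction constant, and the summand 1
    keeps \<open>m\<close> positive when \<open>L = 0\<close>.\<close>
  define m where "m = 2 * L + 1"
  have m: "0 < m" "L / m \<le> 1 / 2" using L by (auto simp: m_def field_simps)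
  define h where "h = (\<lambda>(w :: real \<Rightarrow>\<^sub>C 'a) s. g (exp (m * (s - t0)) *\<^sub>R apply_bcontfun w s) s)"
  have h_cont: "continuous_on {t0..} (h w)" for w
    unfolding h_def
    by (rule continuous_on_compose2[OF cont, where f="\<lambda>s. (exp (m * (s - t0)) *\<^sub>R apply_bcontfun w s, s)", simplified])
       (auto intro!: continuous_intros)
  have h_int: "h w integrable_on {t0..t}" for w t
    by (intro integrable_continuous_real continuous_on_subset[OF h_cont]) auto
  have g_bound: "norm (g x t) \<le> L * norm x" if "t0 \<le> t" for x t
    using lip[OF that, of x 0] zero[OF that] by simp
  have exp_int: "(\<lambda>s. exp (m * (s - t0)) * B) integrable_on {t0..t}" for B t
    by (intro integrable_continuous_real continuous_intros)
  \<comment> \<open>The one estimate behind both the boundedness of the Picard operator and its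
    contraction: integrating \<open>exp (m (s - t0))\<close> gains the factor \<open>1 / m\<close>,
    and the weight removes the growth.\<close>
  have weighted: "exp (- (m * (t - t0))) * norm (integral {t0..t} f) \<le> B / 2"
    if f: "f integrable_on {t0..t}" and B: "0 \<le> B" and t: "t0 \<le> t"
      and le: "\<And>s. s \<in> {t0..t} \<Longrightarrow> norm (f s) \<le> L * (exp (m * (s - t0)) * B)" for f :: "real \<Rightarrow> 'a" and t B
  proof -
    have "norm (integral {t0..t} f) \<le> integral {t0..t} (\<lambda>s. exp (m * (s - t0)) * (L * B))"
      using le by (intro integral_norm_bound_integral f exp_int) (simp add: mult_ac)
    also have "\<dots> = integral {t0..t} (\<lambda>s. exp (m * (s - t0))) * (L * B)" by simp
    also have "\<dots> \<le> exp (m * (t - t0)) / m * (L * B)"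
      using L B m t by (intro mult_right_mono integral_exp_shift_le) auto
    finally have "exp (- (m * (t - t0))) * norm (integral {t0..t} f)
        \<le> exp (- (m * (t - t0))) * (exp (m * (t - t0)) / m * (L * B))" by (intro mult_left_mono) auto
    also have "\<dots> = (exp (- (m * (t - t0))) * exp (m * (t - t0))) * (L / m * B)" by simp
    also have "\<dots> = L / m * B" by (simp flip: exp_add)
    also have "\<dots> \<le> 1 / 2 * B" using m B by (intro mult_right_mono) auto
    finally show ?thesis by simp
  qed
  define F where "F = (\<lambda>w t. exp (- (m * (t - t0))) *\<^sub>R (e0 + integral {t0..t} (h w)))"
  \<comment> \<open>Freezing the argument at \<open>t0\<close> for earlier times gives a bounded
    continuous function on the whole line, an element of a complete space.\<close>
  define T where "T = (\<lambda>w. Bcontfun (\<lambda>t. F w (max t t0)))"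
  have F_cont: "continuous_on {t0..} (F w)" for w
  proof -
    have "continuous_on {t0..} (\<lambda>t. integral {t0..t} (h w))"
      using integral_has_vector_derivative_atLeast[OF h_cont]
      by (auto simp: continuous_on_eq_continuous_within intro: has_vector_derivative_continuous)
    then show ?thesis unfolding F_def by (intro continuous_intros)
  qed
  have h_bound: "norm (h w s) \<le> L * (exp (m * (s - t0)) * norm w)" if "t0 \<le> s" for w s
  proof -
    have "norm (h w s) \<le> L * norm (exp (m * (s - t0)) *\<^sub>R apply_bcontfun w s)"
      unfolding h_def by (rule g_bound[OF that])
    also have "\<dots> \<le> L * (exp (m * (s - t0)) * norm w)"
      using L by (auto intro!: mult_left_mono norm_bounded)
    finally show ?thesis .
  qed
  have F_bound: "norm (F w t) \<le> norm e0 + norm w / 2" if "t0 \<le> t" for w t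
  proof -
    have "norm (F w t) \<le> exp (- (m * (t - t0))) * (norm e0 + norm (integral {t0..t} (h w)))"
      by (simp add: F_def norm_triangle_ineq)
    also have "\<dots> \<le> norm e0 + norm w / 2"
      unfolding distrib_left using m that h_bound
      by (intro add_mono weighted h_int mult_left_le_one_le) auto
    finally show ?thesis .
  qed
  have T: "apply_bcontfun (T w) t = F w (max t t0)" for w t
  proof -
    have "continuous_on UNIV (\<lambda>t. F w (max t t0))"
      by (rule continuous_on_compose2[OF F_cont]) (auto intro!: continuous_intros)
    then have "(\<lambda>t. F w (max t t0)) \<in> bcontfun"
      by (rule bcontfun_normI) (rule F_bound, simp)
    then show ?thesis by (simp add: T_def Bcontfun_inverse)
  qed
  have "dist (T v) (T w) \<le> 1 / 2 * dist v w" for v w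
  proof (rule dist_bound)
    fix t
    define s where "s = max t t0"
    have s: "t0 \<le> s" by (simp add: s_def)
    have "dist (T v t) (T w t) = exp (- (m * (s - t0))) * norm (integral {t0..s} (\<lambda>r. h v r - h w r))"
      by (simp add: T s_def[symmetric] F_def dist_norm integral_diff[OF h_int h_int] flip: scaleR_diff_right)
    also have "\<dots> \<le> dist v w / 2"
    proof (rule weighted)
      fix r assume "r \<in> {t0..s}"
      then have r: "t0 \<le> r" by simp
      have "norm (h v r - h w r) \<le> L * norm (exp (m * (r - t0)) *\<^sub>R apply_bcontfun v r - exp (m * (r - t0)) *\<^sub>R apply_bcontfun w r)"
        unfolding h_def by (rule lip[OF r])
      also have "\<dots> = L * (exp (m * (r - t0)) * dist (apply_bcontfun v r) (apply_bcontfun w r))"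
        by (simp add: dist_norm flip: scaleR_diff_right)
      also have "\<dots> \<le> L * (exp (m * (r - t0)) * dist v w)"
        using L by (intro mult_left_mono dist_bounded) auto
      finally show "norm (h v r - h w r) \<le> L * (exp (m * (r - t0)) * dist v w)" .
    qed (auto intro!: integrable_diff h_int s)
    finally show "dist (T v t) (T w t) \<le> 1 / 2 * dist v w" by simp
  qed
  then obtain w where w: "T w = w" using banach_fix_type[of "1/2" T] by auto
  define e where "e = (\<lambda>t. e0 + integral {t0..t} (h w))"
  have ew: "e t = exp (m * (t - t0)) *\<^sub>R apply_bcontfun w t" if "t0 \<le> t" for t
    using T[of w t] that by (simp add: w F_def e_def exp_minus)
  have h_eq: "h w t = g (e t) t" if "t0 \<le> t" for t using ew[OF that] by (simp add: h_def)
  show thesis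
  proof
    show "e t0 = e0" by (simp add: e_def)
    show "(e has_vector_derivative g (e t) t) (at t within {t0..})" if "t0 \<le> t" for t
    proof -
      have "(e has_vector_derivative 0 + h w t) (at t within {t0..})"
        unfolding e_def
        by (intro has_vector_derivative_add has_vector_derivative_const
            integral_has_vector_derivative_atLeast[OF h_cont that])
      then show ?thesis by (simp add: h_eq[OF that])
    qed
  qed
qed

text \<open>The decay inequality is available only while \<open>v < R\<close>. Up to the first time
  at which \<open>R\<close> would be reached it does hold, and it gives
  \<open>v \<le> v t0 < R\<close> there, so that time never comes.\<close>

lemma exponential_decay_below_barrier:
  fixes v :: "real \<Rightarrow> real"
  assumes cont: "continuous_on {t0..T} v" and nn: "\<And>t. t \<in> {t0..T} \<Longrightarrow> 0 \<le> v t"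
    and deriv: "\<And>t. t0 < t \<Longrightarrow> t < T \<Longrightarrow> (v has_real_derivative v' t) (at t)"
    and decay: "\<And>t. t0 < t \<Longrightarrow> t < T \<Longrightarrow> v t < R \<Longrightarrow> v' t \<le> - m * v t"
    and m: "0 \<le> m" and start: "v t0 < R" and t: "t \<in> {t0..T}"
  shows "v t \<le> v t0 * exp (- m * (t - t0))" "v t < R"
proof -
  \<comment> \<open>The barrier is required only strictly before \<open>s\<close>, so this applies
    at the first hitting time itself, where \<open>v < R\<close> fails.\<close>
  have step: "v s \<le> v t0 * exp (- m * (s - t0))"
    if s: "s \<in> {t0..T}" and below: "\<And>r. t0 < r \<Longrightarrow> r < s \<Longrightarrow> v r < R" for s
  proof (cases "s = t0")
    case False
    then have "t0 < s" using s by simp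
    define f where "f = (\<lambda>r. v r * exp (m * (r - t0)))"
    have "continuous_on {t0..s} f"
      unfolding f_def using s by (intro continuous_intros continuous_on_subset[OF cont]) auto
    note f_cont = this
    have f_deriv: "(f has_derivative (\<lambda>h. (v' r * exp (m * (r - t0)) + v r * (m * exp (m * (r - t0)))) * h)) (at r)"
      if "t0 < r" "r < s" for r
      unfolding f_def has_field_derivative_def[symmetric]
      using deriv[of r] that s by (auto intro!: derivative_eq_intros)
    obtain r where r: "t0 < r" "r < s"
      "f s - f t0 = (v' r * exp (m * (r - t0)) + v r * (m * exp (m * (r - t0)))) * (s - t0)"
      by (rule mvt[OF \<open>t0 < s\<close> f_cont f_deriv])
    have "(v' r + m * v r) * exp (m * (r - t0)) \<le> 0"
      using decay[of r] below[of r] r s by (intro mult_nonpos_nonneg) auto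
    then have "f s - f t0 \<le> 0" unfolding r(3) using r by (intro mult_nonpos_nonneg) (auto simp: algebra_simps)
    then have "v s * exp (m * (s - t0)) \<le> v t0" by (simp add: f_def)
    then have "v s * exp (m * (s - t0)) * exp (- m * (s - t0)) \<le> v t0 * exp (- m * (s - t0))"
      by (intro mult_right_mono) auto
    then show ?thesis by (simp add: mult.assoc flip: exp_add)
  qed simp
  have le_start: "v t0 * exp (- m * (s - t0)) \<le> v t0" if "s \<in> {t0..T}" for s
    using nn[of t0] that m by (intro mult_left_le) auto
  have below: "v s < R" if "s \<in> {t0..T}" for s
  proof (rule ccontr)
    assume *: "\<not> v s < R"
    define X where "X = {r \<in> {t0..T}. R \<le> v r}"
    have X: "X = {t0..T} \<inter> v -` {R..}" by (auto simp: X_def)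
    then have "closed X" by (simp add: continuous_closed_preimage[OF cont])
    then have "compact X" using compact_Int_closed[of "{t0..T}" X] by (auto simp: X Int_left_absorb)
    moreover have "X \<noteq> {}" using * that by (auto simp: X_def)
    ultimately obtain r where r: "r \<in> X" "\<And>q. q \<in> X \<Longrightarrow> r \<le> q" using compact_attains_inf by metis
    have "v r \<le> v t0 * exp (- m * (r - t0))"
    proof (rule step)
      show "r \<in> {t0..T}" using r(1) by (simp add: X_def)
      show "v q < R" if "t0 < q" "q < r" for q using r(1) r(2)[of q] that by (force simp: X_def)
    qed
    then show False using r(1) le_start[of r] start by (auto simp: X_def)
  qed
  show "v t \<le> v t0 * exp (- m * (t - t0))" using t below by (intro step) auto
  show "v t < R" by (rule below[OF t])
qed

section \<open>Contraction in a constant metric\<close>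

lemma at_within_atLeast_eq: "a < t \<Longrightarrow> at t within {a..} = at (t::real)"
  by (rule at_within_interior) simp

context
  fixes Q :: "real^'k^'k"
  assumes Q: "pos_def Q"
begin

lemma pos_def_inner_commute: "x \<bullet> (Q *v y) = y \<bullet> (Q *v x)"
proof -
  have "transpose Q = Q" using Q by (simp add: pos_def_def)
  then show ?thesis by (metis dot_lmul_matrix inner_commute transpose_matrix_vector)
qed

lemma pos_def_nonneg: "0 \<le> x \<bullet> (Q *v x)"
  using Q by (cases "x = 0") (auto simp: pos_def_def less_imp_le)

text \<open>The constants are the extreme values of the form on the unit sphere, carried to all
  vectors by homogeneity.\<close>

lemma pos_def_bounds:
  obtains a b where "0 < a" "0 < b" "\<And>x. a * (x \<bullet> x) \<le> x \<bullet> (Q *v x)" "\<And>x. x \<bullet> (Q *v x) \<le> b * (x \<bullet> x)"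
proof -
  have cont: "continuous_on (sphere 0 1) (\<lambda>x. x \<bullet> (Q *v x))"
    by (intro continuous_intros bounded_linear.continuous_on[OF matrix_vector_mul_bounded_linear])
  have ne: "sphere (0::real^'k) 1 \<noteq> {}" using vector_choose_size[of 1] by force
  obtain p where p: "p \<in> sphere 0 1" "\<And>x. x \<in> sphere 0 1 \<Longrightarrow> p \<bullet> (Q *v p) \<le> x \<bullet> (Q *v x)"
    using continuous_attains_inf[OF compact_sphere ne cont] by blast
  obtain q where q: "q \<in> sphere 0 1" "\<And>x. x \<in> sphere 0 1 \<Longrightarrow> x \<bullet> (Q *v x) \<le> q \<bullet> (Q *v q)"
    using continuous_attains_sup[OF compact_sphere ne cont] by blast
  have scale: "x \<bullet> (Q *v x) = (x \<bullet> x) * (((1 / norm x) *\<^sub>R x) \<bullet> (Q *v ((1 / norm x) *\<^sub>R x)))" if "x \<noteq> 0" for x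
    using that by (simp add: matrix_vector_mult_scaleR power2_norm_eq_inner[symmetric] power2_eq_square)
  have on: "(1 / norm x) *\<^sub>R x \<in> sphere 0 1" if "x \<noteq> 0" for x :: "real^'k" using that by simp
  have pos: "0 < x \<bullet> (Q *v x)" if "x \<in> sphere 0 1" for x
  proof -
    have "x \<noteq> 0" using that by auto
    then show ?thesis using Q by (simp add: pos_def_def)
  qed
  show thesis
  proof (rule that[OF pos[OF p(1)] pos[OF q(1)]])
    fix x
    show "p \<bullet> (Q *v p) * (x \<bullet> x) \<le> x \<bullet> (Q *v x)"
    proof (cases "x = 0")
      case False
      show ?thesis unfolding scale[OF False] using mult_left_mono[OF p(2)[OF on[OF False]], of "x \<bullet> x"]
        by (simp only: inner_ge_zero mult.commute)
    qed simp
    show "x \<bullet> (Q *v x) \<le> q \<bullet> (Q *v q) * (x \<bullet> x)"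
    proof (cases "x = 0")
      case False
      show ?thesis unfolding scale[OF False] using mult_left_mono[OF q(2)[OF on[OF False]], of "x \<bullet> x"]
        by (simp only: inner_ge_zero mult.commute)
    qed simp
  qed
qed

lemma pos_def_Cauchy_Schwarz: "x \<bullet> (Q *v y) \<le> sqrt (x \<bullet> (Q *v x)) * sqrt (y \<bullet> (Q *v y))"
proof (cases "y = 0")
  case False
  define s where "s = y \<bullet> (Q *v y)"
  have s: "0 < s" using Q False by (simp add: s_def pos_def_def)
  define r where "r = (x \<bullet> (Q *v y)) / s"
  have "0 \<le> (x - r *\<^sub>R y) \<bullet> (Q *v (x - r *\<^sub>R y))" by (rule pos_def_nonneg)
  also have "\<dots> = x \<bullet> (Q *v x) - 2 * r * (x \<bullet> (Q *v y)) + r\<^sup>2 * s"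
    using pos_def_inner_commute[of y x]
    by (simp add: matrix_vector_mult_diff_distrib matrix_vector_mult_scaleR inner_diff_left inner_diff_right
        s_def power2_eq_square algebra_simps)
  also have "\<dots> = x \<bullet> (Q *v x) - (x \<bullet> (Q *v y))\<^sup>2 / s"
    using s by (simp add: r_def power2_eq_square field_simps)
  finally have "(x \<bullet> (Q *v y))\<^sup>2 \<le> (x \<bullet> (Q *v x)) * s" using s by (simp add: field_simps)
  then have "\<bar>x \<bullet> (Q *v y)\<bar> \<le> sqrt ((x \<bullet> (Q *v x)) * s)" by (metis real_sqrt_abs real_sqrt_le_mono)
  then show ?thesis by (simp add: s_def real_sqrt_mult)
qed simp

text \<open>Straight segments are shortest. Pairing the velocity of a curve with \<open>Q w\<close>
  integrates to \<open>w \<bullet> (Q *v w)\<close>, and the Cauchy-Schwarz inequality bounds the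
  integrand by the speed times the length of \<open>w\<close>.\<close>

lemma metric_dist_const: "metric_dist (\<lambda>_. Q) x y = sqrt ((y - x) \<bullet> (Q *v (y - x)))"
proof -
  define w where "w = y - x"
  define n where "n = (\<lambda>v. sqrt (v \<bullet> (Q *v v)))"
  let ?L = "metric_length (\<lambda>_. Q)"
  let ?C = "{c. c C1_differentiable_on {0..1} \<and> c 0 = x \<and> c 1 = y}"
  have lower: "n w \<le> ?L c" if c: "c \<in> ?C" for c
  proof -
    \<comment> \<open>These derivatives are two-sided at both endpoints as well, so the
      \<open>vector_derivative\<close> in the length is \<open>D\<close> throughout.\<close>
    obtain D where D: "\<And>s. s \<in> {0..1} \<Longrightarrow> (c has_vector_derivative D s) (at s)" "continuous_on {0..1} D"
      using c unfolding C1_differentiable_on_def by blast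
    have L: "?L c = integral {0..1} (\<lambda>s. n (D s))"
      unfolding metric_length_def n_def
      by (rule integral_cong) (simp add: vector_derivative_at[OF D(1)])
    have cn: "continuous_on {0..1} (\<lambda>s. n (D s))"
      unfolding n_def
      by (intro continuous_intros bounded_linear.continuous_on[OF matrix_vector_mul_bounded_linear] D(2))
    have "(D has_integral (c 1 - c 0)) {0..1}"
      using has_vector_derivative_at_within[OF D(1)] by (intro fundamental_theorem_of_calculus) auto
    then have "((\<lambda>s. D s \<bullet> (Q *v w)) has_integral (w \<bullet> (Q *v w))) {0..1}"
      using c has_integral_linear[OF _ bounded_linear_inner_left, of D "c 1 - c 0" "{0..1}" "Q *v w"]
      by (auto simp: o_def w_def)
    then have "w \<bullet> (Q *v w) = integral {0..1} (\<lambda>s. D s \<bullet> (Q *v w))" by (simp add: integral_unique)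
    also have "\<dots> \<le> integral {0..1} (\<lambda>s. n (D s) * n w)"
      using pos_def_Cauchy_Schwarz
      by (intro integral_le integrable_continuous_real continuous_intros cn D(2)) (auto simp: n_def)
    also have "\<dots> = ?L c * n w" by (simp add: L)
    finally have "n w * n w \<le> ?L c * n w" by (simp add: n_def pos_def_nonneg)
    moreover have "0 \<le> ?L c"
      unfolding L by (intro integral_nonneg integrable_continuous_real cn) (simp add: n_def pos_def_nonneg)
    moreover have "0 \<le> n w" by (simp add: n_def pos_def_nonneg)
    ultimately show ?thesis by (cases "n w = 0") auto
  qed
  define c where "c = (\<lambda>s::real. x + s *\<^sub>R w)"
  have dc: "(c has_vector_derivative w) (at s)" for s
    unfolding c_def by (auto intro!: derivative_eq_intros)
  moreover have "c 0 = x" "c 1 = y" by (simp_all add: c_def w_def)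
  ultimately have cC: "c \<in> ?C"
    by (auto simp: C1_differentiable_on_def intro!: exI[of _ "\<lambda>_. w"])
  have "?L c = n w" by (simp add: metric_length_def vector_derivative_at[OF dc] n_def)
  then have "Inf (?L ` ?C) = n w"
    using cC lower by (intro cInf_eq_minimum) (auto intro!: image_eqI[of _ _ c])
  then show ?thesis by (simp add: metric_dist_def n_def w_def)
qed

lemma metric_ball_const:
  assumes "0 < r"
  shows "metric_ball (\<lambda>_. Q) x r = {y. (y - x) \<bullet> (Q *v (y - x)) < r\<^sup>2}"
  using assms pos_def_nonneg
  by (auto simp: metric_ball_def metric_dist_const real_less_rsqrt real_sqrt_less_iff intro: real_less_lsqrt)
     (metis less_eq_real_def real_sqrt_abs abs_of_nonneg real_sqrt_less_iff)+

text \<open>For weights with \<open>u + v = 1\<close> the convexity defect of the form at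
  \<open>x\<close> and \<open>y\<close> is exactly \<open>u v\<close> times its value at
  \<open>x - y\<close>.\<close>

lemma convex_quadratic_sublevel: "convex {y. y \<bullet> (Q *v y) < R}" "convex {y. y \<bullet> (Q *v y) \<le> R}"
proof -
  have key: "(u *\<^sub>R x + v *\<^sub>R y) \<bullet> (Q *v (u *\<^sub>R x + v *\<^sub>R y)) \<le> u * (x \<bullet> (Q *v x)) + v * (y \<bullet> (Q *v y))"
    if "0 \<le> u" "0 \<le> v" "u + v = 1" for u v x y
  proof -
    have v: "v = 1 - u" using that by simp
    have "0 \<le> u * v * ((x - y) \<bullet> (Q *v (x - y)))" using that pos_def_nonneg by simp
    also have "\<dots> = u * (x \<bullet> (Q *v x)) + v * (y \<bullet> (Q *v y)) - (u *\<^sub>R x + v *\<^sub>R y) \<bullet> (Q *v (u *\<^sub>R x + v *\<^sub>R y))"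
      using pos_def_inner_commute[of y x]
      by (simp add: v matrix_vector_mult_diff_distrib matrix_vector_right_distrib matrix_vector_mult_scaleR
          inner_diff_left inner_diff_right inner_add_left inner_add_right algebra_simps)
    finally show ?thesis by simp
  qed
  show "convex {y. y \<bullet> (Q *v y) < R}" "convex {y. y \<bullet> (Q *v y) \<le> R}"
  proof -
    show "convex {y. y \<bullet> (Q *v y) < R}"
      unfolding convex_def by (auto intro!: le_less_trans[OF key] convex_bound_lt)
    show "convex {y. y \<bullet> (Q *v y) \<le> R}"
      unfolding convex_def by (auto intro!: order_trans[OF key] convex_bound_le)
  qed
qed

text \<open>A solution starting inside a ball of radius \<open>r\<close> around \<open>xs\<close> is obtained from the globally
  Lipschitz field that precomposes \<open>f\<close> with the projection of the deviation \<open>x - xs\<close> onto a slightly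
  smaller closed ball; it solves the original equation because contraction keeps it in that ball.\<close>

theorem const_metric_contraction_attracts_balls:
  fixes f :: "real^'k \<Rightarrow> real \<Rightarrow> real^'k"
  assumes c: "0 < c" and L: "0 \<le> L"
    and f': "\<And>x t. x \<in> D \<Longrightarrow> 0 \<le> t \<Longrightarrow> ((\<lambda>y. f y t) has_derivative f' x t) (at x)"
    and contr: "\<And>x t v. x \<in> D \<Longrightarrow> 0 \<le> t \<Longrightarrow> v \<bullet> (Q *v f' x t v) \<le> - c * (v \<bullet> v)"
    and lip: "\<And>x t v. x \<in> D \<Longrightarrow> 0 \<le> t \<Longrightarrow> norm (f' x t v) \<le> L * norm v"
    and cont: "continuous_on (UNIV \<times> {0..}) (\<lambda>(x, t). f x t)"
    and xs: "solves_on f {0..} xs"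
  shows "exp_attracts_balls f D (\<lambda>_ _. Q) xs"
proof -
  obtain a b where ab: "0 < a" "0 < b" "\<And>x. a * (x \<bullet> x) \<le> x \<bullet> (Q *v x)" "\<And>x. x \<bullet> (Q *v x) \<le> b * (x \<bullet> x)"
    by (rule pos_def_bounds) blast
  \<comment> \<open>As the form is at most \<open>b |w|^2\<close>, the bound
    \<open>- c |w|^2\<close> is at most \<open>- k\<close> times the form. The form then decays at
    rate \<open>2 k\<close> and the norm at rate \<open>k\<close>.\<close>
  define k where "k = c / b"
  have k: "0 < k" using c ab by (simp add: k_def)
  have xs': "(xs has_vector_derivative f (xs t) t) (at t within {0..})" if "0 \<le> t" for t
    using xs that by (simp add: solves_on_def)
  have xs_cont: "continuous_on {0..} xs"
    using xs' by (auto simp: continuous_on_eq_continuous_within intro: has_vector_derivative_continuous)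
  define q where "q = (\<lambda>x. x \<bullet> (Q *v x))"
  have q_cont: "continuous_on X (\<lambda>t. q (g t))" if "continuous_on X g" for X :: "real set" and g
    unfolding q_def by (intro continuous_intros bounded_linear.continuous_on[OF matrix_vector_mul_bounded_linear] that)
  have q_deriv: "((\<lambda>t. q (g t)) has_real_derivative 2 * (g t \<bullet> (Q *v g'))) (at t)"
    if "(g has_vector_derivative g') (at t)" for g g' t
  proof -
    have "((\<lambda>t. g t \<bullet> (Q *v g t)) has_real_derivative (g t \<bullet> (Q *v g') + g' \<bullet> (Q *v g t))) (at t)"
      unfolding has_real_derivative_iff_has_vector_derivative
      by (intro bounded_bilinear.has_vector_derivative[OF bounded_bilinear_inner] that
          bounded_linear.has_vector_derivative[OF matrix_vector_mul_bounded_linear])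
    then show ?thesis unfolding q_def using pos_def_inner_commute[of g' "g t"] by simp
  qed
  show ?thesis
    unfolding exp_attracts_balls_def
  \<comment> \<open>The factor comes from comparing the Euclidean norm with the metric in both
    directions. Neither it nor \<open>k\<close> involves the radius, as the order of the quantifiers
    demands.\<close>
  proof (rule exI[of _ "sqrt (b / a)"], intro exI[of _ k] conjI allI impI ballI)
    show "0 < sqrt (b / a)" "0 < k" using ab k by auto
    fix r :: real assume r: "0 < r" and "\<forall>t\<ge>0. metric_ball (\<lambda>y. Q) (xs t) r \<subseteq> D"
    then have ball: "x \<in> D" if "0 \<le> t" "q (x - xs t) < r\<^sup>2" for x t
      using that by (auto simp: metric_ball_const q_def)
    define B where "B = (\<lambda>t. {x. q (x - xs t) < r\<^sup>2})"
    have cB: "convex (B t)" for t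
    proof -
      have "B t = (\<lambda>y. xs t + y) ` {y. q y < r\<^sup>2}" by (force simp: B_def image_iff)
      then show ?thesis using convex_quadratic_sublevel by (simp add: convex_translation q_def)
    qed
    have BD: "B t \<subseteq> D" if "0 \<le> t" for t using ball[OF that] by (auto simp: B_def)
    have xsB: "xs t \<in> B t" for t using r by (simp add: B_def q_def)
    have f_contr: "(x - xs t) \<bullet> (Q *v (f x t - f (xs t) t)) \<le> - k * q (x - xs t)"
      if t: "0 \<le> t" and x: "q (x - xs t) < r\<^sup>2" for x t
    proof -
      define w where "w = x - xs t"
      \<comment> \<open>The mean value theorem in equality form needs a scalar function, so the
        field is paired with \<open>Q w\<close> along the segment from \<open>xs t\<close> to
        \<open>x\<close>, which convexity keeps in the ball.\<close>
      define \<phi> where "\<phi> = (\<lambda>s. w \<bullet> (Q *v f (xs t + s *\<^sub>R w) t))"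
      have inD: "xs t + s *\<^sub>R w \<in> D" if "0 \<le> s" "s \<le> 1" for s
      proof -
        have "(1 - s) *\<^sub>R xs t + s *\<^sub>R x \<in> B t"
          using that x xsB by (intro convexD[OF cB]) (auto simp: B_def)
        then show ?thesis using BD[OF t] by (auto simp: w_def algebra_simps)
      qed
      have \<phi>': "(\<phi> has_derivative (\<lambda>h. w \<bullet> (Q *v f' (xs t + s *\<^sub>R w) t (h *\<^sub>R w)))) (at s)" if "0 \<le> s" "s \<le> 1" for s
      proof -
        have "((\<lambda>s. f (xs t + s *\<^sub>R w) t) has_derivative (\<lambda>h. f' (xs t + s *\<^sub>R w) t (h *\<^sub>R w))) (at s)"
          by (rule has_derivative_compose[where f="\<lambda>s. xs t + s *\<^sub>R w" and g="\<lambda>y. f y t" and f'="\<lambda>h. h *\<^sub>R w",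
                OF _ f'[OF inD[OF that] t]]) (auto intro!: derivative_eq_intros)
        from bounded_linear.has_derivative[OF matrix_vector_mul_bounded_linear[of Q] this]
        show ?thesis unfolding \<phi>_def by (rule has_derivative_inner_right)
      qed
      obtain s where s: "0 < s" "s < 1" "\<phi> 1 - \<phi> 0 = w \<bullet> (Q *v f' (xs t + s *\<^sub>R w) t ((1 - 0) *\<^sub>R w))"
      proof -
        have "continuous_on {0..1} \<phi>"
          by (rule has_derivative_continuous_on, rule has_derivative_at_withinI, rule \<phi>') auto
        from mvt[OF zero_less_one this \<phi>'] show thesis using that by (metis less_imp_le)
      qed
      have "w \<bullet> (Q *v (f x t - f (xs t) t)) = \<phi> 1 - \<phi> 0"
        by (simp add: \<phi>_def w_def matrix_vector_mult_diff_distrib inner_diff_right)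
      also have "\<dots> \<le> - c * (w \<bullet> w)" using contr[OF inD t, of s w] s by simp
      also have "\<dots> \<le> - k * q w"
      proof -
        have "k * q w \<le> k * (b * (w \<bullet> w))" using k ab(4)[of w] by (intro mult_left_mono) (auto simp: q_def)
        then show ?thesis using ab by (simp add: k_def)
      qed
      finally show ?thesis by (simp add: w_def)
    qed
    have f_lip: "norm (f x t - f y t) \<le> L * norm (x - y)" if "0 \<le> t" "x \<in> B t" "y \<in> B t" for x y t
    proof (rule differentiable_bound[OF cB[of t] _ _ that(2,3)])
      fix z assume z: "z \<in> B t"
      then have "z \<in> D" using BD that by auto
      then show "((\<lambda>y. f y t) has_derivative f' z t) (at z within B t)"
        using f'[OF _ that(1)] by (blast intro: has_derivative_at_withinI)
      show "onorm (f' z t) \<le> L" using \<open>z \<in> D\<close> by (intro onorm_le lip that(1))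
    qed
    \<comment> \<open>The curve has to satisfy the equation only where its deviation is below
      \<open>R\<close>, so this covers the solution of the truncated field, with
      \<open>R < r^2\<close>, as well as an arbitrary solution, with \<open>R = r^2\<close>.\<close>
    have decay: "q (x t - xs t) \<le> q (x t0 - xs t0) * exp (- (2 * k) * (t - t0)) \<and> q (x t - xs t) < R"
      if t0: "0 \<le> t0" and x: "continuous_on {t0..T} x" and R: "R \<le> r\<^sup>2" "q (x t0 - xs t0) < R" and t: "t \<in> {t0..T}"
        and x': "\<And>t. t0 < t \<Longrightarrow> t < T \<Longrightarrow> q (x t - xs t) < R \<Longrightarrow> (x has_vector_derivative f (x t) t) (at t)"
        and xd: "\<And>t. t0 < t \<Longrightarrow> t < T \<Longrightarrow> x differentiable (at t)"
      for x t0 T R t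
    proof -
      define v' where "v' = (\<lambda>t. 2 * ((x t - xs t) \<bullet> (Q *v (vector_derivative x (at t) - f (xs t) t))))"
      have xs_at: "(xs has_vector_derivative f (xs t) t) (at t)" if "t0 < t" for t
        using xs'[of t] t0 that at_within_atLeast_eq[of 0 t] by simp
      define v where "v = (\<lambda>t. q (x t - xs t))"
      have v_cont: "continuous_on {t0..T} v"
        unfolding v_def using t0 by (intro q_cont continuous_on_diff x continuous_on_subset[OF xs_cont]) auto
      have v_deriv: "(v has_real_derivative v' s) (at s)" if "t0 < s" "s < T" for s
        unfolding v'_def v_def using xd[OF that] xs_at[OF that(1)]
        by (intro q_deriv has_vector_derivative_diff) (simp_all add: vector_derivative_works[symmetric])
      have v_decay: "v' s \<le> - (2 * k) * v s" if s: "t0 < s" "s < T" and "v s < R" for s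
      proof -
        have "q (x s - xs s) < R" using that(3) by (simp add: v_def)
        then show ?thesis
          using f_contr[of s "x s"] s t0 R by (simp add: v'_def v_def vector_derivative_at[OF x'[OF s]])
      qed
      have v_nonneg: "0 \<le> v s" for s by (simp add: v_def q_def pos_def_nonneg)
      have "v t0 < R" "0 \<le> 2 * k" using R k by (simp_all add: v_def)
      from exponential_decay_below_barrier[OF v_cont v_nonneg v_deriv v_decay this(2,1) t]
      show ?thesis by (simp add: v_def)
    qed
    fix t0 x0 assume t0: "(0::real) \<le> t0" and x0: "x0 \<in> metric_ball (\<lambda>y. Q) (xs t0) r"
    have q0: "q (x0 - xs t0) < r\<^sup>2" using x0 r by (simp add: metric_ball_const q_def)
    show "\<exists>x. solves_on f {t0..} x \<and> x t0 = x0"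
    proof -
      \<comment> \<open>A level strictly between leaves the start inside the barrier while the
        closed set \<open>{q \<le> R}\<close> stays inside the open ball, where the Lipschitz bound
        holds.\<close>
      obtain R where R: "q (x0 - xs t0) < R" "R < r\<^sup>2" using dense q0 by blast
      define K where "K = {y. q y \<le> R}"
      have "0 \<le> R" using R pos_def_nonneg[of "x0 - xs t0"] by (simp add: q_def)
      then have K0: "0 \<in> K" by (simp add: K_def q_def)
      have Kc: "closed K" "convex K"
      proof -
        have "continuous_on UNIV q" unfolding q_def
          by (intro continuous_intros bounded_linear.continuous_on[OF matrix_vector_mul_bounded_linear])
        then show "closed K" unfolding K_def by (intro closed_Collect_le) auto
        show "convex K" unfolding K_def q_def by (rule convex_quadratic_sublevel)
      qed
      have Kne: "K \<noteq> {}" using K0 by auto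
      define p where "p = closest_point K"
      have pK: "p y \<in> K" for y unfolding p_def by (rule closest_point_in_set[OF Kc(1) Kne])
      have p_id: "p y = y" if "q y \<le> R" for y using that by (simp add: p_def closest_point_self K_def)
      have pB: "xs t + p y \<in> B t" for t y using pK[of y] R by (simp add: B_def K_def)
      \<comment> \<open>This is the truncated equation for the deviation from \<open>xs\<close>. The
        closest-point map is nonexpansive, so the constant \<open>L\<close> survives, and
        subtracting \<open>f (xs t) t\<close> makes 0 an equilibrium.\<close>
      define g where "g = (\<lambda>y t. f (xs t + p y) t - f (xs t) t)"
      have g_lip: "norm (g x t - g y t) \<le> L * norm (x - y)" if "t0 \<le> t" for x y t
      proof -
        have "norm (g x t - g y t) \<le> L * norm ((xs t + p x) - (xs t + p y))"
          unfolding g_def using f_lip[OF _ pB pB, of t x y] that t0 by simp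
        also have "\<dots> \<le> L * norm (x - y)"
          using L closest_point_lipschitz[OF Kc(2,1) Kne, of x y]
          by (intro mult_left_mono) (auto simp: p_def dist_norm)
        finally show ?thesis .
      qed
      have g0: "g 0 t = 0" for t by (simp add: g_def p_id q_def \<open>0 \<le> R\<close>)
      have g_cont: "continuous_on (UNIV \<times> {t0..}) (\<lambda>(y, t). g y t)"
      proof -
        have c1: "continuous_on (UNIV \<times> {t0..}) (\<lambda>z. xs (snd z))"
          by (rule continuous_on_compose2[OF xs_cont]) (use t0 in \<open>auto intro!: continuous_intros\<close>)
        have c2: "continuous_on (UNIV \<times> {t0..}) (\<lambda>z. p (fst z))"
          unfolding p_def
          by (rule continuous_on_compose2[OF continuous_on_closest_point[OF Kc(2,1) Kne, of UNIV]])
             (auto intro!: continuous_intros)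
        have c3: "continuous_on (UNIV \<times> {t0..}) (\<lambda>z. (\<lambda>(x, t). f x t) (h z, snd z))"
          if "continuous_on (UNIV \<times> {t0..}) h" for h :: "(real^'k) \<times> real \<Rightarrow> real^'k"
          by (rule continuous_on_compose2[OF cont]) (use t0 that in \<open>auto intro!: continuous_intros\<close>)
        show ?thesis
          using continuous_on_diff[OF c3[OF continuous_on_add[OF c1 c2]] c3[OF c1]]
          by (simp add: g_def case_prod_beta)
      qed
      obtain e where e: "e t0 = x0 - xs t0" "\<And>t. t0 \<le> t \<Longrightarrow> (e has_vector_derivative g (e t) t) (at t within {t0..})"
        using global_lipschitz_ode_solution[OF g_lip g0 g_cont L] by metis
      define x where "x = (\<lambda>t. xs t + e t)"
      have x'1: "(x has_vector_derivative f (xs t) t + g (e t) t) (at t within {t0..})" if "t0 \<le> t" for t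
        unfolding x_def using t0 that
        by (intro has_vector_derivative_add e has_vector_derivative_within_subset[OF xs']) auto
      have x_cont: "continuous_on {t0..} x"
        using x'1 by (auto simp: continuous_on_eq_continuous_within intro: has_vector_derivative_continuous)
      have eq: "f (xs t) t + g (e t) t = f (x t) t" if "q (x t - xs t) < R" for t
        using that by (simp add: x_def g_def p_id)
      have x'2: "(x has_vector_derivative f (xs t) t + g (e t) t) (at t)" if "t0 < t" for t
        using x'1[of t] that at_within_atLeast_eq[of t0 t] by simp
      have inside: "q (x t - xs t) < R" if t: "t0 \<le> t" for t
      proof (rule decay[THEN conjunct2, OF t0])
        show "continuous_on {t0..t} x" by (rule continuous_on_subset[OF x_cont]) auto
        show "q (x t0 - xs t0) < R" using R by (simp add: x_def e)
        fix s assume s: "t0 < s"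
        show "x differentiable (at s)" using x'2[OF s] by (rule differentiableI_vector)
        assume "q (x s - xs s) < R"
        then show "(x has_vector_derivative f (x s) s) (at s)" using x'2[OF s] eq by simp
      qed (use R t in auto)
      have "solves_on f {t0..} x" using x'1 eq[OF inside] by (simp add: solves_on_def)
      moreover have "x t0 = x0" by (simp add: x_def e)
      ultimately show ?thesis by blast
    qed
    fix T x t assume x: "solves_on f {t0..T} x \<and> x t0 = x0" and t: "t \<in> {t0..T}"
    have x': "(x has_vector_derivative f (x t) t) (at t within {t0..T})" if "t \<in> {t0..T}" for t
      using x that by (simp add: solves_on_def)
    have x'': "(x has_vector_derivative f (x t) t) (at t)" if "t0 < t" "t < T" for t
      using x'[of t] that at_within_Icc_at[of t0 t T] by simp
    have "q (x t - xs t) \<le> q (x t0 - xs t0) * exp (- (2 * k) * (t - t0)) \<and> q (x t - xs t) < r\<^sup>2"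
    proof (rule decay[OF t0 _ order_refl _ t])
      show "continuous_on {t0..T} x"
        unfolding continuous_on_eq_continuous_within using has_vector_derivative_continuous[OF x'] by blast
      show "q (x t0 - xs t0) < r\<^sup>2" using q0 x by simp
    qed (auto intro: x'' differentiableI_vector)
    then have dec: "q (x t - xs t) \<le> q (x0 - xs t0) * exp (- (2 * k) * (t - t0))" and ins: "q (x t - xs t) < r\<^sup>2"
      using x by auto
    show "x t \<in> metric_ball (\<lambda>y. Q) (xs t) r" using ins r by (simp add: metric_ball_const q_def)
    show "norm (x t - xs t) \<le> sqrt (b / a) * exp (- k * (t - t0)) * norm (x0 - xs t0)"
    proof -
      have "a * (norm (x t - xs t))\<^sup>2 \<le> q (x t - xs t)" using ab(3) by (simp add: q_def power2_norm_eq_inner)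
      also note dec
      also have "q (x0 - xs t0) * exp (- (2 * k) * (t - t0)) \<le> (b * (norm (x0 - xs t0))\<^sup>2) * exp (- (2 * k) * (t - t0))"
        using ab(4) by (intro mult_right_mono) (auto simp: q_def power2_norm_eq_inner)
      also have "exp (- (2 * k) * (t - t0)) = (exp (- k * (t - t0)))\<^sup>2"
        by (simp add: power2_eq_square flip: exp_add)
      finally have "(norm (x t - xs t))\<^sup>2 \<le> (b / a) * (norm (x0 - xs t0))\<^sup>2 * (exp (- k * (t - t0)))\<^sup>2"
        using ab by (simp add: field_simps)
      also have "\<dots> = (sqrt (b / a) * exp (- k * (t - t0)) * norm (x0 - xs t0))\<^sup>2"
        using ab by (simp add: power_mult_distrib)
      finally show ?thesis by (rule power2_le_imp_le) (use ab in auto)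
    qed
  qed
qed

lemma const_metric_contractive_with:
  fixes f :: "real^'k \<Rightarrow> real \<Rightarrow> real^'k"
  assumes D: "open D" and c: "0 < c"
    and f': "\<And>x t. x \<in> D \<Longrightarrow> 0 \<le> t \<Longrightarrow> ((\<lambda>y. f y t) has_derivative f' x t) (at x)"
    and contr: "\<And>x t v. x \<in> D \<Longrightarrow> 0 \<le> t \<Longrightarrow> v \<bullet> (Q *v f' x t v) \<le> - c * (v \<bullet> v)"
  obtains k where "contractive_with f D (\<lambda>_ _. Q) k"
proof -
  obtain a b where ab: "0 < a" "0 < b" "\<And>x. a * (x \<bullet> x) \<le> x \<bullet> (Q *v x)" "\<And>x. x \<bullet> (Q *v x) \<le> b * (x \<bullet> x)"
    by (rule pos_def_bounds) blast
  have symQ: "transpose Q = Q" using Q by (simp add: pos_def_def)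
  have deriv0: "deriv_along f (\<lambda>_ _. Q) x t = 0" if "0 \<le> t" for x t
  proof -
    have "(\<lambda>(y, s). Q) = (\<lambda>_ :: (real^'k) \<times> real. Q)" by auto
    \<comment> \<open>At \<open>t = 0\<close> the domain is one-sided in time; uniqueness of the
      derivative is verified with small positive steps along the basis vectors.\<close>
    moreover have "frechet_derivative (\<lambda>_ :: (real^'k) \<times> real. Q) (at (x, t) within UNIV \<times> {0..}) = (\<lambda>_. 0)"
    proof (rule frechet_derivative_unique_within[symmetric])
      show "((\<lambda>_. Q) has_derivative (\<lambda>_. 0)) (at (x, t) within UNIV \<times> {0..})" by simp
      show "((\<lambda>_. Q) has_derivative frechet_derivative (\<lambda>_. Q) (at (x, t) within UNIV \<times> {0..})) (at (x, t) within UNIV \<times> {0..})"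
        by (simp flip: frechet_derivative_works)
      show "\<exists>d. 0 < \<bar>d\<bar> \<and> \<bar>d\<bar> < e \<and> (x, t) + d *\<^sub>R i \<in> UNIV \<times> {0..}"
        if "i \<in> Basis" "0 < e" for i :: "(real^'k) \<times> real" and e
        using that \<open>0 \<le> t\<close> by (intro exI[of _ "e / 2"]) (auto simp: Basis_prod_def)
    qed
    ultimately show ?thesis by (simp add: deriv_along_def)
  qed
  have "contractive_with f D (\<lambda>_ _. Q) (c / b)"
    unfolding contractive_with_def
  proof (intro conjI allI impI ballI exI)
    show "open D" "0 < c / b" using D c ab by auto
    have eq: "(\<lambda>(x :: real^'k, t :: real). Q) = (\<lambda>_. Q)" by auto
    show "Ck_on 1 (UNIV \<times> {0..}) (\<lambda>(x :: real^'k, t :: real). Q)"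
      unfolding eq by (auto intro!: exI[of _ "\<lambda>_ _. 0"])
    show "0 < a" by (rule ab)
    show "pos_semidef (Q - mat a)" "pos_semidef (mat b - Q)"
    proof -
      have "transpose (mat r) = (mat r :: real^'k^'k)" "transpose (X - Y) = transpose X - transpose Y"
        for r and X Y :: "real^'k^'k"
        by (simp_all add: transpose_def mat_def vec_eq_iff)
      then show "pos_semidef (Q - mat a)" "pos_semidef (mat b - Q)"
        using ab symQ by (simp_all add: pos_semidef_def matrix_vector_mult_diff_rdistrib mat_mult_vector inner_diff_right)
    qed
    fix x and t :: real assume x: "x \<in> D" and t: "0 \<le> t"
    show "(\<lambda>y. f y t) differentiable at x" using f'[OF x t] by (auto simp: differentiable_def)
    define A where "A = jacobian (\<lambda>y. f y t) (at x)"
    have A: "A *v v = f' x t v" for v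
      unfolding A_def jacobian_def frechet_derivative_at[OF f'[OF x t], symmetric]
      using matrix_vector_mul(2)[OF has_derivative_linear[OF f'[OF x t]]] by metis
    show "let A = jacobian (\<lambda>y. f y t) (at x) in
        pos_semidef (- (2 * (c / b)) *\<^sub>R Q - (transpose A ** Q + Q ** A + deriv_along f (\<lambda>_ _. Q) x t))"
      unfolding A_def[symmetric] Let_def deriv0[OF t] pos_semidef_def
    proof (intro conjI allI)
      show "transpose (- (2 * (c / b)) *\<^sub>R Q - (transpose A ** Q + Q ** A + 0))
          = - (2 * (c / b)) *\<^sub>R Q - (transpose A ** Q + Q ** A + 0)"
      proof -
        have "transpose (X - (Y + Z)) = transpose X - (transpose Z + transpose Y)" "transpose (- X) = - transpose X"
          for X Y Z :: "real^'k^'k"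
          by (simp_all add: transpose_def vec_eq_iff)
        then show ?thesis by (simp add: matrix_transpose_mul symQ transpose_scalar)
      qed
      fix v
      have "v \<bullet> ((transpose A ** Q) *v v) = v \<bullet> ((Q ** A) *v v)"
        using symQ by (metis dot_lmul_matrix inner_commute matrix_vector_mul_assoc transpose_matrix_vector)
      then have "v \<bullet> ((- (2 * (c / b)) *\<^sub>R Q - (transpose A ** Q + Q ** A + 0)) *v v)
          = - (2 * (c / b)) * (v \<bullet> (Q *v v)) - 2 * (v \<bullet> (Q *v f' x t v))"
        by (simp only: matrix_vector_mult_diff_rdistrib matrix_vector_mult_add_rdistrib add_0_right inner_diff_right
            inner_add_right scaleR_matrix_vector_assoc[symmetric] inner_scaleR_right
            matrix_vector_mul_assoc[symmetric, of Q] A)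
      moreover have "(c / b) * (v \<bullet> (Q *v v)) \<le> (c / b) * (b * (v \<bullet> v))"
        using ab(4) c ab(2) by (intro mult_left_mono) auto
      ultimately show "0 \<le> v \<bullet> ((- (2 * (c / b)) *\<^sub>R Q - (transpose A ** Q + Q ** A + 0)) *v v)"
        using contr[OF x t, of v] ab(2) by simp
    qed
  qed
  then show thesis by (rule that)
qed

end

section \<open>Gradients of energies\<close>

lemma bounded_bilinear_matrix_vector_mult:
  "bounded_bilinear ((*v) :: real^'n^'m \<Rightarrow> real^'n \<Rightarrow> real^'m)"
  unfolding bilinear_conv_bounded_bilinear[symmetric] bilinear_def
  by (auto intro!: linearI simp: matrix_vector_mult_add_rdistrib matrix_vector_right_distrib
      matrix_vector_mult_scaleR scaleR_matrix_vector_assoc)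

lemma bounded_bilinear_differentiable:
  assumes "bounded_bilinear pr" "f differentiable (at x within S)" "g differentiable (at x within S)"
  shows "(\<lambda>x. pr (f x) (g x)) differentiable (at x within S)"
  using assms bounded_bilinear.FDERIV unfolding differentiable_def by blast

lemmas differentiable_matrix_vector_mult = bounded_bilinear_differentiable[OF bounded_bilinear_matrix_vector_mult]
lemmas differentiable_inner_prod = bounded_bilinear_differentiable[OF bounded_bilinear_inner]

lemma bounded_linear_differentiable_comp:
  assumes "bounded_linear h" "f differentiable (at x within S)"
  shows "(\<lambda>x. h (f x)) differentiable (at x within S)"
  using assms bounded_linear.has_derivative unfolding differentiable_def by blast

lemma differentiable_vec_lambda:
  fixes f :: "'a::real_normed_vector \<Rightarrow> 'i::finite \<Rightarrow> 'b::euclidean_space"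
  assumes "\<And>i. (\<lambda>x. f x i) differentiable (at x within S)"
  shows "(\<lambda>x. \<chi> i. f x i) differentiable (at x within S)"
  unfolding differentiable_componentwise_within[of "\<lambda>x. \<chi> i. f x i"]
  by (auto simp: Basis_vec_def inner_axis intro!: differentiable_inner_prod assms)

lemma differentiable_prod:
  fixes f :: "'i \<Rightarrow> 'a::real_normed_vector \<Rightarrow> real"
  assumes "\<And>i. i \<in> I \<Longrightarrow> f i differentiable (at x within S)"
  shows "(\<lambda>x. \<Prod>i\<in>I. f i x) differentiable (at x within S)"
  using assms
  by (induction I rule: infinite_finite_induct) (auto intro!: bounded_bilinear_differentiable[OF bounded_bilinear_mult])

lemma differentiable_det:
  fixes A :: "'a::real_normed_vector \<Rightarrow> real^'n^'n"
  assumes "\<And>i j. (\<lambda>x. A x $ i $ j) differentiable (at x within S)"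
  shows "(\<lambda>x. det (A x)) differentiable (at x within S)"
  unfolding det_def
  by (intro differentiable_sum differentiable_prod bounded_bilinear_differentiable[OF bounded_bilinear_mult] assms
      ballI finite_permutations finite differentiable_const)

section \<open>Inverses of matrix-valued functions\<close>

lemma matrix_inv_works:
  fixes A :: "real^'n^'n"
  assumes "invertible A"
  shows "A ** matrix_inv A = mat 1" "matrix_inv A ** A = mat 1"
  using someI_ex[of "\<lambda>B. A ** B = mat 1 \<and> B ** A = mat 1"] assms
  unfolding matrix_inv_def invertible_def by blast+

lemma pos_def_invertible: "pos_def A \<Longrightarrow> invertible A"
  unfolding invertible_left_inverse matrix_left_invertible_ker pos_def_def
  by (metis inner_zero_right less_irrefl)

lemma matrix_inv_mult_vec:
  fixes A :: "real^'n^'n"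
  assumes "invertible A"
  shows "A *v (matrix_inv A *v x) = x" "matrix_inv A *v (A *v x) = x"
  using matrix_inv_works[OF assms] by (simp_all add: matrix_vector_mul_assoc)

lemma inner_matrix_inv_commute:
  fixes A :: "real^'n^'n"
  assumes "pos_def A"
  shows "x \<bullet> (matrix_inv A *v y) = (matrix_inv A *v x) \<bullet> y"
proof -
  note inv = matrix_inv_mult_vec[OF pos_def_invertible[OF assms]]
  have sym: "u \<bullet> (A *v v) = (A *v u) \<bullet> v" for u v
    using assms unfolding pos_def_def by (metis dot_lmul_matrix transpose_matrix_vector)
  show ?thesis using sym[of "matrix_inv A *v x" "matrix_inv A *v y"] by (simp add: inv)
qed

text \<open>By Cramer's rule every entry of the inverse is a quotient of determinants, which are
  polynomials in the entries.\<close>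

lemma differentiable_matrix_inv:
  fixes A :: "'a::real_normed_vector \<Rightarrow> real^'n^'n"
  assumes A: "A differentiable (at x within S)" and inv: "\<And>x. invertible (A x)"
  shows "(\<lambda>x. matrix_inv (A x)) differentiable (at x within S)"
proof -
  have Aij: "(\<lambda>x. A x $ i $ j) differentiable (at x within S)" for i j
    by (intro bounded_linear_differentiable_comp[OF bounded_linear_vec_nth] A)
  have det0: "det (A x) \<noteq> 0" for x using inv invertible_det_nz by blast
  have "matrix_inv (A x) $ k $ l
      = det (\<chi> i j. if j = k then axis l 1 $ i else A x $ i $ j) / det (A x)" for x k l
  proof -
    have "matrix_inv (A x) $ k $ l = (matrix_inv (A x) *v axis l 1) $ k"
      by (simp add: matrix_vector_mult_def axis_def if_distrib cong: if_cong)
    also have "matrix_inv (A x) *v axis l 1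
        = (\<chi> k. det (\<chi> i j. if j = k then axis l 1 $ i else A x $ i $ j) / det (A x))"
      using cramer[OF det0] matrix_inv_mult_vec(1)[OF inv] by blast
    finally show ?thesis by simp
  qed
  then have "(\<lambda>x. matrix_inv (A x)) = (\<lambda>x. \<chi> k l. det (\<chi> i j. if j = k then axis l 1 $ i else A x $ i $ j) / det (A x))"
    by (simp add: vec_eq_iff fun_eq_iff)
  moreover have "(\<lambda>x. det (\<chi> i j. if j = k then axis l 1 $ i else A x $ i $ j) / det (A x)) differentiable (at x within S)" for k l
  proof -
    have "(\<lambda>x. if j = k then axis l 1 $ i else A x $ i $ j) differentiable (at x within S)" for i j
      using Aij by (cases "j = k") auto
    then show ?thesis
      by (intro differentiable_divide differentiable_det Aij det0) simp_all
  qed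
  ultimately show ?thesis by (simp add: differentiable_vec_lambda)
qed

text \<open>Once differentiability is known, the formula follows by differentiating the constant
  \<open>A x *v (matrix_inv (A x) *v v) = v\<close>.\<close>

lemma has_derivative_matrix_inv_vec:
  fixes A :: "'a::real_normed_vector \<Rightarrow> real^'n^'n"
  assumes A: "(A has_derivative A') (at x)" and inv: "\<And>x. invertible (A x)"
  shows "((\<lambda>x. matrix_inv (A x) *v v) has_derivative (\<lambda>h. - (matrix_inv (A x) *v (A' h *v (matrix_inv (A x) *v v))))) (at x)"
proof -
  have "(\<lambda>x. matrix_inv (A x) *v v) differentiable (at x)"
    using A by (intro differentiable_matrix_vector_mult differentiable_matrix_inv inv) (auto simp: differentiable_def)
  then obtain B' where B': "((\<lambda>x. matrix_inv (A x) *v v) has_derivative B') (at x)"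
    by (auto simp: differentiable_def)
  have "((\<lambda>x. A x *v (matrix_inv (A x) *v v)) has_derivative
      (\<lambda>h. A x *v B' h + A' h *v (matrix_inv (A x) *v v))) (at x)"
    by (rule bounded_bilinear.FDERIV[OF bounded_bilinear_matrix_vector_mult A B'])
  then have "((\<lambda>x. v) has_derivative (\<lambda>h. A x *v B' h + A' h *v (matrix_inv (A x) *v v))) (at x)"
    by (simp add: matrix_inv_mult_vec[OF inv])
  then have "(\<lambda>h. A x *v B' h + A' h *v (matrix_inv (A x) *v v)) = (\<lambda>h. 0)"
    by (rule has_derivative_unique) simp
  then have "A x *v B' h = - (A' h *v (matrix_inv (A x) *v v))" for h
    by (metis add_eq_0_iff2)
  then have "B' h = matrix_inv (A x) *v (- (A' h *v (matrix_inv (A x) *v v)))" for h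
    by (metis matrix_inv_mult_vec(2)[OF inv])
  then have "B' = (\<lambda>h. - (matrix_inv (A x) *v (A' h *v (matrix_inv (A x) *v v))))"
    by (simp add: fun_eq_iff linear_neg[OF matrix_vector_mul_linear])
  with B' show ?thesis by simp
qed

section \<open>Gradients, and the smoothness of the energies\<close>

lemma grad_eqI: "(f has_derivative (\<lambda>h. g \<bullet> h)) (at x) \<Longrightarrow> grad f x = g"
  by (simp add: grad_def vec_eq_iff inner_axis flip: frechet_derivative_at)

lemma has_derivative_grad_nth: "(f has_derivative f') (at x) \<Longrightarrow> grad f x $ i = f' (axis i 1)"
  by (simp add: grad_def flip: frechet_derivative_at)

lemma has_derivative_grad:
  assumes "f differentiable (at x)"
  shows "(f has_derivative (\<lambda>h. grad f x \<bullet> h)) (at x)"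
proof -
  obtain f' where f': "(f has_derivative f') (at x)" using assms by (auto simp: differentiable_def)
  have lin: "linear f'" by (rule has_derivative_linear[OF f'])
  have "f' h = grad f x \<bullet> h" for h
  proof -
    have "f' h = f' (\<Sum>i\<in>UNIV. (h $ i) *\<^sub>R axis i 1)"
      using basis_expansion[of h] by (simp add: scalar_mult_eq_scaleR)
    also have "\<dots> = (\<Sum>i\<in>UNIV. h $ i * grad f x $ i)"
      by (simp add: linear_sum[OF lin] linear_scale[OF lin] has_derivative_grad_nth[OF f'])
    finally show ?thesis by (simp add: inner_vec_def mult.commute)
  qed
  then have "f' = (\<lambda>h. grad f x \<bullet> h)" by auto
  then show ?thesis using f' by simp
qed

lemma Ck_on_SucE:
  assumes "Ck_on (Suc k) S f"
  obtains f' where "\<And>x. x \<in> S \<Longrightarrow> (f has_derivative f' x) (at x within S)" "\<And>v. Ck_on k S (\<lambda>x. f' x v)"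
  using assms by auto

lemma Ck_on_Suc_differentiable: "Ck_on (Suc k) S f \<Longrightarrow> x \<in> S \<Longrightarrow> f differentiable (at x within S)"
  by (auto simp: differentiable_def)

lemma Ck_on_Suc_continuous: "Ck_on (Suc k) S f \<Longrightarrow> continuous_on S f"
  by (meson Ck_on_Suc_differentiable continuous_on_eq_continuous_within differentiable_imp_continuous_within)

text \<open>The last two claims are joint differentiability in position and momentum; they make the
  closed-loop field differentiable, so that its Jacobian can be read off from a Hessian.\<close>

lemma kinetic_energy_grad:
  fixes A :: "real^'n \<Rightarrow> real^'n^'n"
  assumes pd: "\<And>q. pos_def (A q)" and A: "Ck_on 2 UNIV A"
  shows "((\<lambda>q'. p \<bullet> (matrix_inv (A q') *v p)) has_derivative
            (\<lambda>h. grad (\<lambda>q'. p \<bullet> (matrix_inv (A q') *v p)) q \<bullet> h)) (at q)"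
    and "((\<lambda>p'. p' \<bullet> (matrix_inv (A q) *v p')) has_derivative (\<lambda>h. (2 *\<^sub>R (matrix_inv (A q) *v p)) \<bullet> h)) (at p)"
    and "(\<lambda>z. matrix_inv (A (fst z)) *v snd z) differentiable (at w)"
    and "(\<lambda>z. grad (\<lambda>q'. snd z \<bullet> (matrix_inv (A q') *v snd z)) (fst z)) differentiable (at w)"
proof -
  have inv: "invertible (A q)" for q by (rule pos_def_invertible[OF pd])
  obtain A' where A': "\<And>q. (A has_derivative A' q) (at q)" and A'': "\<And>v. Ck_on 1 UNIV (\<lambda>q. A' q v)"
    using A Ck_on_SucE[of 1 UNIV A] by (metis UNIV_I one_add_one plus_1_eq_Suc)
  have comp: "(\<lambda>z. g (fst z)) differentiable (at w)" if "\<And>q. g differentiable (at q)" for g :: "real^'n \<Rightarrow> 'b::real_normed_vector" and w :: "(real^'n) \<times> 'c::real_normed_vector"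
    using differentiable_chain_at[of fst w g] that
    by (auto simp: o_def intro: bounded_linear_imp_differentiable bounded_linear_fst)
  have snd: "snd differentiable (at w)" for w :: "'d::real_normed_vector \<times> 'c::real_normed_vector"
    by (intro bounded_linear_imp_differentiable bounded_linear_snd)
  have Adiff: "A differentiable (at q)" for q using A' by (auto simp: differentiable_def)
  have Bdiff: "(\<lambda>z. matrix_inv (A (fst z))) differentiable (at w)" for w :: "(real^'n) \<times> 'c::real_normed_vector"
    by (intro differentiable_matrix_inv inv comp Adiff)
  have der: "((\<lambda>q'. p \<bullet> (matrix_inv (A q') *v p)) has_derivative
      (\<lambda>h. p \<bullet> (- (matrix_inv (A q) *v (A' q h *v (matrix_inv (A q) *v p)))))) (at q)" for p q
    by (intro has_derivative_inner_right has_derivative_matrix_inv_vec A' inv)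
  then show "((\<lambda>q'. p \<bullet> (matrix_inv (A q') *v p)) has_derivative
      (\<lambda>h. grad (\<lambda>q'. p \<bullet> (matrix_inv (A q') *v p)) q \<bullet> h)) (at q)"
    by (intro has_derivative_grad) (auto simp: differentiable_def)
  have "((\<lambda>p'. p' \<bullet> (matrix_inv (A q) *v p')) has_derivative (\<lambda>h. p \<bullet> (matrix_inv (A q) *v h) + h \<bullet> (matrix_inv (A q) *v p))) (at p)"
    by (intro has_derivative_inner has_derivative_ident
        bounded_linear.has_derivative[OF matrix_vector_mul_bounded_linear[of "matrix_inv (A q)"]])
  moreover have "p \<bullet> (matrix_inv (A q) *v h) + h \<bullet> (matrix_inv (A q) *v p) = (2 *\<^sub>R (matrix_inv (A q) *v p)) \<bullet> h" for h
    using inner_matrix_inv_commute[OF pd, of p q h] by (simp add: inner_commute)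
  ultimately show "((\<lambda>p'. p' \<bullet> (matrix_inv (A q) *v p')) has_derivative (\<lambda>h. (2 *\<^sub>R (matrix_inv (A q) *v p)) \<bullet> h)) (at p)"
    by simp
  show Bp: "(\<lambda>z. matrix_inv (A (fst z)) *v snd z) differentiable (at w)" for w
    by (intro differentiable_matrix_vector_mult Bdiff snd)
  have "grad (\<lambda>q'. p \<bullet> (matrix_inv (A q') *v p)) q
      = (\<chi> i. - ((matrix_inv (A q) *v p) \<bullet> (A' q (axis i 1) *v (matrix_inv (A q) *v p))))" for p q
    unfolding vec_eq_iff has_derivative_grad_nth[OF der] by (simp add: inner_matrix_inv_commute[OF pd])
  moreover have "(\<lambda>z. \<chi> i. - ((matrix_inv (A (fst z)) *v snd z) \<bullet> (A' (fst z) (axis i 1) *v (matrix_inv (A (fst z)) *v snd z))))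
      differentiable (at w)"
  proof (intro differentiable_vec_lambda differentiable_minus differentiable_inner_prod differentiable_matrix_vector_mult Bp)
    fix i :: 'n
    have "(\<lambda>q. A' q (axis i 1)) differentiable (at q)" for q
      using Ck_on_Suc_differentiable[of 0 UNIV _ q] A''[of "axis i 1"] by simp
    then show "(\<lambda>z. A' (fst z) (axis i 1)) differentiable (at w)" by (rule comp)
  qed (rule Bdiff snd)+
  ultimately show "(\<lambda>z. grad (\<lambda>q'. snd z \<bullet> (matrix_inv (A q') *v snd z)) (fst z)) differentiable (at w)"
    by simp
qed

text \<open>Joint differentiability is known, so the total derivative is determined by its
  restrictions to the two coordinate slices.\<close>

lemma kinetic_energy_has_derivative:
  fixes A :: "real^'n \<Rightarrow> real^'n^'n"
  assumes pd: "\<And>q. pos_def (A q)" and A: "Ck_on 2 UNIV A"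
  shows "((\<lambda>z. snd z \<bullet> (matrix_inv (A (fst z)) *v snd z)) has_derivative
    (\<lambda>h. grad (\<lambda>q'. p \<bullet> (matrix_inv (A q') *v p)) q \<bullet> fst h + (2 *\<^sub>R (matrix_inv (A q) *v p)) \<bullet> snd h)) (at (q, p))"
proof -
  let ?f = "\<lambda>z. snd z \<bullet> (matrix_inv (A (fst z)) *v snd z)"
  have "?f differentiable (at (q, p))"
    by (intro differentiable_inner_prod kinetic_energy_grad(3)[OF assms] bounded_linear_imp_differentiable bounded_linear_snd)
  then obtain D where D: "(?f has_derivative D) (at (q, p))" by (auto simp: differentiable_def)
  have "((\<lambda>q'. (q', p)) has_derivative (\<lambda>h. (h, 0))) (at q)" "((\<lambda>p'. (q, p')) has_derivative (\<lambda>h. (0, h))) (at p)"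
    by (auto intro!: derivative_eq_intros)
  from has_derivative_compose[OF this(1) D] has_derivative_compose[OF this(2) D]
  have "((\<lambda>q'. p \<bullet> (matrix_inv (A q') *v p)) has_derivative (\<lambda>h. D (h, 0))) (at q)"
    "((\<lambda>p'. p' \<bullet> (matrix_inv (A q) *v p')) has_derivative (\<lambda>h. D (0, h))) (at p)" by simp_all
  from has_derivative_unique[OF this(1) kinetic_energy_grad(1)[OF assms]]
    has_derivative_unique[OF this(2) kinetic_energy_grad(2)[OF assms]]
  have partial: "D (h, 0) = grad (\<lambda>q'. p \<bullet> (matrix_inv (A q') *v p)) q \<bullet> h"
    "D (0, h) = (2 *\<^sub>R (matrix_inv (A q) *v p)) \<bullet> h" for h
    by (simp_all add: fun_eq_iff)
  have "D = (\<lambda>h. grad (\<lambda>q'. p \<bullet> (matrix_inv (A q') *v p)) q \<bullet> fst h + (2 *\<^sub>R (matrix_inv (A q) *v p)) \<bullet> snd h)"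
  proof
    fix h
    have "D h = D (fst h, 0) + D (0, snd h)"
      using linear_add[OF has_derivative_linear[OF D], of "(fst h, 0)" "(0, snd h)"] by simp
    then show "D h = grad (\<lambda>q'. p \<bullet> (matrix_inv (A q') *v p)) q \<bullet> fst h + (2 *\<^sub>R (matrix_inv (A q) *v p)) \<bullet> snd h"
      by (simp only: partial)
  qed
  with D show ?thesis by simp
qed

text \<open>Smoothness is given only within \<open>UNIV \<times> {0..}\<close>, but every slice of
  constant \<open>t \<ge> 0\<close> lies entirely in that set. The derivatives in \<open>q\<close>
  are therefore unrestricted, even at \<open>t = 0\<close>.\<close>

lemma time_varying_potential_grad:
  fixes U :: "real^'n \<Rightarrow> real \<Rightarrow> real"
  assumes U: "Ck_on 2 (UNIV \<times> {0..}) (\<lambda>(q, t). U q t)"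
  shows "0 \<le> t \<Longrightarrow> ((\<lambda>q. U q t) has_derivative (\<lambda>h. grad (\<lambda>q. U q t) q \<bullet> h)) (at q)"
    and "0 \<le> t \<Longrightarrow> (\<lambda>q. grad (\<lambda>q. U q t) q) differentiable (at q)"
    and "continuous_on (UNIV \<times> {0..}) (\<lambda>z. grad (\<lambda>q. U q (snd z)) (fst z))"
proof -
  let ?S = "UNIV \<times> {0..} :: ((real^'n) \<times> real) set"
  obtain U' where U': "\<And>z. z \<in> ?S \<Longrightarrow> ((\<lambda>(q, t). U q t) has_derivative U' z) (at z within ?S)"
      and U'': "\<And>v. Ck_on 1 ?S (\<lambda>z. U' z v)"
    using U Ck_on_SucE[of 1 ?S] by (metis one_add_one plus_1_eq_Suc)
  have slice: "((\<lambda>q. g (q, t)) has_derivative (\<lambda>h. g' (h, 0))) (at q)"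
    if "(g has_derivative g') (at (q, t) within ?S)" "0 \<le> t" for g :: "(real^'n) \<times> real \<Rightarrow> real" and g' q t
  proof -
    have "((\<lambda>q. (q, t)) has_derivative (\<lambda>h. (h, 0))) (at q)" by (auto intro!: derivative_eq_intros)
    moreover have "(g has_derivative g') (at (q, t) within range (\<lambda>q. (q, t)))"
      by (rule has_derivative_subset[OF that(1)]) (use that in auto)
    ultimately show ?thesis by (rule has_derivative_in_compose)
  qed
  have der: "((\<lambda>q. U q t) has_derivative (\<lambda>h. U' (q, t) (h, 0))) (at q)" if "0 \<le> t" for q t
    using slice[OF U'[of "(q, t)"] that] that by simp
  show "((\<lambda>q. U q t) has_derivative (\<lambda>h. grad (\<lambda>q. U q t) q \<bullet> h)) (at q)" if "0 \<le> t"
    using der[OF that] by (intro has_derivative_grad) (auto simp: differentiable_def)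
  have grad: "grad (\<lambda>q. U q t) q = (\<chi> i. U' (q, t) (axis i 1, 0))" if "0 \<le> t" for q t
    by (simp add: vec_eq_iff has_derivative_grad_nth[OF der[OF that]])
  show "(\<lambda>q. grad (\<lambda>q. U q t) q) differentiable (at q)" if t: "0 \<le> t"
    unfolding grad[OF t]
  proof (rule differentiable_vec_lambda)
    fix i :: 'n
    have "(\<lambda>z. U' z (axis i 1, 0)) differentiable (at (q, t) within ?S)"
      using Ck_on_Suc_differentiable[of 0 ?S _ "(q, t)"] U''[of "(axis i 1, 0)"] t by simp
    then obtain g' where "((\<lambda>z. U' z (axis i 1, 0)) has_derivative g') (at (q, t) within ?S)"
      by (auto simp: differentiable_def)
    from slice[OF this t] show "(\<lambda>q. U' (q, t) (axis i 1, 0)) differentiable (at q)"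
      by (auto simp: differentiable_def)
  qed
  have "Ck_on (Suc 0) ?S (\<lambda>z. U' z (axis i 1, 0))" for i
    using U''[of "(axis i 1, 0)"] by (simp only: One_nat_def)
  from Ck_on_Suc_continuous[OF this] have "continuous_on ?S (\<lambda>z. \<chi> i. U' z (axis i 1, 0))"
    by (rule continuous_on_vec_lambda)
  then show "continuous_on ?S (\<lambda>z. grad (\<lambda>q. U q (snd z)) (fst z))"
    by (rule continuous_on_eq) (auto simp: grad)
qed

section \<open>Block vectors and left annihilators\<close>

lemma blk_vec3 [simp]: "blk1 (vec3 u v w) = u" "blk2 (vec3 u v w) = v" "blk3 (vec3 u v w) = w"
  by (simp_all add: blk1_def blk2_def blk3_def vec3_def)

lemma vec3_eq_iff: "vec3 u v w = vec3 u' v' w' \<longleftrightarrow> u = u' \<and> v = v' \<and> w = w'"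
  by (metis blk_vec3)

lemma inner_vec3: "vec3 u v w \<bullet> x = u \<bullet> blk1 x + v \<bullet> blk2 x + w \<bullet> blk3 (x :: real^('a::finite + 'b::finite + 'c::finite))"
  by (simp add: inner_vec_def sum_plus_type vec3_def blk1_def blk2_def blk3_def)

lemma block3x3_mult_vec3:
  fixes A11 :: "real^'a::finite^'d::finite" and A22 :: "real^'b::finite^'e::finite" and A33 :: "real^'c::finite^'f::finite"
  shows "block3x3 A11 A12 A13 A21 A22 A23 A31 A32 A33 *v vec3 x y z
    = vec3 (A11 *v x + A12 *v y + A13 *v z) (A21 *v x + A22 *v y + A23 *v z) (A31 *v x + A32 *v y + A33 *v z)"
  by (auto simp: vec_eq_iff vec3_def block3x3_def matrix_vector_mult_def sum_plus_type split: sum.splits)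

lemma bounded_linear_blk:
  "bounded_linear (blk1 :: real^('a::finite + 'b::finite + 'c::finite) \<Rightarrow> _)"
  "bounded_linear (blk2 :: real^('a::finite + 'b::finite + 'c::finite) \<Rightarrow> _)"
  "bounded_linear (blk3 :: real^('a::finite + 'b::finite + 'c::finite) \<Rightarrow> _)"
  unfolding linear_conv_bounded_linear[symmetric] blk1_def blk2_def blk3_def
  by (auto intro!: linearI simp: vec_eq_iff)

lemma bounded_linear_vec3:
  "bounded_linear (\<lambda>(u, v, w). vec3 u v w :: real^('a::finite + 'b::finite + 'c::finite))"
  unfolding linear_conv_bounded_linear[symmetric] vec3_def
  by (auto intro!: linearI simp: vec_eq_iff split: sum.splits)

lemma has_vector_derivative_vec3:
  fixes u :: "real \<Rightarrow> real^'a::finite" and v :: "real \<Rightarrow> real^'b::finite" and w :: "real \<Rightarrow> real^'c::finite"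
  assumes "(u has_vector_derivative u') (at t within S)" "(v has_vector_derivative v') (at t within S)"
    "(w has_vector_derivative w') (at t within S)"
  shows "((\<lambda>t. vec3 (u t) (v t) (w t)) has_vector_derivative vec3 u' v' w') (at t within S)"
  using bounded_linear.has_vector_derivative[OF bounded_linear_vec3
      has_vector_derivative_Pair[OF assms(1) has_vector_derivative_Pair[OF assms(2,3)]]] by simp

lemma differentiable_vec3:
  fixes u :: "'z::real_normed_vector \<Rightarrow> real^'a::finite" and v :: "'z \<Rightarrow> real^'b::finite" and w :: "'z \<Rightarrow> real^'c::finite"
  assumes "u differentiable (at t)" "v differentiable (at t)" "w differentiable (at t)"
  shows "(\<lambda>t. vec3 (u t) (v t) (w t)) differentiable (at t)"
proof -
  obtain u' v' w' where "(u has_derivative u') (at t)" "(v has_derivative v') (at t)" "(w has_derivative w') (at t)"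
    using assms by (auto simp: differentiable_def)
  then have "((\<lambda>t. (u t, v t, w t)) has_derivative (\<lambda>h. (u' h, v' h, w' h))) (at t)"
    by (intro has_derivative_Pair)
  from bounded_linear.has_derivative[OF bounded_linear_vec3 this] show ?thesis
    by (auto simp: differentiable_def)
qed

lemma continuous_on_vec3:
  fixes u :: "'z::topological_space \<Rightarrow> real^'a::finite" and v :: "'z \<Rightarrow> real^'b::finite" and w :: "'z \<Rightarrow> real^'c::finite"
  assumes "continuous_on S u" "continuous_on S v" "continuous_on S w"
  shows "continuous_on S (\<lambda>t. vec3 (u t) (v t) (w t))"
  using bounded_linear.continuous_on[OF bounded_linear_vec3 continuous_on_Pair[OF assms(1) continuous_on_Pair[OF assms(2,3)]]]
  by simp

text \<open>A dimension count: the orthogonal complement of the \<open>n - m\<close> rows has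
  dimension \<open>m\<close> and contains the range of \<open>G\<close>, which has the same
  dimension.\<close>

lemma left_annihilator_imp_range:
  fixes G :: "real^'m^'n"
  assumes Gp: "full_rank_left_annihilator Gp G" and rank: "rank G = CARD('m)" and dims: "CARD('m) \<le> CARD('n)"
    and x: "\<And>g. g \<in> set Gp \<Longrightarrow> g \<bullet> x = 0"
  obtains w where "x = G *v w"
proof -
  define A where "A = span (set Gp)"
  define N where "N = {y. \<forall>a\<in>A. orthogonal a y}"
  have len: "length Gp = CARD('n) - CARD('m)" "distinct Gp" "independent (set Gp)" and ann: "\<And>g. g \<in> set Gp \<Longrightarrow> g v* G = 0"
    using Gp by (auto simp: full_rank_left_annihilator_def)
  have "dim A = card (set Gp)" unfolding A_def using len(3) by (simp add: dim_eq_card_independent)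
  also have "\<dots> = CARD('n) - CARD('m)" using len by (simp add: distinct_card)
  finally have "dim A = CARD('n) - CARD('m)" .
  moreover have "dim N + dim A = CARD('n)"
    using dim_subspace_orthogonal_to_vectors[of A UNIV] by (simp add: A_def N_def)
  ultimately have dimN: "dim N = CARD('m)" using dims by simp
  have in_N: "y \<in> N" if "\<And>g. g \<in> set Gp \<Longrightarrow> g \<bullet> y = 0" for y
  proof -
    have "orthogonal y a" if "a \<in> A" for a
      using that \<open>\<And>g. g \<in> set Gp \<Longrightarrow> g \<bullet> y = 0\<close> unfolding A_def
      by (intro orthogonal_to_span[of a "set Gp" y]) (auto simp: orthogonal_def inner_commute)
    then show ?thesis by (simp add: N_def orthogonal_commute)
  qed
  have "range ((*v) G) \<subseteq> N"
    using in_N ann by (auto simp: dot_lmul_matrix[symmetric])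
  moreover have "subspace N" unfolding N_def by (rule subspace_orthogonal_to_vectors)
  moreover have "subspace (range ((*v) G))"
    by (rule linear_subspace_image[OF matrix_vector_mul_linear subspace_UNIV])
  moreover have "dim N \<le> dim (range ((*v) G))" using dimN rank by (simp add: rank_dim_range)
  ultimately have "range ((*v) G) = N" by (intro subspace_dim_equal)
  then show thesis using in_N[of x] x that by auto
qed

text \<open>\<open>|G x|^2\<close> is the inner product of \<open>G^T G x\<close> with
  \<open>x\<close>; in other words, \<open>G^T\<close> is injective on the range of
  \<open>G\<close>.\<close>

lemma gram_kernel:
  fixes G :: "real^'m^'n"
  assumes "transpose G *v (G *v x) = 0"
  shows "G *v x = 0"
proof -
  have "(G *v x) \<bullet> (G *v x) = (transpose G *v (G *v x)) \<bullet> x"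
    by (simp add: dot_lmul_matrix)
  then show ?thesis using assms by simp
qed

lemma pseudo_inv_left_inverse:
  fixes G :: "real^'m^'n"
  assumes "inj ((*v) G)"
  shows "pseudo_inv G *v (G *v x) = x"
proof -
  have "x = 0" if "(transpose G ** G) *v x = 0" for x
    using gram_kernel[of G x] that assms
    by (metis injD matrix_vector_mul_assoc matrix_vector_mult_0_right)
  then have "invertible (transpose G ** G)"
    unfolding invertible_left_inverse matrix_left_invertible_ker by blast
  from matrix_inv_mult_vec(2)[OF this] show ?thesis
    by (simp add: pseudo_inv_def matrix_vector_mul_assoc[symmetric] del: transpose_matrix_vector)
qed

lemma pos_def_inj: "pos_def A \<Longrightarrow> inj ((*v) A)"
  using matrix_inv_mult_vec(2)[OF pos_def_invertible] by (metis injI)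

section \<open>The tracking controller\<close>

text \<open>This makes vector derivatives within a half-line unique, including at its left
  endpoint.\<close>

lemma at_within_atLeast_neq_bot: "a \<le> t \<Longrightarrow> at (t::real) within {a..} \<noteq> bot"
proof -
  assume "a \<le> t"
  moreover have "{a..} \<noteq> {b}" for b :: real
    using atLeast_iff[of "b + 1" a] atLeast_iff[of b a] by (metis add_increasing2 singleton_iff zero_le_one add_cancel_left_right zero_neq_one)
  ultimately have "t islimpt {a..}" by (intro connected_imp_perfect) auto
  then show ?thesis by (simp add: trivial_limit_within)
qed

theorem theorem3:
  fixes M Md :: "real^'n \<Rightarrow> real^'n^'n"
    and V :: "real^'n \<Rightarrow> real"
    and Vd2 :: "real^'n \<Rightarrow> real \<Rightarrow> real"
    and G W1 :: "real^'m^'n"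
    and Gperp :: "(real^'n) list"
    and J Rd :: "real^'n^'n"
    and Kz :: "real^'m^'m"
    and W2 W3 :: "real^'n^'m"
    and d \<mu>1 :: "real^'m"
    and qs ps :: "real \<Rightarrow> real^'n"
    and H :: "real^'n \<Rightarrow> real^'n \<Rightarrow> real"
    and \<Theta> :: "real^'n \<Rightarrow> real^'n \<Rightarrow> real \<Rightarrow> real^'n"
    and \<gamma>1 :: "real \<Rightarrow> real^'m"
    and Hd2 :: "real^('n + 'n + 'm) \<Rightarrow> real \<Rightarrow> real"
    and P2 :: "real^('n + 'n + 'm)^('n + 'n + 'm)"
    and N2 :: "real^(('n + 'n + 'm) + ('n + 'n + 'm))^(('n + 'n + 'm) + ('n + 'n + 'm))"
    and D2 :: "(real^('n + 'n + 'm)) set"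
    and \<alpha>2 \<beta>2 \<epsilon>2 :: real
    and u :: "real^'n \<Rightarrow> real^'n \<Rightarrow> real^'m \<Rightarrow> real \<Rightarrow> real^'m"
    and F :: "real^('n + 'n + 'm) \<Rightarrow> real \<Rightarrow> real^('n + 'n + 'm)"
  assumes dims: "CARD('m) \<le> CARD('n)"
    \<comment> \<open>the mechanical system\<close>
    and M: "\<And>q. pos_def (M q)" "Ck_on 2 UNIV M"
    and V: "\<And>q. 0 \<le> V q" "Ck_on 2 UNIV V"
    and G: "rank G = CARD('m)"
    and Gperp: "full_rank_left_annihilator Gperp G"
    and H: "H = hamiltonian M V"
    and feasible: "feasible_trajectory H G qs ps" "Ck_on 1 {0..} qs" "Ck_on 1 {0..} ps"
    and momentum: "\<And>t. 0 \<le> t \<Longrightarrow> ps t = M (qs t) *v vector_derivative qs (at t within {0..})"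
    \<comment> \<open>the design parameters\<close>
    and Md: "\<And>q. pos_def (Md q)" "Ck_on 2 UNIV Md"
    and Vd2: "\<And>q t. 0 \<le> t \<Longrightarrow> 0 \<le> Vd2 q t" "Ck_on 2 (UNIV \<times> {0..}) (\<lambda>(q, t). Vd2 q t)"
    and Rd: "pos_def Rd"
    and Kz: "pos_def Kz"
    and W: "rank W1 = CARD('m)" "rank W2 = CARD('m)" "rank W3 = CARD('m)"
    and \<Theta>: "\<Theta> = (\<lambda>q p t. (1/2) *\<^sub>R grad (\<lambda>q'. p \<bullet> (matrix_inv (Md q') *v p)) q
                            + grad (\<lambda>q'. Vd2 q' t) q)"
    and \<gamma>1: "\<gamma>1 = (\<lambda>t. matrix_inv (transpose G ** W1 ** Kz) *v
               (transpose G *v (- (transpose J *v \<Theta> (qs t) (ps t) t)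
                                - Rd *v (matrix_inv (Md (qs t)) *v ps t))
                - transpose G *v vector_derivative ps (at t within {0..})))"
    \<comment> \<open>(i)\<close>
    and matching1: "\<And>q p. matrix_inv (M q) *v p = J *v (matrix_inv (Md q) *v p)"
    and matching2: "\<And>q p. \<forall>g\<in>set Gperp.
          g \<bullet> (grad (\<lambda>q'. p \<bullet> (matrix_inv (M q') *v p)) q
               - transpose J *v grad (\<lambda>q'. p \<bullet> (matrix_inv (Md q') *v p)) q
               - 2 *\<^sub>R (Rd *v (matrix_inv (Md q) *v p))) = 0"
    and matching3: "\<And>q \<zeta> t. 0 \<le> t \<Longrightarrow> \<forall>g\<in>set Gperp.
          g \<bullet> (grad V q - transpose J *v grad (\<lambda>q'. Vd2 q' t) q
               + (W1 ** Kz) *v (\<zeta> - \<gamma>1 t)) = 0"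
    \<comment> \<open>(ii)\<close>
    and \<mu>1: "\<mu>1 = pseudo_inv (W1 ** Kz) *v (G *v d)"
    and Hd2: "Hd2 = (\<lambda>\<eta> t. 1/2 * (blk2 \<eta> \<bullet> (matrix_inv (Md (blk1 \<eta>)) *v blk2 \<eta>)) + Vd2 (blk1 \<eta>) t
               + 1/2 * ((blk3 \<eta> - \<gamma>1 t + \<mu>1) \<bullet> (Kz *v (blk3 \<eta> - \<gamma>1 t + \<mu>1))))"
    and P2: "P2 = block3x3 0 J 0
                           (- transpose J) (- Rd) W1
                           W2 W3 0"
    and P2_hurwitz: "hurwitz P2"
    and bounds: "0 < \<alpha>2" "\<alpha>2 < \<beta>2"
    and D2: "open D2"
    and hessian_bounds: "\<And>\<eta> t. \<eta> \<in> D2 \<Longrightarrow> 0 \<le> t \<Longrightarrow>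
          pos_def (hessian (\<lambda>\<eta>'. Hd2 \<eta>' t) \<eta> - mat \<alpha>2) \<and>
          pos_def (mat \<beta>2 - hessian (\<lambda>\<eta>'. Hd2 \<eta>' t) \<eta>)"
    and \<epsilon>2: "0 < \<epsilon>2"
    and N2: "N2 = block2x2 P2 ((1 - \<alpha>2 / \<beta>2) *\<^sub>R (P2 ** transpose P2))
                           (- mat (1 - \<alpha>2 / \<beta>2 + \<epsilon>2)) (- transpose P2)"
    and N2_eigenvalues: "\<And>l. matrix_eigenvalue N2 l \<Longrightarrow> Re l \<noteq> 0"
    \<comment> \<open>(iii)\<close>
    and invariance: "\<And>t. 0 \<le> t \<Longrightarrow>
          W2 *v \<Theta> (qs t) (ps t) t + W3 *v (matrix_inv (Md (qs t)) *v ps t) = 0"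
    \<comment> \<open>the controller and the disturbed closed loop\<close>
    and u: "u = (\<lambda>q p \<zeta> t. pseudo_inv G *v
               (- (transpose J *v \<Theta> q p t) - Rd *v (matrix_inv (Md q) *v p)
                + (W1 ** Kz) *v (\<zeta> - \<gamma>1 t) + grad (\<lambda>q'. H q' p) q))"
    and F: "F = (\<lambda>\<eta> t. let q = blk1 \<eta>; p = blk2 \<eta>; \<zeta> = blk3 \<eta> in
               vec3 (grad (\<lambda>p'. H q p') p)
                    (- grad (\<lambda>q'. H q' p) q + G *v (u q p \<zeta> t + d))
                    (W2 *v \<Theta> q p t + W3 *v (matrix_inv (Md q) *v p)))"
  shows "local_exponential_tracker F D2 qs ps"
proof -
  define WK where "WK = W1 ** Kz"
  define B where "B q = matrix_inv (Md q)" for q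
  define gM where "gM q p = grad (\<lambda>q'. p \<bullet> (matrix_inv (M q') *v p)) q" for q p
  define gD where "gD q p = grad (\<lambda>q'. p \<bullet> (B q' *v p)) q" for q p
  define gU where "gU q t = grad (\<lambda>q'. Vd2 q' t) q" for q t
  note kM = kinetic_energy_grad[OF M, folded gM_def]
  note kD = kinetic_energy_grad[OF Md, folded B_def, folded gD_def]
  note pot = time_varying_potential_grad[OF Vd2(2), folded gU_def]
  have \<Theta>': "\<Theta> q p t = (1/2) *\<^sub>R gD q p + gU q t" for q p t
    by (simp add: \<Theta> gD_def gU_def B_def)

  have injG: "inj ((*v) G)" and injWK: "inj ((*v) WK)"
  proof -
    show "inj ((*v) G)" using G full_rank_injective by blast
    have "inj ((*v) W1)" using W(1) full_rank_injective by blast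
    moreover have "(*v) WK = (*v) W1 \<circ> (*v) Kz" by (simp add: fun_eq_iff WK_def matrix_vector_mul_assoc)
    ultimately show "inj ((*v) WK)" using pos_def_inj[OF Kz] by (simp add: inj_compose)
  qed
  \<comment> \<open>Comparing the third matching equation at two values of \<open>\<zeta>\<close>
    isolates its part linear in \<open>\<zeta>\<close>, so the annihilator kills the columns of
    \<open>WK\<close>.\<close>
  have WK_range: "\<exists>w. WK *v v = G *v w" for v
  proof -
    have "g \<bullet> (WK *v v) = 0" if "g \<in> set Gperp" for g
      using matching3[where t=0 and q=0 and \<zeta>="\<gamma>1 0 + v"] matching3[where t=0 and q=0 and \<zeta>="\<gamma>1 0"] that by (simp add: WK_def inner_add_right)
    then show ?thesis using left_annihilator_imp_range[OF Gperp G dims] by metis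
  qed
  \<comment> \<open>This is the invertibility of the matrix that is inverted in
    \<open>\<gamma>1\<close>.\<close>
  have WK0: "x = 0" if "transpose G *v (WK *v x) = 0" for x
  proof -
    obtain w where w: "WK *v x = G *v w" using WK_range by blast
    then have "WK *v x = WK *v 0" using that gram_kernel[of G w] by simp
    then show ?thesis using injWK by (rule injD[rotated])
  qed
  have disturbance: "WK *v \<mu>1 = G *v d"
  proof -
    \<comment> \<open>\<open>L\<close> expresses \<open>WK\<close> in the columns of
      \<open>G\<close>. It is square and injective, hence invertible, so \<open>G d\<close> lies in
      the range of \<open>WK\<close> and the pseudo-inverse in \<open>\<mu>1\<close> solves for it
      exactly.\<close>
    define L where "L = pseudo_inv G ** WK"
    have GL: "G *v (L *v v) = WK *v v" for v
      using WK_range[of v] pseudo_inv_left_inverse[OF injG]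
      by (auto simp: L_def matrix_vector_mul_assoc[symmetric])
    have "v = 0" if "L *v v = 0" for v
    proof -
      have "WK *v v = WK *v 0" using GL[of v] that by simp
      then show ?thesis using injWK by (rule injD[rotated])
    qed
    then have "invertible L" unfolding invertible_left_inverse matrix_left_invertible_ker by blast
    then have "L *v (matrix_inv L *v d) = d" by (rule matrix_inv_mult_vec)
    then have "G *v d = WK *v (matrix_inv L *v d)" by (metis GL)
    then show ?thesis by (simp add: \<mu>1 WK_def[symmetric] pseudo_inv_left_inverse[OF injWK])
  qed

  have V_grad: "(V has_derivative (\<lambda>h. grad V q \<bullet> h)) (at q)" for q
    using Ck_on_Suc_differentiable[of 1 UNIV V q] V(2) by (intro has_derivative_grad) (simp add: numeral_2_eq_2)
  have H_q: "grad (\<lambda>q'. H q' p) q = (1/2) *\<^sub>R gM q p + grad V q" for q p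
  proof (rule grad_eqI)
    have "((\<lambda>q'. 1/2 * (p \<bullet> (matrix_inv (M q') *v p)) + V q') has_derivative
        (\<lambda>h. 1/2 * (gM q p \<bullet> h) + grad V q \<bullet> h)) (at q)"
      by (intro has_derivative_add has_derivative_mult_right kM(1) V_grad)
    then show "((\<lambda>q'. H q' p) has_derivative (\<lambda>h. ((1/2) *\<^sub>R gM q p + grad V q) \<bullet> h)) (at q)"
      by (simp add: H hamiltonian_def inner_add_left)
  qed
  have H_p: "grad (\<lambda>p'. H q p') p = matrix_inv (M q) *v p" for q p
  proof (rule grad_eqI)
    have "((\<lambda>p'. 1/2 * (p' \<bullet> (matrix_inv (M q) *v p')) + V q) has_derivative
        (\<lambda>h. 1/2 * ((2 *\<^sub>R (matrix_inv (M q) *v p)) \<bullet> h) + 0)) (at p)"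
      by (intro has_derivative_add has_derivative_mult_right kM(2) has_derivative_const)
    then show "((\<lambda>p'. H q p') has_derivative (\<lambda>h. (matrix_inv (M q) *v p) \<bullet> h)) (at p)"
      by (simp add: H hamiltonian_def)
  qed

  \<comment> \<open>The bracket in the controller. It is half the second matching expression plus
    the third, hence annihilated, hence in the range of \<open>G\<close>; so multiplication by
    \<open>pseudo_inv G\<close> and then by \<open>G\<close> returns it unchanged.\<close>
  define X where "X = (\<lambda>q p \<zeta> t. - (transpose J *v \<Theta> q p t) - Rd *v (B q *v p) + WK *v (\<zeta> - \<gamma>1 t) + grad (\<lambda>q'. H q' p) q)"
  have X_range: "\<exists>w. X q p \<zeta> t = G *v w" if t: "0 \<le> t" for q p \<zeta> t
  proof -
    have "g \<bullet> X q p \<zeta> t = 0" if g: "g \<in> set Gperp" for g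
    proof -
      have "X q p \<zeta> t = (1/2) *\<^sub>R (gM q p - transpose J *v gD q p - 2 *\<^sub>R (Rd *v (B q *v p)))
          + (grad V q - transpose J *v gU q t + WK *v (\<zeta> - \<gamma>1 t))"
        by (simp add: X_def \<Theta>' H_q matrix_vector_right_distrib matrix_vector_mult_scaleR algebra_simps
            del: transpose_matrix_vector)
      then show ?thesis
        using matching2[of p q] matching3[OF t, of q \<zeta>] g
        by (simp add: inner_add_right gM_def gD_def B_def gU_def WK_def del: transpose_matrix_vector)
    qed
    then show ?thesis using left_annihilator_imp_range[OF Gperp G dims] by metis
  qed

  \<comment> \<open>The gradient of \<open>Hd2\<close> in closed form, as \<open>grad_Hd2\<close>
    confirms. In the momentum row \<open>W1\<close> turns the shift by \<open>\<mu>1\<close> into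
    \<open>WK *v \<mu>1 = G *v d\<close>.\<close>
  define E where "E = (\<lambda>\<eta> t. vec3 (\<Theta> (blk1 \<eta>) (blk2 \<eta>) t) (B (blk1 \<eta>) *v blk2 \<eta>) (Kz *v (blk3 \<eta> - \<gamma>1 t + \<mu>1)))"
  have P2E: "P2 *v vec3 x y (Kz *v z)
      = vec3 (J *v y) (- (transpose J *v x) - Rd *v y + WK *v z) (W2 *v x + W3 *v y)" for x y z
    by (simp add: P2 block3x3_mult_vec3 uminus_matrix_vector_mult WK_def matrix_vector_mul_assoc
        del: transpose_matrix_vector)
  have F_eq: "F \<eta> t = P2 *v E \<eta> t" if t: "0 \<le> t" for \<eta> t
  proof -
    obtain w where w: "X (blk1 \<eta>) (blk2 \<eta>) (blk3 \<eta>) t = G *v w" using X_range[OF t] by blast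
    have "G *v (u (blk1 \<eta>) (blk2 \<eta>) (blk3 \<eta>) t + d) = X (blk1 \<eta>) (blk2 \<eta>) (blk3 \<eta>) t + WK *v \<mu>1"
    proof -
      have "u (blk1 \<eta>) (blk2 \<eta>) (blk3 \<eta>) t = pseudo_inv G *v X (blk1 \<eta>) (blk2 \<eta>) (blk3 \<eta>) t"
        by (simp only: u X_def B_def WK_def)
      then show ?thesis by (simp add: w pseudo_inv_left_inverse[OF injG] matrix_vector_right_distrib disturbance)
    qed
    then show ?thesis
      unfolding E_def P2E
      by (simp add: F Let_def vec3_eq_iff H_p matching1 X_def B_def matrix_vector_right_distrib
          matrix_vector_mult_diff_distrib del: transpose_matrix_vector)
  qed

  \<comment> \<open>Despite its name, this is the derivative of the desired momentum
    \<open>ps\<close>.\<close>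
  define \<gamma>' where "\<gamma>' t = vector_derivative ps (at t within {0..})" for t
  have target: "solves_on F {0..} (\<lambda>t. vec3 (qs t) (ps t) (- \<mu>1))"
    unfolding solves_on_def
  proof
    fix t :: real assume "t \<in> {0..}"
    then have t: "0 \<le> t" by simp
    obtain us where qs: "(qs has_vector_derivative grad (\<lambda>p. H (qs t) p) (ps t)) (at t within {0..})"
      and ps: "(ps has_vector_derivative (- grad (\<lambda>q. H q (ps t)) (qs t) + G *v us)) (at t within {0..})"
      using feasible(1) t unfolding feasible_trajectory_def by blast
    have ps': "\<gamma>' t = - grad (\<lambda>q. H q (ps t)) (qs t) + G *v us"
      unfolding \<gamma>'_def using t by (intro vector_derivative_within ps) (simp add: at_within_atLeast_neq_bot)
    define r where "r = - (transpose J *v \<Theta> (qs t) (ps t) t) - Rd *v (B (qs t) *v ps t)"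
    obtain w where w: "X (qs t) (ps t) 0 t = G *v w" using X_range[OF t] by blast
    \<comment> \<open>The defect of the desired momentum equation lies in the range of
      \<open>G\<close>. The definition of \<open>\<gamma>1\<close> makes \<open>G^T\<close>
      annihilate it, and therefore it vanishes.\<close>
    have diff: "\<gamma>' t - r + WK *v \<gamma>1 t = G *v (us - w)"
      using w by (simp add: ps' r_def X_def matrix_vector_mult_diff_distrib linear_neg[OF matrix_vector_mul_linear]
          algebra_simps del: transpose_matrix_vector)
    have "invertible (transpose G ** W1 ** Kz)"
      unfolding invertible_left_inverse matrix_left_invertible_ker
      using WK0 by (simp add: WK_def matrix_vector_mul_assoc matrix_mul_assoc)
    then have "(transpose G ** W1 ** Kz) *v \<gamma>1 t = transpose G *v r - transpose G *v \<gamma>' t"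
      unfolding \<gamma>1 r_def B_def \<gamma>'_def by (rule matrix_inv_mult_vec)
    then have "transpose G *v (\<gamma>' t - r + WK *v \<gamma>1 t) = 0"
      by (simp add: WK_def matrix_vector_right_distrib matrix_vector_mult_diff_distrib matrix_vector_mul_assoc
          matrix_mul_assoc del: transpose_matrix_vector)
    then have "G *v (us - w) = 0" unfolding diff by (rule gram_kernel)
    with diff have psr: "\<gamma>' t = r + WK *v (- \<gamma>1 t)"
      by (simp add: linear_neg[OF matrix_vector_mul_linear] algebra_simps)
    \<comment> \<open>At \<open>\<zeta> = - \<mu>1\<close> the shift cancels and the third block of
      the gradient is \<open>- Kz \<gamma>1\<close>, as \<open>psr\<close> requires. Condition (iii)
      makes the controller state stationary.\<close>
    have "F (vec3 (qs t) (ps t) (- \<mu>1)) t = vec3 (grad (\<lambda>p. H (qs t) p) (ps t)) (\<gamma>' t) 0"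
      unfolding F_eq[OF t] E_def P2E
      using invariance[OF t] by (simp add: vec3_eq_iff psr r_def H_p matching1 B_def)
    moreover have "((\<lambda>t. vec3 (qs t) (ps t) (- \<mu>1)) has_vector_derivative
        vec3 (grad (\<lambda>p. H (qs t) p) (ps t)) (\<gamma>' t) 0) (at t within {0..})"
      using qs ps by (intro has_vector_derivative_vec3 has_vector_derivative_const) (simp_all add: ps')
    ultimately show "((\<lambda>t. vec3 (qs t) (ps t) (- \<mu>1)) has_vector_derivative
        F (vec3 (qs t) (ps t) (- \<mu>1)) t) (at t within {0..})" by simp
  qed

  have grad_Hd2: "grad (\<lambda>\<eta>. Hd2 \<eta> t) \<eta> = E \<eta> t" if t: "0 \<le> t" for \<eta> t
  proof (rule grad_eqI)
    note blk = bounded_linear.has_derivative[OF bounded_linear_blk(1) has_derivative_ident]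
      bounded_linear.has_derivative[OF bounded_linear_blk(2) has_derivative_ident]
      bounded_linear.has_derivative[OF bounded_linear_blk(3) has_derivative_ident]
    have kin: "((\<lambda>\<eta>. blk2 \<eta> \<bullet> (B (blk1 \<eta>) *v blk2 \<eta>)) has_derivative
        (\<lambda>h. gD (blk1 \<eta>) (blk2 \<eta>) \<bullet> blk1 h + (2 *\<^sub>R (B (blk1 \<eta>) *v blk2 \<eta>)) \<bullet> blk2 h)) (at \<eta>)"
      (is "(?k has_derivative ?k') _")
      using has_derivative_compose[OF has_derivative_Pair[OF blk(1,2)] kinetic_energy_has_derivative[OF Md]]
      by (simp add: gD_def B_def)
    have quad: "((\<lambda>\<eta>. (blk3 \<eta> - \<gamma>1 t + \<mu>1) \<bullet> (Kz *v (blk3 \<eta> - \<gamma>1 t + \<mu>1))) has_derivative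
        (\<lambda>h. 2 * ((Kz *v (blk3 \<eta> - \<gamma>1 t + \<mu>1)) \<bullet> blk3 h))) (at \<eta>)"
    proof -
      define e where "e = (\<lambda>\<eta> :: real^('n + 'n + 'm). blk3 \<eta> - \<gamma>1 t + \<mu>1)"
      have "(e has_derivative (\<lambda>h. blk3 h - 0 + 0)) (at \<eta>)"
        unfolding e_def by (intro has_derivative_add has_derivative_diff has_derivative_const blk(3))
      then have e: "(e has_derivative blk3) (at \<eta>)" by simp
      from has_derivative_inner[OF e bounded_linear.has_derivative[OF matrix_vector_mul_bounded_linear[of Kz] e]]
      have der: "((\<lambda>\<eta>. e \<eta> \<bullet> (Kz *v e \<eta>)) has_derivative (\<lambda>h. e \<eta> \<bullet> (Kz *v blk3 h) + blk3 h \<bullet> (Kz *v e \<eta>))) (at \<eta>)" .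
      have sym: "e \<eta> \<bullet> (Kz *v blk3 h) + blk3 h \<bullet> (Kz *v e \<eta>) = 2 * ((Kz *v e \<eta>) \<bullet> blk3 h)" for h
        using pos_def_inner_commute[OF Kz, of "e \<eta>" "blk3 h"] inner_commute[of "Kz *v e \<eta>"] by simp
      from der[unfolded sym] show ?thesis by (simp only: e_def)
    qed
    have "((\<lambda>\<eta>. Hd2 \<eta> t) has_derivative (\<lambda>h. 1/2 * ?k' h + gU (blk1 \<eta>) t \<bullet> blk1 h
        + 1/2 * (2 * ((Kz *v (blk3 \<eta> - \<gamma>1 t + \<mu>1)) \<bullet> blk3 h)))) (at \<eta>)"
      unfolding Hd2 B_def[symmetric]
      by (intro has_derivative_add has_derivative_mult_right kin quad
          has_derivative_compose[OF blk(1) pot(1)[OF t]])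
    then show "((\<lambda>\<eta>. Hd2 \<eta> t) has_derivative (\<lambda>h. E \<eta> t \<bullet> h)) (at \<eta>)"
      by (simp add: E_def inner_vec3 \<Theta>' inner_add_left algebra_simps)
  qed
  have blk_diff: "blk1 differentiable (at \<eta>)" "blk2 differentiable (at \<eta>)" "blk3 differentiable (at \<eta>)"
    for \<eta> :: "real^('n + 'n + 'm)"
    using bounded_linear_blk by (auto intro: bounded_linear_imp_differentiable)
  have pair_diff: "(\<lambda>\<eta>. (blk1 \<eta>, blk2 \<eta>)) differentiable (at \<eta>)" for \<eta> :: "real^('n + 'n + 'm)"
    by (intro bounded_linear_imp_differentiable bounded_linear_Pair bounded_linear_blk)
  have E_diff: "(\<lambda>\<eta>. E \<eta> t) differentiable (at \<eta>)" if t: "0 \<le> t" for \<eta> t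
  proof -
    have "(\<lambda>\<eta>. gD (blk1 \<eta>) (blk2 \<eta>)) differentiable (at \<eta>)" "(\<lambda>\<eta>. B (blk1 \<eta>) *v blk2 \<eta>) differentiable (at \<eta>)"
      using differentiable_chain_at[OF pair_diff kD(4)] differentiable_chain_at[OF pair_diff kD(3)] by (simp_all add: o_def)
    moreover have "(\<lambda>\<eta>. gU (blk1 \<eta>) t) differentiable (at \<eta>)"
      using differentiable_chain_at[OF blk_diff(1) pot(2)[OF t]] by (simp add: o_def)
    ultimately show ?thesis
      unfolding E_def \<Theta>'
      by (intro differentiable_vec3 differentiable_add differentiable_diff differentiable_scaleR differentiable_const
          bounded_linear_differentiable_comp[OF matrix_vector_mul_bounded_linear[of Kz]] blk_diff)
  qed
  define S where "S = (\<lambda>\<eta> t. hessian (\<lambda>\<eta>. Hd2 \<eta> t) \<eta>)"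
  have E_deriv: "((\<lambda>\<eta>. E \<eta> t) has_derivative (\<lambda>h. S \<eta> t *v h)) (at \<eta>)" if t: "0 \<le> t" for \<eta> t
  proof -
    have "S \<eta> t = jacobian (\<lambda>\<eta>. E \<eta> t) (at \<eta>)"
      using ext[of "grad (\<lambda>\<eta>. Hd2 \<eta> t)" "\<lambda>\<eta>. E \<eta> t", OF grad_Hd2[OF t]] by (simp add: S_def hessian_def)
    then show ?thesis using jacobian_works[of "\<lambda>\<eta>. E \<eta> t"] E_diff[OF t] by simp
  qed
  have F_deriv: "((\<lambda>\<eta>. F \<eta> t) has_derivative (\<lambda>h. P2 *v (S \<eta> t *v h))) (at \<eta>)" if t: "0 \<le> t" for \<eta> t
    using bounded_linear.has_derivative[OF matrix_vector_mul_bounded_linear[of P2] E_deriv[OF t, of \<eta>]]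
    by (simp add: F_eq[OF t])

  have gD_cont: "continuous_on UNIV (\<lambda>z. gD (fst z) (snd z))" and B_cont: "continuous_on UNIV (\<lambda>z. B (fst z) *v snd z)"
    using kD(3,4) by (auto intro!: differentiable_imp_continuous_on simp: differentiable_on_def differentiable_at_withinI)
  have Bp_cont: "continuous_on T (\<lambda>z. B (a z) *v b z)"
    if "continuous_on T a" "continuous_on T b" for T :: "'z::topological_space set" and a b
  proof -
    have "continuous_on T (\<lambda>z. B (fst (a z, b z)) *v snd (a z, b z))"
      by (rule continuous_on_compose2[OF B_cont continuous_on_Pair[OF that]]) simp
    then show ?thesis by simp
  qed
  have \<Theta>_cont: "continuous_on T (\<lambda>z. \<Theta> (a z) (b z) (c z))"
    if "continuous_on T a" "continuous_on T b" "continuous_on T c" "\<And>z. z \<in> T \<Longrightarrow> 0 \<le> c z"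
    for T :: "'z::topological_space set" and a b c
  proof -
    have "continuous_on T (\<lambda>z. gD (fst (a z, b z)) (snd (a z, b z)))"
      by (rule continuous_on_compose2[OF gD_cont continuous_on_Pair[OF that(1,2)]]) simp
    moreover have "continuous_on T (\<lambda>z. gU (fst (a z, c z)) (snd (a z, c z)))"
      by (rule continuous_on_compose2[OF pot(3) continuous_on_Pair[OF that(1,3)]]) (use that(4) in auto)
    ultimately show ?thesis unfolding \<Theta>' by (intro continuous_intros) simp_all
  qed
  note mat_cont = bounded_linear.continuous_on[OF matrix_vector_mul_bounded_linear]
  \<comment> \<open>\<open>\<gamma>1\<close> contains the derivative of \<open>ps\<close>, so its
    continuity rests on \<open>ps\<close> being C^1 up to the endpoint 0.\<close>
  have \<gamma>1_cont: "continuous_on {0..} \<gamma>1"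
  proof -
    have qs: "continuous_on {0..} qs" and ps: "continuous_on {0..} ps"
      using feasible(2,3) by (auto simp only: One_nat_def intro: Ck_on_Suc_continuous)
    obtain ps' where ps': "\<And>t. t \<in> {0..} \<Longrightarrow> (ps has_derivative ps' t) (at t within {0..})"
      "\<And>v. Ck_on 0 {0..} (\<lambda>t. ps' t v)"
      by (rule Ck_on_SucE[OF feasible(3)[unfolded One_nat_def]]) (rule that)
    have "\<gamma>' t = ps' t 1" if "0 \<le> t" for t
      unfolding \<gamma>'_def
    proof (rule vector_derivative_within)
      have "linear (ps' t)" using ps'(1)[of t] that by (auto intro: has_derivative_linear)
      then have "ps' t = (\<lambda>h. h *\<^sub>R ps' t 1)"
        by (metis linear_scale mult.right_neutral real_scaleR_def)
      then show "(ps has_vector_derivative ps' t 1) (at t within {0..})"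
        using ps'(1)[of t] that by (simp add: has_vector_derivative_def)
    qed (use that in \<open>simp add: at_within_atLeast_neq_bot\<close>)
    moreover have "continuous_on {0..} (\<lambda>t. ps' t 1)" using ps'(2)[of 1] by simp
    ultimately have "continuous_on {0..} \<gamma>'" by (auto intro: continuous_on_eq)
    then show ?thesis
      unfolding \<gamma>1 \<gamma>'_def[symmetric] B_def[symmetric]
      by (intro mat_cont continuous_intros \<Theta>_cont Bp_cont qs ps) simp_all
  qed
  have F_cont: "continuous_on (UNIV \<times> {0..}) (\<lambda>(\<eta>, t). F \<eta> t)"
  proof -
    let ?T = "UNIV \<times> {0..} :: ((real^('n + 'n + 'm)) \<times> real) set"
    have b: "continuous_on ?T (\<lambda>z. blk1 (fst z))" "continuous_on ?T (\<lambda>z. blk2 (fst z))" "continuous_on ?T (\<lambda>z. blk3 (fst z))"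
      by (intro bounded_linear.continuous_on[OF bounded_linear_blk(1)] bounded_linear.continuous_on[OF bounded_linear_blk(2)]
          bounded_linear.continuous_on[OF bounded_linear_blk(3)] continuous_on_fst continuous_on_id)+
    have g: "continuous_on ?T (\<lambda>z. \<gamma>1 (snd z))"
      by (rule continuous_on_compose2[OF \<gamma>1_cont]) (auto intro!: continuous_intros)
    have "continuous_on ?T (\<lambda>z. E (fst z) (snd z))"
      unfolding E_def
      by (intro continuous_on_vec3 \<Theta>_cont Bp_cont mat_cont continuous_on_add continuous_on_diff b g continuous_on_const continuous_on_snd continuous_on_id) auto
    then have "continuous_on ?T (\<lambda>z. P2 *v E (fst z) (snd z))" by (rule mat_cont)
    then show ?thesis by (rule continuous_on_eq) (auto simp: F_eq)
  qed

  obtain Q c where Q: "pos_def Q" "0 < c"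
    and contr': "\<And>S x. transpose S = S \<Longrightarrow>
      \<forall>x. \<alpha>2 * (x \<bullet> x) \<le> x \<bullet> (S *v x) \<and> x \<bullet> (S *v x) \<le> \<beta>2 * (x \<bullet> x) \<Longrightarrow>
      x \<bullet> (Q *v (P2 *v (S *v x))) \<le> - c * (x \<bullet> x)"
    using hamiltonian_matrix_contraction_metric[OF P2_hurwitz bounds \<epsilon>2 N2_eigenvalues[unfolded N2]] by auto
  have S: "transpose (S \<eta> t) = S \<eta> t" "\<alpha>2 * (x \<bullet> x) \<le> x \<bullet> (S \<eta> t *v x)" "x \<bullet> (S \<eta> t *v x) \<le> \<beta>2 * (x \<bullet> x)"
    if "\<eta> \<in> D2" "0 \<le> t" for \<eta> t x
  proof -
    have lo: "pos_def (S \<eta> t - mat \<alpha>2)" and hi: "pos_def (mat \<beta>2 - S \<eta> t)"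
      using hessian_bounds[OF that] by (simp_all add: S_def)
    have nn: "0 \<le> x \<bullet> (A *v x)" if "pos_def A" for A :: "real^('n + 'n + 'm)^('n + 'n + 'm)" and x
      using that by (rule pos_def_nonneg)
    have "transpose (S \<eta> t - mat \<alpha>2) = transpose (S \<eta> t) - mat \<alpha>2"
      by (simp add: vec_eq_iff transpose_def mat_def)
    then show "transpose (S \<eta> t) = S \<eta> t" using lo by (simp add: pos_def_def)
    show "\<alpha>2 * (x \<bullet> x) \<le> x \<bullet> (S \<eta> t *v x)" "x \<bullet> (S \<eta> t *v x) \<le> \<beta>2 * (x \<bullet> x)"
      using nn[OF lo, of x] nn[OF hi, of x]
      by (simp_all add: matrix_vector_mult_diff_rdistrib mat_mult_vector inner_diff_right)
  qed
  have contr: "v \<bullet> (Q *v (P2 *v (S \<eta> t *v v))) \<le> - c * (v \<bullet> v)" if "\<eta> \<in> D2" "0 \<le> t" for \<eta> t v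
    using S[OF that] by (intro contr') auto
  obtain K where K: "0 < K" "\<And>x. norm (P2 *v x) \<le> norm x * K"
    using bounded_linear.pos_bounded[OF matrix_vector_mul_bounded_linear[of P2]] by blast
  have lip: "norm (P2 *v (S \<eta> t *v v)) \<le> (2 * \<beta>2 * K) * norm v" if "\<eta> \<in> D2" "0 \<le> t" for \<eta> t v
  proof -
    \<comment> \<open>\<open>|w - v| \<le> |v|\<close> already gives
      \<open>|S v| \<le> 2 \<beta>2 |v|\<close>, hence a Lipschitz constant uniform over
      \<open>D2\<close> and all times.\<close>
    define w where "w = (1 / \<beta>2) *\<^sub>R (S \<eta> t *v v)"
    have "(norm (w - v))\<^sup>2 \<le> ((1 - \<alpha>2 / \<beta>2) * norm v)\<^sup>2"
      using symmetric_sandwich_norm_le[OF S(1)[OF that] bounds S(2,3)[OF that], of v]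
      by (simp add: w_def power_mult_distrib)
    then have "norm (w - v) \<le> (1 - \<alpha>2 / \<beta>2) * norm v"
      by (rule power2_le_imp_le) (use bounds in simp)
    also have "\<dots> \<le> 1 * norm v" using bounds by (intro mult_right_mono) auto
    finally have "norm w \<le> 2 * norm v" using norm_triangle_ineq[of "w - v" v] by simp
    moreover have "S \<eta> t *v v = \<beta>2 *\<^sub>R w" using bounds by (simp add: w_def)
    ultimately have "norm (S \<eta> t *v v) \<le> \<beta>2 * (2 * norm v)" using bounds by simp
    then have "norm (S \<eta> t *v v) * K \<le> \<beta>2 * (2 * norm v) * K" using K(1) by (intro mult_right_mono) auto
    then show ?thesis using K(2)[of "S \<eta> t *v v"] by (simp add: mult_ac)
  qed
  obtain k where "contractive_with F D2 (\<lambda>_ _. Q) k"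
    by (rule const_metric_contractive_with[OF Q(1) D2 Q(2) F_deriv contr])
  moreover have "exp_attracts_balls F D2 (\<lambda>_ _. Q) (\<lambda>t. vec3 (qs t) (ps t) (- \<mu>1))"
    by (rule const_metric_contraction_attracts_balls[OF Q(1,2) _ F_deriv contr lip F_cont target])
       (use bounds K in \<open>simp_all add: less_imp_le\<close>)
  ultimately show ?thesis
    unfolding local_exponential_tracker_def using target
    by (intro exI[of _ "\<lambda>_. - \<mu>1"] exI[of _ "\<lambda>_ _. Q"] exI[of _ k] conjI)
qed

end
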